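(* Let $S$ be the Schlumprecht space. For every sequence $(n_k)_{k=1}^\infty$ of positive integers, $S$ is isomorphic to $\left(\sum_{k=1}^\infty \oplus\, \ell_\infty^{n_k}\right)_S$.
   Context: Let $c_{00}$ be the linear space of finitely supported scalar sequences with standard basis $(e_i)_{i=1}^\infty$. For finite sets $E,F\subset\mathbb{N}$, write $E<F$ if $\max E<\min F$ or if either $E$ or $F$ is empty; $E_1<E_2<\dots<E_r$ means $E_i<E_j$ for all $i<j$. For $x=\sum_i a_ie_i$ and $E\subset\mathbb{N}$, put $Ex=\sum_{i\in E}a_ie_i$. For $t\ge 1$ let $f(t)=\log_2(t+1)$. The Schlumprecht space $S=(S,\|\cdot\|)$ is the completion of $c_{00}$ with respect to the norm defined by the implicit equation $$\|x\|=\max\Big\{\|x\|_\infty,\ \sup_{r\ge 2,\ E_1<E_2<\dots<E_r}\frac{1}{f(r)}\sum_{i=1}^r\|E_ix\|\Big\},\qquad x\in c_{00},$$ where the $E_i$ are finite subsets of $\mathbb{N}$. The sequence $(e_i)$ is a 1-unconditional and 1-subsymmetric basis of $S$. Given Banach spaces $(X_k,\|\cdot\|_k)$, $k=1,2,\dots$, the sum $\left(\sum_{k=1}^\infty\oplus X_k\right)_S$ is the Banach space of sequences $y=(y_k)$ with $y_k\in X_k$ for which $\sum_k\|y_k\|_k e_k$ converges in $S$, with norm $\left\|\sum_k\|y_k\|_k e_k\right\|$, where $\|\cdot\|$ is the norm of $S$. Here $\ell_\infty^n$ denotes $n$-dimensional scalar space with the maximum norm. Two Banach spaces are isomorphic if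 there is a bounded linear bijection between them with bounded inverse. *)

theory Defs
  imports "HOL-Analysis.Analysis" "HOL-Library.Function_Algebras"
begin

text \<open>
  The scalar field is a type of sort \<open>{real_normed_field, banach}\<close>. By Gelfand--Mazur these are, up
  to isometric isomorphism, exactly the reals and the complex numbers, so both scalar fields are
  covered. Sequences are indexed from 0, and functions carry the pointwise addition of
  Function_Algebras.
\<close>

definition c00 :: "(nat \<Rightarrow> 'k::zero) set" where
  "c00 = {x. finite {i. x i \<noteq> 0}}"

definition unit_seq :: "nat \<Rightarrow> nat \<Rightarrow> 'k::zero_neq_one" where
  "unit_seq k = (\<lambda>i. if i = k then 1 else 0)"

definition coord_proj :: "nat set \<Rightarrow> (nat \<Rightarrow> 'k::zero) \<Rightarrow> nat \<Rightarrow> 'k" where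
  "coord_proj E x = (\<lambda>i. if i \<in> E then x i else 0)"

definition set_before :: "nat set \<Rightarrow> nat set \<Rightarrow> bool" where
  "set_before E F \<longleftrightarrow> E = {} \<or> F = {} \<or> Max E < Min F"

definition schlumprecht_f :: "real \<Rightarrow> real" where
  "schlumprecht_f t = log 2 (t + 1)"

text \<open>
  The implicit equation. If \<open>N\<close> is a seminorm on \<open>c00\<close> (the only use below), then for fixed \<open>x\<close> there
  are only finitely many vectors \<open>coord_proj E x\<close> and \<open>N 0 = 0\<close>, so both suprema are taken over
  nonempty sets that are bounded above. At most one seminorm satisfies the equation: if some
  \<open>E i\<close> contains the support of \<open>x\<close>, the corresponding quotient is \<open>N x / schlumprecht_f r\<close>, which is
  smaller than \<open>N x\<close> unless \<open>x = 0\<close>; otherwise induct on the size of the support.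
\<close>

definition schlumprecht_equation :: "((nat \<Rightarrow> 'k::real_normed_field) \<Rightarrow> real) \<Rightarrow> bool" where
  "schlumprecht_equation N \<longleftrightarrow>
     (\<forall>x\<in>c00. N x =
        max (SUP i. norm (x i))
            (Sup {(\<Sum>i=1..r. N (coord_proj (E i) x)) / schlumprecht_f (real r) | r E.
                    2 \<le> r \<and> (\<forall>i\<in>{1..r}. finite (E i)) \<and>
                    (\<forall>i\<in>{1..r}. \<forall>j\<in>{1..r}. i < j \<longrightarrow> set_before (E i) (E j))}))"

text \<open>
  A Banach space over \<open>'k\<close>: completeness comes from the type class, whose real structure is the
  restriction of the given scalar multiplication.
\<close>

locale banach_space_over = vector_space scale
  for scale :: "'k::{real_normed_field,banach} \<Rightarrow> 's::banach \<Rightarrow> 's" +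
  assumes scale_of_real: "scale (of_real r) v = r *\<^sub>R v"
    and norm_scale: "norm (scale c v) = norm c * norm v"

text \<open>
  The Schlumprecht space as a completion of \<open>c00\<close>: \<open>J\<close> is the canonical linear map of \<open>c00\<close> onto a
  dense subspace, and the Schlumprecht norm of \<open>x\<close> is \<open>norm (J x)\<close>. Injectivity of \<open>J\<close> follows, as
  the equation makes this norm dominate the supremum norm.
\<close>

locale schlumprecht_space = banach_space_over scale
  for scale :: "'k::{real_normed_field,banach} \<Rightarrow> 's::banach \<Rightarrow> 's" +
  fixes J :: "(nat \<Rightarrow> 'k) \<Rightarrow> 's"
  assumes J_add: "x \<in> c00 \<Longrightarrow> y \<in> c00 \<Longrightarrow> J (x + y) = J x + J y"
    and J_scale: "x \<in> c00 \<Longrightarrow> J (\<lambda>i. c * x i) = scale c (J x)"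
    and norm_J: "schlumprecht_equation (\<lambda>x. norm (J x))"
    and J_dense: "closure (J ` c00) = UNIV"

text \<open>
  The sum of the normed spaces with carriers \<open>X k\<close> and norms \<open>nrm k\<close> (inside a common type), formed
  with respect to the sequence \<open>e\<close> of a Banach space.
\<close>

definition direct_sum :: "(nat \<Rightarrow> 's::banach) \<Rightarrow> (nat \<Rightarrow> 'v set) \<Rightarrow> (nat \<Rightarrow> 'v \<Rightarrow> real) \<Rightarrow> (nat \<Rightarrow> 'v) set"
  where "direct_sum e X nrm =
    {y. (\<forall>k. y k \<in> X k) \<and> summable (\<lambda>k. nrm k (y k) *\<^sub>R e k)}"

definition direct_sum_norm :: "(nat \<Rightarrow> 's::banach) \<Rightarrow> (nat \<Rightarrow> 'v \<Rightarrow> real) \<Rightarrow> (nat \<Rightarrow> 'v) \<Rightarrow> real"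
  where "direct_sum_norm e nrm y = norm (\<Sum>k. nrm k (y k) *\<^sub>R e k)"

text \<open>
  The coordinates of a vector of \<open>linf n\<close> are those with index below \<open>n\<close>. The norm is only used for
  positive \<open>n\<close>, where the maximum is over a nonempty set.
\<close>

definition linf :: "nat \<Rightarrow> (nat \<Rightarrow> 'k::zero) set" where
  "linf n = {v. \<forall>i\<ge>n. v i = 0}"

definition linf_norm :: "nat \<Rightarrow> (nat \<Rightarrow> 'k::real_normed_vector) \<Rightarrow> real" where
  "linf_norm n v = Max ((\<lambda>i. norm (v i)) ` {..<n})"

definition isomorphic_spaces ::
  "('k \<Rightarrow> 'a \<Rightarrow> 'a) \<Rightarrow> 'a::ab_group_add set \<Rightarrow> ('a \<Rightarrow> real) \<Rightarrow>
   ('k \<Rightarrow> 'b \<Rightarrow> 'b) \<Rightarrow> 'b::ab_group_add set \<Rightarrow> ('b \<Rightarrow> real) \<Rightarrow> bool" where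
  "isomorphic_spaces scale1 V1 norm1 scale2 V2 norm2 \<longleftrightarrow>
     (\<exists>T. bij_betw T V1 V2 \<and>
        (\<forall>x\<in>V1. \<forall>y\<in>V1. T (x + y) = T x + T y) \<and>
        (\<forall>c. \<forall>x\<in>V1. T (scale1 c x) = scale2 c (T x)) \<and>
        (\<exists>C. \<forall>x\<in>V1. norm2 (T x) \<le> C * norm1 x) \<and>
        (\<exists>C. \<forall>y\<in>V2. norm1 (inv_into V1 T y) \<le> C * norm2 y))"

end

(*
  A sum of spaces l_infinity^{p k} over S is complemented in S for every p. In block k take the
  average w_k of N_k consecutive copies of a vector v_k of norm at most 3 that is a sum of p k
  disjoint pieces, each normed up to a factor 2 by a functional of norm 1; the pieces live on widely different scales
  (a flat vector next to an average of many copies of the previous vector). If N_k grows fast, the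
  blocks w_k are dominated by the basis e_k. For this, one follows nested admissible families: a
  family of r sets norms at most one block k, the one with rho k <= r < rho (k + 1). The point is that
  n2 (x) = max over cuts x = x' + x'' of norm x' + norm x'' satisfies the implicit inequality of S
  without loss, so n2 can pay for that one block with x' and for the later blocks with x''.

  With p 0 = 0 and p (k + 1) = p k + n k, adding the sum for n to the sum for p only shifts the
  latter, and S is isomorphic to its square. Hence, writing S = L(p) + Z, the sum L(n) is isomorphic to
  S + L(n) = Z + L(p) + L(n) = Z + L(p) = S.
*)

theory Submission
  imports Defs
begin

section \<open>The implicit equation\<close>

text \<open>The usual decomposition argument would want L(n) to be isomorphic to its square, but
  L(n) + L(n) is L(2 n), which is not visibly L(n). Absorption into L(p) avoids this; its price is
  that unbounded dimensions have to be realized in S even for constant n. Comparing the blocks with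
  the basis meets two obstacles. Families are nested arbitrarily deep, so a constant lost at each
  level would be fatal: every loss is tied to a block index and is summable over the blocks. And a
  set of the family may cut through a block, while a basis vector cannot be cut. Therefore each
  block is represented by the start of one of its copies, chosen at random, and the norms of the
  selected basis vectors are averaged over all choices; the probability of selecting a point in an
  interval is then the proportion of the copies that start there. The bound 3 solves 1 + c / (3/2) =
  c, where 3/2 bounds f(2) from below; the factor 2 comes from f(N N) \<le> 2 f(N). Bounded
  completeness of the basis allows membership in all sums to be tested on finite pieces.\<close>

lemma schlumprecht_f_mono: "0 \<le> s \<Longrightarrow> s \<le> t \<Longrightarrow> schlumprecht_f s \<le> schlumprecht_f t"
  by (simp add: schlumprecht_f_def)

lemma schlumprecht_f_0 [simp]: "schlumprecht_f 0 = 0"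
  and schlumprecht_f_1 [simp]: "schlumprecht_f 1 = 1"
  by (simp_all add: schlumprecht_f_def)

lemma schlumprecht_f_nonneg: "0 \<le> t \<Longrightarrow> 0 \<le> schlumprecht_f t"
  using schlumprecht_f_mono[of 0 t] by simp

lemma schlumprecht_f_ge_1: "1 \<le> t \<Longrightarrow> 1 \<le> schlumprecht_f t"
  using schlumprecht_f_mono[of 1 t] by simp

text \<open>The least gain of a cut into two or more pieces. It also fixes the ratio 2/3 in the
  definition of \<open>h\<close>.\<close>

lemma schlumprecht_f_2: "3 / 2 \<le> schlumprecht_f 2"
proof -
  have "2 powr (3/2) = (2::real) powr (1 + 1/2)" by simp
  also have "\<dots> = 2 * sqrt 2" by (subst powr_add) (simp add: powr_half_sqrt)
  also have "\<dots> \<le> 3"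
    by (rule power2_le_imp_le) (auto simp: power_mult_distrib)
  finally show ?thesis unfolding schlumprecht_f_def by (subst le_log_iff) auto
qed

lemma schlumprecht_f_ge: "2 \<le> t \<Longrightarrow> 3 / 2 \<le> schlumprecht_f t"
  using schlumprecht_f_mono[of 2 t] schlumprecht_f_2 by simp

lemma schlumprecht_f_double: "0 \<le> t \<Longrightarrow> schlumprecht_f (2 * t) \<le> schlumprecht_f t + 1"
proof -
  assume t: "0 \<le> t"
  have "log 2 (2 * t + 1) \<le> log 2 (2 * (t + 1))" using t by simp
  also have "\<dots> = log 2 (t + 1) + 1" using t by (subst log_mult) auto
  finally show ?thesis by (simp add: schlumprecht_f_def)
qed

text \<open>For a flat vector of length \<open>t\<close> that is spread over \<open>t\<close>
  copies, the normalization of the summing functional changes by a factor of at most 2.\<close>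

lemma schlumprecht_f_square:
  assumes "0 \<le> s" "0 \<le> t" "s \<le> t"
  shows "schlumprecht_f (s * t) \<le> 2 * schlumprecht_f t"
proof -
  have "s * t + 1 \<le> t * t + 2 * t + 1"
    using assms mult_right_mono[of s t t] by simp
  also have "\<dots> = (t + 1)^2" by (simp add: power2_eq_square algebra_simps)
  finally have "log 2 (s * t + 1) \<le> log 2 ((t+1)^2)"
    using assms by (subst log_le_cancel_iff) (auto simp: add_nonneg_pos)
  also have "\<dots> = 2 * log 2 (t+1)" using assms by (simp add: log_nat_power)
  finally show ?thesis by (simp add: schlumprecht_f_def)
qed

lemma schlumprecht_f_pow2: "real n \<le> schlumprecht_f (2 ^ n)"
  "schlumprecht_f (2 ^ n) \<le> real n + 1"
proof -
  have "real n = log 2 (2 ^ n)" by simp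
  also have "\<dots> \<le> log 2 (2 ^ n + 1)" by (subst log_le_cancel_iff) (auto simp: add_pos_pos)
  finally show "real n \<le> schlumprecht_f (2 ^ n)" by (simp add: schlumprecht_f_def)
  have "log 2 (2 ^ n + 1) \<le> log 2 (2 ^ Suc n)" by (subst log_le_cancel_iff) (auto simp: add_pos_pos)
  also have "\<dots> = real (Suc n)" by (subst log_nat_power) auto
  finally show "schlumprecht_f (2 ^ n) \<le> real n + 1" by (simp add: schlumprecht_f_def)
qed

lemma schlumprecht_f_le_self: "schlumprecht_f (real n) \<le> real n"
proof -
  have "real n + 1 \<le> 2 ^ n"
    using less_exp[of n] by (metis Suc_eq_plus1 Suc_leI of_nat_1 of_nat_add of_nat_le_iff of_nat_numeral of_nat_power)
  then have "log 2 (real n + 1) \<le> log 2 (2 ^ n)" by (subst log_le_cancel_iff) auto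
  then show ?thesis by (simp add: schlumprecht_f_def)
qed

lemma schlumprecht_f_unbounded: "\<exists>R. \<forall>r\<ge>R. B \<le> schlumprecht_f (real r)"
proof -
  obtain n where n: "B \<le> real n" using real_arch_simple by blast
  show ?thesis
  proof (intro exI allI impI)
    fix r :: nat assume "2 ^ n \<le> r"
    then have "2 ^ n \<le> real r" by (metis of_nat_le_iff of_nat_numeral of_nat_power)
    with schlumprecht_f_mono[of "2^n" "real r"] schlumprecht_f_pow2(1)[of n] n
    show "B \<le> schlumprecht_f (real r)" by simp
  qed
qed

text \<open>For fixed \<open>b\<close>, both sides of \<open>1 + a b \<le> (1 + a) powr f b\<close> agree at \<open>a = 0\<close> and \<open>a = 1\<close>, and
  the right-hand side is convex in \<open>a\<close>.\<close>

lemma schlumprecht_f_submult: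
  assumes "1 \<le> a" "1 \<le> b"
  shows "schlumprecht_f (a * b) \<le> schlumprecht_f a * schlumprecht_f b"
proof -
  define \<beta> where "\<beta> = schlumprecht_f b"
  have \<beta>: "1 \<le> \<beta>" using assms schlumprecht_f_ge_1 by (simp add: \<beta>_def)
  have b: "2 powr \<beta> = b + 1" using assms by (simp add: \<beta>_def schlumprecht_f_def)
  have conv: "convex_on {0<..} (\<lambda>t::real. t powr \<beta>)"
    using powr_convex[OF \<beta>] .
  have "2 powr \<beta> \<le> (1 - 1 / a) * 1 powr \<beta> + (1 / a) * (1 + a) powr \<beta>"
  proof -
    have e: "(1 - 1 / a) *\<^sub>R 1 + (1 / a) *\<^sub>R (1 + a) = (2::real)" using assms by (simp add: field_simps)
    show ?thesis
      using convex_onD[OF conv, of "1/a" 1 "1 + a"] assms unfolding e by simp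
  qed
  then have "a * 2 powr \<beta> \<le> a * ((1 - 1 / a) * 1 powr \<beta> + (1 / a) * (1 + a) powr \<beta>)"
    using assms by (intro mult_left_mono) auto
  also have "\<dots> = (a - 1) + (1 + a) powr \<beta>"
    using assms by (simp add: distrib_left right_diff_distrib)
  finally have "a * (b + 1) \<le> (a - 1) + (1 + a) powr \<beta>" unfolding b .
  then have "a * b + 1 \<le> (1 + a) powr \<beta>" by (simp add: algebra_simps)
  then have "log 2 (a * b + 1) \<le> log 2 ((1 + a) powr \<beta>)"
    using assms by (subst log_le_cancel_iff) (auto simp: add_pos_pos)
  also have "\<dots> = \<beta> * log 2 (1 + a)" using assms by (simp add: log_powr)
  finally show ?thesis by (simp add: schlumprecht_f_def \<beta>_def add.commute mult.commute)
qed

text \<open>Concavity: the graph lies below its tangent at \<open>r\<close>. Summed with weights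
  this takes the place of Jensen's inequality.\<close>

lemma schlumprecht_f_tangent:
  assumes "0 \<le> z" "0 \<le> r"
  shows "schlumprecht_f z \<le> schlumprecht_f r + (z - r) / ((1 + r) * ln 2)"
proof -
  have "ln ((1 + z) / (1 + r)) \<le> (1 + z) / (1 + r) - 1"
    using assms by (intro ln_le_minus_one) simp
  then have "ln (1 + z) \<le> ln (1 + r) + (z - r) / (1 + r)"
    using assms by (simp add: ln_div field_simps)
  then have "ln (1 + z) / ln 2 \<le> (ln (1 + r) + (z - r) / (1 + r)) / ln 2"
    by (intro divide_right_mono) auto
  then show ?thesis by (simp add: schlumprecht_f_def log_def add.commute add_divide_distrib)
qed

text \<open>The induction step for the norm of a flat vector. Submultiplicativity replaces l / f(l)
  by l f(s / l) / f(s), and by concavity the mean of the values f(s / l) with weights l / s is at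
  most f(r).\<close>

lemma flat_sum_le:
  fixes l :: "nat \<Rightarrow> nat"
  assumes s: "(\<Sum>i<r. l i) = s" "0 < s"
  shows "(\<Sum>i<r. real (l i) / schlumprecht_f (real (l i))) \<le>
    schlumprecht_f (real r) * (real s / schlumprecht_f (real s))"
proof -
  \<comment> \<open>Pieces of length 0 drop out because their quotient is 0 / 0 = 0.\<close>
  define I where "I = {i. i < r \<and> 0 < l i}"
  have fin: "finite I" by (simp add: I_def)
  have sI: "(\<Sum>i\<in>I. real (l i)) = real s"
  proof -
    have "(\<Sum>i\<in>I. real (l i)) = (\<Sum>i<r. real (l i))"
      by (rule sum.mono_neutral_left) (auto simp: I_def)
    then show ?thesis using s by (metis of_nat_sum)
  qed
  have fs: "1 \<le> schlumprecht_f (real s)" using s schlumprecht_f_ge_1 by simp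
  have le_s: "l i \<le> s" if "i \<in> I" for i
    using that s member_le_sum[of i "{..<r}" l] by (auto simp: I_def)
  have "(\<Sum>i<r. real (l i) / schlumprecht_f (real (l i))) =
      (\<Sum>i\<in>I. real (l i) / schlumprecht_f (real (l i)))"
    by (rule sum.mono_neutral_right) (auto simp: I_def)
  also have "\<dots> \<le> (\<Sum>i\<in>I. real (l i) * schlumprecht_f (real s / real (l i)) / schlumprecht_f (real s))"
  proof (rule sum_mono)
    fix i assume i: "i \<in> I"
    have l: "1 \<le> real (l i)" using i by (simp add: I_def)
    have "schlumprecht_f (real s) = schlumprecht_f (real (l i) * (real s / real (l i)))"
      using l by simp
    also have "\<dots> \<le> schlumprecht_f (real (l i)) * schlumprecht_f (real s / real (l i))"
      using l le_s[OF i] by (intro schlumprecht_f_submult) (auto simp: field_simps)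
    finally have "schlumprecht_f (real s) \<le> \<dots>" .
    then have "real (l i) * schlumprecht_f (real s) \<le>
        real (l i) * (schlumprecht_f (real (l i)) * schlumprecht_f (real s / real (l i)))"
      using l by (intro mult_left_mono) auto
    then show "real (l i) / schlumprecht_f (real (l i)) \<le>
        real (l i) * schlumprecht_f (real s / real (l i)) / schlumprecht_f (real s)"
      using fs schlumprecht_f_ge_1[OF l] by (simp add: field_simps)
  qed
  \<comment> \<open>The tangent at \<open>r\<close> is used at each point \<open>s / l i\<close>.
    The linear corrections add up to something nonpositive, as there are at most \<open>r\<close>
    nonempty pieces.\<close>
  also have "\<dots> \<le> (\<Sum>i\<in>I. (real (l i) * schlumprecht_f (real r) +
        (real s - real (l i) * real r) / ((1 + real r) * ln 2)) / schlumprecht_f (real s))"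
  proof (intro sum_mono divide_right_mono)
    fix i assume i: "i \<in> I"
    then have l: "0 < real (l i)" by (simp add: I_def)
    have "real (l i) * schlumprecht_f (real s / real (l i)) \<le> real (l i) *
      (schlumprecht_f (real r) + (real s / real (l i) - real r) / ((1 + real r) * ln 2))"
      using l by (intro mult_left_mono schlumprecht_f_tangent) auto
    also have "\<dots> = real (l i) * schlumprecht_f (real r) +
        (real s - real (l i) * real r) / ((1 + real r) * ln 2)"
      using l by (simp add: distrib_left right_diff_distrib)
    finally show "real (l i) * schlumprecht_f (real s / real (l i)) \<le> \<dots>" .
  qed (use fs in auto)
  also have "\<dots> = (real s * schlumprecht_f (real r) +
      (\<Sum>i\<in>I. real s - real (l i) * real r) / ((1 + real r) * ln 2)) / schlumprecht_f (real s)"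
    by (simp add: sum.distrib sI flip: sum_divide_distrib sum_distrib_right)
  also have "\<dots> \<le> (real s * schlumprecht_f (real r)) / schlumprecht_f (real s)"
  proof -
    have "card I \<le> r" using card_mono[of "{..<r}" I] by (auto simp: I_def)
    then have "real (card I) * real s \<le> real r * real s" by (intro mult_right_mono) auto
    moreover have "(\<Sum>i\<in>I. real s - real (l i) * real r) = real (card I) * real s - real r * real s"
      by (simp add: sum_subtractf sI flip: sum_distrib_right)
    ultimately have "(\<Sum>i\<in>I. real s - real (l i) * real r) \<le> 0" by simp
    then show ?thesis using fs by (intro divide_right_mono) (auto simp: divide_nonpos_nonneg)
  qed
  finally show ?thesis by (simp add: mult.commute)
qed

section \<open>Admissible families and norms satisfying the equation\<close>

definition admissible :: "nat \<Rightarrow> (nat \<Rightarrow> nat set) \<Rightarrow> bool" where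
  "admissible r E \<longleftrightarrow> 2 \<le> r \<and> (\<forall>i\<in>{1..r}. finite (E i)) \<and>
     (\<forall>i\<in>{1..r}. \<forall>j\<in>{1..r}. i < j \<longrightarrow> set_before (E i) (E j))"

lemma admissible_less:
  assumes "admissible r E" "i \<in> {1..r}" "j \<in> {1..r}" "i < j" "a \<in> E i" "b \<in> E j"
  shows "a < b"
proof -
  have "a \<le> Max (E i)" "Min (E j) \<le> b"
    using assms by (auto simp: admissible_def)
  moreover have "Max (E i) < Min (E j)"
    using assms unfolding admissible_def set_before_def by blast
  ultimately show ?thesis by simp
qed

lemma admissible_disjoint:
  assumes "admissible r E" "i \<in> {1..r}" "j \<in> {1..r}" "i \<noteq> j"
  shows "E i \<inter> E j = {}"
  using admissible_less[OF assms(1)] assms(2-4)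
  by (metis disjoint_iff less_irrefl nat_neq_iff)

text \<open>Two instances occur: the given norm over the scalar field, and its restriction to real
  sequences, on which the estimates for the blocks are carried out.\<close>

locale schlumprecht_norm =
  fixes F :: "(nat \<Rightarrow> 'k::real_normed_field) \<Rightarrow> real"
  assumes equation: "schlumprecht_equation F"
    and triangle: "x \<in> c00 \<Longrightarrow> y \<in> c00 \<Longrightarrow> F (x + y) \<le> F x + F y"
    and homogeneous: "x \<in> c00 \<Longrightarrow> F (\<lambda>i. c * x i) = norm c * F x"

lemma zero_c00 [simp]: "(\<lambda>_. 0) \<in> c00"
  by (simp add: c00_def)

lemma coord_proj_c00: "x \<in> c00 \<Longrightarrow> coord_proj E x \<in> c00"
  unfolding c00_def coord_proj_def by (auto elim: rev_finite_subset)

lemma unit_seq_c00: "unit_seq k \<in> c00"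
  unfolding c00_def unit_seq_def by simp

lemma scale_c00: "x \<in> c00 \<Longrightarrow> (\<lambda>i. c * x i :: 'k::real_normed_field) \<in> c00"
  unfolding c00_def by (auto elim: rev_finite_subset)

lemma c00_norm_bdd:
  assumes "x \<in> c00" shows "bdd_above (range (\<lambda>i. norm (x i :: 'k::real_normed_field)))"
proof -
  have "range (\<lambda>i. norm (x i)) \<subseteq> insert 0 ((\<lambda>i. norm (x i)) ` {i. x i \<noteq> 0})" by auto
  then have "finite (range (\<lambda>i. norm (x i)))"
    using assms by (auto simp: c00_def elim: finite_subset)
  then show ?thesis by (rule bdd_above_finite)
qed

context schlumprecht_norm
begin

lemma F_0 [simp]: "F (\<lambda>_. 0) = 0"
  using homogeneous[of "\<lambda>_. 0" 0] by simp

lemma coord_proj_le: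
  assumes "x \<in> c00" "finite A"
  shows "F (coord_proj A x) \<le> (\<Sum>j\<in>A. norm (x j) * F (unit_seq j))"
  using assms(2)
proof (induction A)
  case empty
  then show ?case by (simp add: coord_proj_def)
next
  case (insert j A)
  have "coord_proj (insert j A) x = coord_proj A x + (\<lambda>i. x j * unit_seq j i)"
    using insert.hyps by (auto simp: coord_proj_def unit_seq_def fun_eq_iff)
  then have "F (coord_proj (insert j A) x) \<le> F (coord_proj A x) + F (\<lambda>i. x j * unit_seq j i)"
    using triangle[OF coord_proj_c00[OF assms(1)] scale_c00[OF unit_seq_c00]] by simp
  also have "F (\<lambda>i. x j * unit_seq j i) = norm (x j) * F (unit_seq j)"
    by (rule homogeneous[OF unit_seq_c00])
  finally show ?case using insert by simp
qed

lemma F_nonneg: "x \<in> c00 \<Longrightarrow> 0 \<le> F x"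
proof -
  assume x: "x \<in> c00"
  have "F (x + (\<lambda>i. (- 1) * x i)) \<le> F x + F (\<lambda>i. (- 1) * x i)"
    by (rule triangle[OF x scale_c00[OF x]])
  also have "F (\<lambda>i. (- 1) * x i) = F x" using homogeneous[OF x, of "- 1"] by simp
  also have "x + (\<lambda>i. (- 1) * x i) = (\<lambda>_. 0)" by (auto simp: fun_eq_iff)
  finally show ?thesis by simp
qed

text \<open>A bound independent of the family makes the set of quotients bounded above, without
  which its \<open>Sup\<close> would carry no information.\<close>

lemma quotients_bdd:
  assumes x: "x \<in> c00" and adm: "admissible r E"
  shows "(\<Sum>i=1..r. F (coord_proj (E i) x)) \<le> (\<Sum>j | x j \<noteq> 0. norm (x j) * F (unit_seq j))"
proof -
  let ?S = "{j. x j \<noteq> 0}"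
  have S: "finite ?S" using x by (simp add: c00_def)
  have "(\<Sum>i=1..r. F (coord_proj (E i) x)) \<le>
      (\<Sum>i=1..r. \<Sum>j\<in>E i \<inter> ?S. norm (x j) * F (unit_seq j))"
  proof (rule sum_mono)
    fix i
    have "coord_proj (E i) x = coord_proj (E i \<inter> ?S) x" by (auto simp: coord_proj_def)
    then show "F (coord_proj (E i) x) \<le> (\<Sum>j\<in>E i \<inter> ?S. norm (x j) * F (unit_seq j))"
      using coord_proj_le[OF x, of "E i \<inter> ?S"] S by simp
  qed
  also have "\<dots> = (\<Sum>j\<in>(\<Union>i\<in>{1..r}. E i \<inter> ?S). norm (x j) * F (unit_seq j))"
    using S admissible_disjoint[OF adm] by (subst sum.UNION_disjoint) blast+
  also have "\<dots> \<le> (\<Sum>j\<in>?S. norm (x j) * F (unit_seq j))"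
    using S by (intro sum_mono2) (auto intro!: mult_nonneg_nonneg F_nonneg unit_seq_c00)
  finally show ?thesis .
qed

lemma equation':
  assumes "x \<in> c00"
  shows "F x = max (SUP i. norm (x i)) (Sup {(\<Sum>i=1..r. F (coord_proj (E i) x)) /
    schlumprecht_f (real r) | r E. admissible r E})"
  using equation assms unfolding schlumprecht_equation_def admissible_def by auto

lemma norm_le_F:
  assumes "x \<in> c00" shows "norm (x i) \<le> F x"
proof -
  have "norm (x i) \<le> (SUP i. norm (x i))"
    by (rule cSUP_upper[OF UNIV_I c00_norm_bdd[OF assms]])
  then show ?thesis using equation'[OF assms] by simp
qed

lemma F_lower:
  assumes x: "x \<in> c00" and adm: "admissible r E"
  shows "(\<Sum>i=1..r. F (coord_proj (E i) x)) \<le> schlumprecht_f (real r) * F x"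
proof -
  let ?S = "{(\<Sum>i=1..r. F (coord_proj (E i) x)) / schlumprecht_f (real r) | r E. admissible r E}"
  let ?B = "\<Sum>j | x j \<noteq> 0. norm (x j) * F (unit_seq j)"
  have "bdd_above ?S"
  proof (rule bdd_aboveI[of _ ?B])
    fix y assume "y \<in> ?S"
    then obtain r E where y: "y = (\<Sum>i=1..r. F (coord_proj (E i) x)) / schlumprecht_f (real r)"
      and *: "admissible r E" by auto
    have f: "1 \<le> schlumprecht_f (real r)"
      using * by (intro schlumprecht_f_ge_1) (auto simp: admissible_def)
    have "y \<le> (\<Sum>i=1..r. F (coord_proj (E i) x)) / 1" unfolding y
      using f by (intro divide_left_mono sum_nonneg) (auto intro!: F_nonneg coord_proj_c00 x)
    with quotients_bdd[OF x *] show "y \<le> ?B" by simp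
  qed
  then have "(\<Sum>i=1..r. F (coord_proj (E i) x)) / schlumprecht_f (real r) \<le> Sup ?S"
    using adm by (intro cSup_upper) auto
  also have "\<dots> \<le> F x" using equation'[OF x] by simp
  finally have *: "(\<Sum>i=1..r. F (coord_proj (E i) x)) / schlumprecht_f (real r) \<le> F x" .
  have "1 \<le> schlumprecht_f (real r)"
    using adm by (intro schlumprecht_f_ge_1) (auto simp: admissible_def)
  then show ?thesis using * by (simp add: field_simps)
qed

lemma F_upper:
  assumes x: "x \<in> c00" and sup: "\<And>i. norm (x i) \<le> B"
    and *: "\<And>r E. admissible r E \<Longrightarrow> (\<Sum>i=1..r. F (coord_proj (E i) x)) \<le> schlumprecht_f (real r) * B"
  shows "F x \<le> B"
proof -
  have "Sup {(\<Sum>i=1..r. F (coord_proj (E i) x)) / schlumprecht_f (real r) | r E. admissible r E} \<le> B"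
  proof (rule cSup_least)
    have "admissible 2 (\<lambda>_. {})" by (simp add: admissible_def set_before_def)
    then show "{(\<Sum>i=1..r. F (coord_proj (E i) x)) / schlumprecht_f (real r) | r E. admissible r E} \<noteq> {}"
      by blast
  next
    fix y assume "y \<in> {(\<Sum>i=1..r. F (coord_proj (E i) x)) / schlumprecht_f (real r) | r E. admissible r E}"
    then obtain r E where y: "y = (\<Sum>i=1..r. F (coord_proj (E i) x)) / schlumprecht_f (real r)"
      and **: "admissible r E" by auto
    have f: "1 \<le> schlumprecht_f (real r)"
      using ** by (intro schlumprecht_f_ge_1) (auto simp: admissible_def)
    show "y \<le> B" using *[OF **] f unfolding y by (simp add: field_simps)
  qed
  moreover have "(SUP i. norm (x i)) \<le> B" by (rule cSUP_least) (auto intro: sup)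
  ultimately show ?thesis using equation'[OF x] by simp
qed

text \<open>Families in which one member sees all of \<open>x\<close> contribute at most \<open>F x / f 2 < F x\<close>.\<close>

lemma F_upper_strict:
  assumes x: "x \<in> c00" and B: "0 \<le> B" and sup: "\<And>i. norm (x i) \<le> B"
    and *: "\<And>r E. admissible r E \<Longrightarrow> \<not> (\<Sum>i=1..r. F (coord_proj (E i) x)) \<le> F x \<Longrightarrow>
      (\<Sum>i=1..r. F (coord_proj (E i) x)) \<le> schlumprecht_f (real r) * B"
  shows "F x \<le> B"
proof -
  \<comment> \<open>The second entry of the maximum accommodates the exceptional families.
    Afterwards it is discarded: \<open>F x \<le> F x / schlumprecht_f 2\<close> forces
    \<open>F x \<le> 0\<close>.\<close>
  let ?t = "max B (F x / schlumprecht_f 2)"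
  have "F x \<le> ?t"
  proof (rule F_upper[OF x])
    show "norm (x i) \<le> ?t" for i using sup[of i] by simp
    fix r E assume adm: "admissible r E"
    then have f: "schlumprecht_f 2 \<le> schlumprecht_f (real r)"
      by (intro schlumprecht_f_mono) (auto simp: admissible_def)
    note f2 = schlumprecht_f_2
    show "(\<Sum>i=1..r. F (coord_proj (E i) x)) \<le> schlumprecht_f (real r) * ?t"
    proof (cases "(\<Sum>i=1..r. F (coord_proj (E i) x)) \<le> F x")
      case True
      also have "F x = schlumprecht_f 2 * (F x / schlumprecht_f 2)" using f2 by simp
      also have "\<dots> \<le> schlumprecht_f (real r) * ?t"
        using f f2 F_nonneg[OF x] by (intro mult_mono) (auto intro: divide_nonneg_nonneg)
      finally show ?thesis .
    next
      case False
      note *[OF adm False]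
      also have "schlumprecht_f (real r) * B \<le> schlumprecht_f (real r) * ?t"
        using f f2 by (intro mult_left_mono) auto
      finally show ?thesis .
    qed
  qed
  moreover have "F x \<le> B" if "F x \<le> F x / schlumprecht_f 2"
  proof -
    have "F x * schlumprecht_f 2 \<le> F x" using that schlumprecht_f_2 by (simp add: field_simps)
    moreover have "F x * (3/2) \<le> F x * schlumprecht_f 2"
      using schlumprecht_f_2 F_nonneg[OF x] by (intro mult_left_mono)
    ultimately show ?thesis using B by linarith
  qed
  ultimately show ?thesis by linarith
qed

end

text \<open>Taken for one and the same norm this is 1-unconditionality; for two norms it is uniqueness.\<close>

lemma schlumprecht_norm_compare:
  fixes F :: "(nat \<Rightarrow> 'k::real_normed_field) \<Rightarrow> real" and G :: "(nat \<Rightarrow> 'l::real_normed_field) \<Rightarrow> real"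
  assumes "schlumprecht_norm F" "schlumprecht_norm G"
  assumes "x \<in> c00" "y \<in> c00" "\<And>i. norm (x i) \<le> norm (y i)"
  shows "F x \<le> G y"
proof -
  interpret F: schlumprecht_norm F by fact
  interpret G: schlumprecht_norm G by fact
  show ?thesis using assms(3-5)
  proof (induction "card {i. x i \<noteq> 0}" arbitrary: x y rule: less_induct)
    case less
    show ?case
    proof (rule F.F_upper_strict[OF less.prems(1)])
      show "0 \<le> G y" by (rule G.F_nonneg[OF less.prems(2)])
      show "norm (x i) \<le> G y" for i
        using less.prems(3)[of i] G.norm_le_F[OF less.prems(2), of i] by linarith
      fix r E assume adm: "admissible r E" and big: "\<not> (\<Sum>i=1..r. F (coord_proj (E i) x)) \<le> F x"
      have "F (coord_proj (E i) x) \<le> G (coord_proj (E i) y)" if i: "i \<in> {1..r}" for i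
      proof (rule less.hyps)
        have fin: "finite {j. x j \<noteq> 0}" using less.prems(1) by (simp add: c00_def)
        \<comment> \<open>A member covering the support of \<open>x\<close> would make all other
          terms vanish and the sum equal to \<open>F x\<close>, which \<open>big\<close>
          excludes.\<close>
        have "{j. coord_proj (E i) x j \<noteq> 0} \<subset> {j. x j \<noteq> 0}"
        proof (rule ccontr)
          assume "\<not> ?thesis"
          then have sub: "{j. x j \<noteq> 0} \<subseteq> E i" by (auto simp: coord_proj_def split: if_splits)
          have z: "coord_proj (E j) x = (\<lambda>_. 0)" if "j \<in> {1..r} - {i}" for j
          proof -
            have "E j \<inter> E i = {}" using admissible_disjoint[OF adm, of j i] that i by blast
            then show ?thesis using sub by (auto simp: coord_proj_def fun_eq_iff)
          qed
          have e: "coord_proj (E i) x = x" using sub by (auto simp: coord_proj_def fun_eq_iff)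
          have "(\<Sum>i=1..r. F (coord_proj (E i) x)) = F x"
            using i z by (subst sum.remove[of _ i]) (auto simp: e sum.neutral)
          with big show False by simp
        qed
        then show "card {j. coord_proj (E i) x j \<noteq> 0} < card {j. x j \<noteq> 0}"
          by (rule psubset_card_mono[OF fin])
        show "norm (coord_proj (E i) x j) \<le> norm (coord_proj (E i) y j)" for j
          using less.prems(3) by (simp add: coord_proj_def)
      qed (use less.prems in \<open>auto intro: coord_proj_c00\<close>)
      then have "(\<Sum>i=1..r. F (coord_proj (E i) x)) \<le> (\<Sum>i=1..r. G (coord_proj (E i) y))"
        by (rule sum_mono)
      also have "\<dots> \<le> schlumprecht_f (real r) * G y" by (rule G.F_lower[OF less.prems(2) adm])
      finally show "(\<Sum>i=1..r. F (coord_proj (E i) x)) \<le> schlumprecht_f (real r) * G y" .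
    qed
  qed
qed

section \<open>Intervals\<close>

definition window :: "nat \<Rightarrow> nat \<Rightarrow> (nat \<Rightarrow> 'k::zero) \<Rightarrow> nat \<Rightarrow> 'k" where
  "window a c x = (\<lambda>i. if a \<le> i \<and> i < c then x i else 0)"

lemma window_c00 [simp]: "window a c x \<in> c00"
  unfolding c00_def window_def by (auto intro: finite_subset[of _ "{a..<c}"])

lemma window_empty: "c \<le> a \<Longrightarrow> window a c x = (\<lambda>_. 0)"
  by (auto simp: window_def fun_eq_iff)

lemma incseq_piece:
  fixes q :: "nat \<Rightarrow> nat"
  assumes "incseq q" "q i \<le> a" "c \<le> q (Suc i)" "j \<noteq> i"
  shows "q (Suc j) \<le> a \<or> c \<le> q j"
proof (cases "j < i")
  case True
  then show ?thesis using incseqD[OF assms(1), of "Suc j" i] assms(2) by simp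
next
  case False
  then show ?thesis using incseqD[OF assms(1), of "Suc i" j] assms(3,4) by simp
qed

context schlumprecht_norm
begin

lemma F_mono: "x \<in> c00 \<Longrightarrow> y \<in> c00 \<Longrightarrow> (\<And>i. norm (x i) \<le> norm (y i)) \<Longrightarrow> F x \<le> F y"
  by (rule schlumprecht_norm_compare) unfold_locales

lemma F_window_mono:
  assumes "\<And>i. a \<le> i \<Longrightarrow> i < c \<Longrightarrow> a' \<le> i \<and> i < c' \<and> norm (x i) \<le> norm (y i)"
  shows "F (window a c x) \<le> F (window a' c' y)"
  proof (rule F_mono)
  show "norm (window a c x i) \<le> norm (window a' c' y i)" for i
    using assms[of i] by (simp add: window_def)
qed auto

lemma F_window_nonneg: "0 \<le> F (window a c x)"
  by (rule F_nonneg) simp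

lemma norm_le_F_window: "a \<le> i \<Longrightarrow> i < c \<Longrightarrow> norm (x i) \<le> F (window a c x)"
  using norm_le_F[OF window_c00, of a c x i] by (subst (asm) window_def) simp

text \<open>Consecutive intervals are admissible. The cases \<open>r = 0\<close> and
  \<open>r = 1\<close> hold because f(0) = 0 and f(1) = 1, so that later no lower bound on
  \<open>r\<close> has to be tracked.\<close>

lemma interval_lower:
  assumes q: "incseq q"
  shows "(\<Sum>i<r. F (window (q i) (q (Suc i)) x)) \<le> schlumprecht_f (real r) * F (window (q 0) (q r) x)"
proof (cases "2 \<le> r")
  case True
  let ?E = "\<lambda>i. {q (i - 1)..<q i}"
  have adm: "admissible r ?E"
    unfolding admissible_def set_before_def
  proof (intro conjI ballI impI)
    fix i j assume "i \<in> {1..r}" "j \<in> {1..r}" "i < j"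
    then have le: "q i \<le> q (j - 1)" by (intro incseqD[OF q]) auto
    show "?E i = {} \<or> ?E j = {} \<or> Max (?E i) < Min (?E j)"
    proof (cases "?E i = {} \<or> ?E j = {}")
      case False
      then have "Max (?E i) < q i" "q (j - 1) \<le> Min (?E j)" by auto
      with le show ?thesis by linarith
    qed auto
  qed (use True in auto)
  have "(\<Sum>i<r. F (window (q i) (q (Suc i)) x)) =
      (\<Sum>i=1..r. F (window (q (i - 1)) (q i) x))"
    by (rule sum.reindex_bij_witness[of _ "\<lambda>i. i - 1" Suc]) auto
  also have "\<dots> = (\<Sum>i=1..r. F (coord_proj (?E i) (window (q 0) (q r) x)))"
  proof (intro sum.cong refl arg_cong[of _ _ F])
    fix i assume "i \<in> {1..r}"
    then have "q 0 \<le> q (i - 1)" "q i \<le> q r" by (auto intro!: incseqD[OF q])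
    then show "window (q (i - 1)) (q i) x = coord_proj (?E i) (window (q 0) (q r) x)"
      by (auto simp: window_def coord_proj_def fun_eq_iff)
  qed
  also have "\<dots> \<le> schlumprecht_f (real r) * F (window (q 0) (q r) x)"
    by (rule F_lower[OF window_c00 adm])
  finally show ?thesis .
next
  case False
  then have "r = 0 \<or> r = 1" by auto
  then show ?thesis by auto
qed

text \<open>By unconditionality each set of a family may be enlarged to an interval that starts
  where the earlier sets end, so partitions suffice. A partition with a piece of full length is
  settled here, once and for all; the remaining ones have strictly shorter pieces, which permits
  induction on the length.\<close>

lemma interval_upper:
  assumes B: "0 \<le> B" and sup: "\<And>i. a \<le> i \<Longrightarrow> i < c \<Longrightarrow> norm (x i) \<le> B"
    and *: "\<And>r q. 2 \<le> r \<Longrightarrow> incseq q \<Longrightarrow> q 0 = a \<Longrightarrow> q r = c \<Longrightarrow>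
      (\<And>i. i < r \<Longrightarrow> q (Suc i) - q i < c - a) \<Longrightarrow>
      (\<Sum>i<r. F (window (q i) (q (Suc i)) x)) \<le> schlumprecht_f (real r) * B"
  shows "F (window a c x) \<le> B"
proof (cases "a < c")
  case False
  then show ?thesis using B by (simp add: window_empty)
next
  case ac: True
  let ?x = "window a c x"
  show ?thesis
  proof (rule F_upper_strict[OF window_c00 B])
    show "norm (?x i) \<le> B" for i using sup[of i] B by (auto simp: window_def)
    fix r E assume adm: "admissible r E" and big: "\<not> (\<Sum>i=1..r. F (coord_proj (E i) ?x)) \<le> F ?x"
    \<comment> \<open>\<open>q i\<close> lies just behind the last point of the first
      \<open>i\<close> sets, clipped to the interval; the last cut is moved to \<open>c\<close> to
      exhaust it. Inserting \<open>a\<close> keeps the maximum meaningful when these sets are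
      empty.\<close>
    define Q where "Q i = insert a {min c (Suc e) | e. a \<le> e \<and> (\<exists>j\<in>{1..i}. e \<in> E j)}" for i
    define q where "q i = (if i < r then Max (Q i) else c)" for i
    have finQ: "finite (Q i)" if "i < r" for i
    proof -
      have "Q i \<subseteq> insert a {..c}" by (auto simp: Q_def)
      then show ?thesis by (rule finite_subset) auto
    qed
    have Q0: "a \<in> Q i" and Qle: "y \<in> Q i \<Longrightarrow> a \<le> y \<and> y \<le> c" for i y
      using ac by (auto simp: Q_def)
    have r: "2 \<le> r" using adm by (simp add: admissible_def)
    have q_bd: "a \<le> q i \<and> q i \<le> c" for i
    proof (cases "i < r")
      case True
      then have "Max (Q i) \<in> Q i" using finQ Q0 by (intro Max_in) auto
      then show ?thesis using True Qle by (simp add: q_def)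
    qed (use ac in \<open>simp add: q_def\<close>)
    have inc: "incseq q"
    proof (rule incseq_SucI)
      fix i show "q i \<le> q (Suc i)"
      proof (cases "Suc i < r")
        case True
        have "Q i \<subseteq> Q (Suc i)" unfolding Q_def by (rule insert_mono) (use atLeastatMost_subset_iff in \<open>fastforce\<close>)
        then show ?thesis using True finQ[of "Suc i"] Q0 by (auto simp: q_def intro!: Max_mono)
      next
        case False
        then have "q (Suc i) = c" by (simp add: q_def)
        then show ?thesis using q_bd by simp
      qed
    qed
    have q0: "q 0 = a" using r by (simp add: q_def Q_def)
    have qr: "q r = c" by (simp add: q_def)
    have E_sub: "q i \<le> e \<and> e < q (Suc i)" if e: "e \<in> E (Suc i)" "a \<le> e" "e < c" and i: "i < r" for i e
    proof
      have "y \<le> e" if "y \<in> Q i" for y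
        using that e i admissible_less[OF adm, of _ "Suc i" _ e]
        by (fastforce simp: Q_def)
      then have "Max (Q i) \<le> e" using finQ[OF i] Q0[of i] by (intro Max.boundedI) auto
      then show "q i \<le> e" using i by (simp add: q_def)
      show "e < q (Suc i)"
      proof (cases "Suc i < r")
        case True
        have "Suc e \<in> Q (Suc i)" using e by (force simp: Q_def)
        then have "Suc e \<le> Max (Q (Suc i))" using finQ[OF True] by (intro Max_ge)
        then show ?thesis using True by (simp add: q_def)
      qed (use e in \<open>simp add: q_def\<close>)
    qed
    have le: "F (coord_proj (E (Suc i)) ?x) \<le> F (window (q i) (q (Suc i)) x)" if i: "i < r" for i
    proof (rule F_mono)
      show "norm (coord_proj (E (Suc i)) ?x e) \<le> norm (window (q i) (q (Suc i)) x e)" for e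
        using E_sub[OF _ _ _ i, of e] by (auto simp: coord_proj_def window_def)
    qed (auto intro: coord_proj_c00)
    have sum_le: "(\<Sum>i=1..r. F (coord_proj (E i) ?x)) \<le> (\<Sum>i<r. F (window (q i) (q (Suc i)) x))"
      proof -
      have "(\<Sum>i=1..r. F (coord_proj (E i) ?x)) = (\<Sum>i<r. F (coord_proj (E (Suc i)) ?x))"
        by (rule sum.reindex_bij_witness[of _ Suc "\<lambda>i. i - 1"]) auto
      also have "\<dots> \<le> (\<Sum>i<r. F (window (q i) (q (Suc i)) x))" using le by (intro sum_mono) auto
      finally show ?thesis .
    qed
    \<comment> \<open>A piece of full length leaves the others empty, and the family contributes no
      more than \<open>F\<close> of the whole vector, contrary to \<open>big\<close>.\<close>
    have "q (Suc i) - q i < c - a" if i: "i < r" for i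
    proof (rule ccontr)
      assume "\<not> ?thesis"
      then have "q i = a" "q (Suc i) = c" using q_bd[of i] q_bd[of "Suc i"] ac by linarith+
      then have "F (window (q j) (q (Suc j)) x) = 0" if "j \<noteq> i" for j
        using incseq_piece[OF inc, of i a c j] q_bd[of j] q_bd[of "Suc j"] that
        by (subst window_empty) auto
      then have "(\<Sum>i<r. F (window (q i) (q (Suc i)) x)) = F ?x"
        using i \<open>q i = a\<close> \<open>q (Suc i) = c\<close> by (subst sum.remove[of _ i]) auto
      then show False using big sum_le by simp
    qed
    from *[OF r inc q0 qr this] sum_le
    show "(\<Sum>i=1..r. F (coord_proj (E i) ?x)) \<le> schlumprecht_f (real r) * B" by linarith
  qed
qed

lemma F_window_triangle: "a \<le> s \<Longrightarrow> s \<le> c \<Longrightarrow> F (window a c x) \<le> F (window a s x) + F (window s c x)"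
proof -
  assume "a \<le> s" "s \<le> c"
  then have "window a c x = window a s x + window s c x" by (auto simp: window_def fun_eq_iff)
  then show ?thesis using triangle[OF window_c00 window_c00, of a s x s c x] by simp
qed

lemma F_singleton: "F (window a (Suc a) x) = norm (x a)"
proof (rule antisym)
  show "F (window a (Suc a) x) \<le> norm (x a)"
  proof (rule interval_upper)
    fix r q assume "incseq q" "q 0 = a" "q r = Suc a" and 1: "\<And>i. i < r \<Longrightarrow> q (Suc i) - q i < Suc a - a"
    have "(\<Sum>i<r. F (window (q i) (q (Suc i)) x)) = 0"
      using 1 by (intro sum.neutral) (auto simp: window_empty)
    then show "(\<Sum>i<r. F (window (q i) (q (Suc i)) x)) \<le> schlumprecht_f (real r) * norm (x a)"
      by (simp add: schlumprecht_f_nonneg)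
  qed (auto simp: le_less_Suc_eq)
qed (simp add: norm_le_F_window)

lemma F_window_le_sum: "F (window a c x) \<le> (\<Sum>i\<in>{a..<c}. norm (x i))"
proof (induction c)
  case (Suc c)
  show ?case
  proof (cases "a \<le> c")
    case True
    then have "F (window a (Suc c) x) \<le> F (window a c x) + norm (x c)"
      using F_window_triangle[of a c "Suc c" x] by (simp add: F_singleton)
    with Suc True show ?thesis by simp
  qed (simp add: window_empty)
qed (simp add: window_empty)

text \<open>Successive blocks dominate the basis with constant 1, since \<open>t\<close> carries a
  partition of the indices to a partition of the positions.\<close>

lemma block_lower:
  assumes t: "incseq t" and b: "\<And>k. m \<le> k \<Longrightarrow> k < l \<Longrightarrow> norm (b k) \<le> F (window (t k) (t (Suc k)) x)"
  shows "F (window m l b) \<le> F (window (t m) (t l) x)"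
  using b
proof (induction "l - m" arbitrary: m l rule: less_induct)
  case less
  show ?case
  proof (rule interval_upper[OF F_window_nonneg])
    fix k assume k: "m \<le> k" "k < l"
    have "F (window (t k) (t (Suc k)) x) \<le> F (window (t m) (t l) x)"
      using incseqD[OF t, of m k] incseqD[OF t, of "Suc k" l] k by (intro F_window_mono) auto
    with less.prems[OF k] show "norm (b k) \<le> F (window (t m) (t l) x)" by simp
  next
    fix r q assume q: "incseq q" "q 0 = m" "q r = l" "\<And>i. i < r \<Longrightarrow> q (Suc i) - q i < l - m"
    have "(\<Sum>i<r. F (window (q i) (q (Suc i)) b)) \<le> (\<Sum>i<r. F (window (t (q i)) (t (q (Suc i))) x))"
    proof (intro sum_mono less.hyps)
      fix i assume "i \<in> {..<r}"
      then have i: "q 0 \<le> q i" "q (Suc i) \<le> q r" "q (Suc i) - q i < l - m"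
        using q(4) by (auto intro!: incseqD[OF q(1)])
      then show "q (Suc i) - q i < l - m" by simp
      show "norm (b k) \<le> F (window (t k) (t (Suc k)) x)" if "q i \<le> k" "k < q (Suc i)" for k
        using i that q less.prems by simp
    qed
    also have "\<dots> \<le> schlumprecht_f (real r) * F (window (t m) (t l) x)"
      using interval_lower[of "t \<circ> q" x r] t q by (simp add: incseq_def)
    finally show "(\<Sum>i<r. F (window (q i) (q (Suc i)) b)) \<le> schlumprecht_f (real r) * F (window (t m) (t l) x)" .
  qed
qed

text \<open>1-subsymmetry: \<open>g s\<close> counts the indices \<open>k\<close> with \<open>\<phi> k < s\<close>.\<close>

lemma spread_upper:
  assumes g: "\<And>k s. k < g s \<longleftrightarrow> \<phi> k < s"
    and x: "\<And>k. norm (x (\<phi> k)) \<le> norm (b k)" "\<And>i. i \<notin> range \<phi> \<Longrightarrow> x i = 0"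
  shows "F (window s t x) \<le> F (window (g s) (g t) b)"
proof (induction "t - s" arbitrary: s t rule: less_induct)
  case less
  have gmono: "g u \<le> g v" if "u \<le> v" for u v :: nat
    using that g by (metis le_less_trans leI less_irrefl not_less)
  show ?case
  proof (rule interval_upper[OF F_window_nonneg])
    fix i assume i: "s \<le> i" "i < t"
    show "norm (x i) \<le> F (window (g s) (g t) b)"
    proof (cases "i \<in> range \<phi>")
      case True
      then obtain k where k: "i = \<phi> k" by auto
      then have "g s \<le> k" "k < g t" using i g[of k] by (auto simp: not_less[symmetric])
      then show ?thesis using x(1)[of k] norm_le_F_window[of "g s" k "g t" b] k by simp
    qed (simp add: x F_window_nonneg)
  next
    fix r q assume q: "incseq q" "q 0 = s" "q r = t" "\<And>i. i < r \<Longrightarrow> q (Suc i) - q i < t - s"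
    have "(\<Sum>i<r. F (window (q i) (q (Suc i)) x)) \<le> (\<Sum>i<r. F (window (g (q i)) (g (q (Suc i))) b))"
      using q(4) by (intro sum_mono less.hyps) auto
    also have "\<dots> \<le> schlumprecht_f (real r) * F (window (g s) (g t) b)"
      using interval_lower[of "g \<circ> q" b r] gmono q by (simp add: incseq_def)
    finally show "(\<Sum>i<r. F (window (q i) (q (Suc i)) x)) \<le> schlumprecht_f (real r) * F (window (g s) (g t) b)" .
  qed
qed

lemma F_shift: "F (window (a + s) (c + s) (\<lambda>i. x (i - s))) = F (window a c x)"
proof (rule antisym)
  \<comment> \<open>Subtraction of naturals sends every \<open>i < s\<close> to 0; \<open>?y\<close>
    is cut off there so that it vanishes outside the range of the shift.\<close>
  let ?y = "\<lambda>i. if s \<le> i then x (i - s) else 0"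
  have *: "window (a + s) (c + s) (\<lambda>i. x (i - s)) = window (a + s) (c + s) ?y"
    by (auto simp: window_def fun_eq_iff)
  have "F (window (a + s) (c + s) ?y) \<le> F (window (a + s - s) (c + s - s) x)"
  proof (rule spread_upper[where \<phi> = "\<lambda>k. k + s"])
    show "?y i = 0" if "i \<notin> range (\<lambda>k. k + s)" for i
      using that by (metis le_add_diff_inverse2 rangeI)
  qed auto
  then show "F (window (a + s) (c + s) (\<lambda>i. x (i - s))) \<le> F (window a c x)" unfolding * by simp
  show "F (window a c x) \<le> F (window (a + s) (c + s) (\<lambda>i. x (i - s)))"
    by (rule block_lower[of "\<lambda>k. k + s"]) (auto simp: F_singleton incseq_def)
qed

text \<open>The bound n / f(n) for a sum of n unit vectors is preserved by the implicit equation;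
  this is exactly \<open>flat_sum_le\<close>.\<close>

lemma F_flat:
  assumes "a < c" "\<And>i. norm (x i) \<le> 1"
  shows "F (window a c x) \<le> real (c - a) / schlumprecht_f (real (c - a))"
  using assms(1)
proof (induction "c - a" arbitrary: a c rule: less_induct)
  case less
  have ge1: "1 \<le> real s / schlumprecht_f (real s)" if "0 < s" for s
  proof -
    have "schlumprecht_f (real s) \<le> real s"
      by (rule schlumprecht_f_le_self)
    then show ?thesis using that schlumprecht_f_ge_1[of "real s"] by (simp add: field_simps)
  qed
  show ?case
  proof (rule interval_upper)
    show "0 \<le> real (c - a) / schlumprecht_f (real (c - a))"
      by (simp add: schlumprecht_f_nonneg)
    show "norm (x i) \<le> real (c - a) / schlumprecht_f (real (c - a))" for i
      using ge1[of "c - a"] assms(2)[of i] less.prems by simp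
  next
    fix r q assume q: "incseq q" "q 0 = a" "q r = c" "\<And>i. i < r \<Longrightarrow> q (Suc i) - q i < c - a"
    let ?l = "\<lambda>i. q (Suc i) - q i"
    have "(\<Sum>i<r. F (window (q i) (q (Suc i)) x)) \<le> (\<Sum>i<r. real (?l i) / schlumprecht_f (real (?l i)))"
    proof (rule sum_mono)
      fix i assume i: "i \<in> {..<r}"
      show "F (window (q i) (q (Suc i)) x) \<le> real (?l i) / schlumprecht_f (real (?l i))"
        using i q less.hyps[of "q (Suc i)" "q i"]
        by (cases "q i < q (Suc i)") (auto simp: window_empty)
    qed
    also have "\<dots> \<le> schlumprecht_f (real r) * (real (c - a) / schlumprecht_f (real (c - a)))"
    proof (rule flat_sum_le)
      have "(\<Sum>i<r. q (Suc i) - q i) = q r - q 0"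
      proof (induction r)
        case (Suc r)
        have "q 0 \<le> q r" "q r \<le> q (Suc r)" using q(1) by (auto simp: incseq_def)
        with Suc show ?case by simp
      qed simp
      then show "(\<Sum>i<r. ?l i) = c - a" using q by simp
    qed (use less.prems in simp)
    finally show "(\<Sum>i<r. F (window (q i) (q (Suc i)) x)) \<le>
      schlumprecht_f (real r) * (real (c - a) / schlumprecht_f (real (c - a)))" .
  qed
qed

end

section \<open>Vectors spanning \<open>l\<^sub>\<infinity>\<close>\<close>

definition copies :: "nat \<Rightarrow> nat \<Rightarrow> nat \<Rightarrow> nat set \<Rightarrow> nat set" where
  "copies s N V A = (\<lambda>(l, a). s + (l * V + a)) ` ({..<N} \<times> A)"

lemma copies_inj:
  fixes s V :: nat
  assumes "A \<subseteq> {..<V}"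
  shows "inj_on (\<lambda>(l, a). s + (l * V + a)) ({..<N} \<times> A)"
proof (rule inj_onI, clarify)
  fix l a l' a' assume *: "a \<in> A" "a' \<in> A" "s + (l * V + a) = s + (l' * V + a')"
  then have lt: "a < V" "a' < V" using assms by auto
  have e: "l * V + a = l' * V + a'" using *(3) by (rule add_left_imp_eq)
  have "a = a'" using arg_cong[OF e, of "\<lambda>x. x mod V"] lt by simp
  then show "l = l' \<and> a = a'" using e lt by auto
qed

lemma copies_subset: "A \<subseteq> {..<V} \<Longrightarrow> copies s N V A \<subseteq> {s..<s + N * V}"
proof
  fix i assume A: "A \<subseteq> {..<V}" and "i \<in> copies s N V A"
  then obtain l a where i: "l < N" "a \<in> A" "i = s + (l * V + a)" by (auto simp: copies_def)
  then have "l * V + a < l * V + V" using A by auto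
  also have "\<dots> \<le> N * V" using mult_le_mono1[of "Suc l" N V] i(1) by simp
  finally show "i \<in> {s..<s + N * V}" using i by simp
qed

lemma card_copies: "A \<subseteq> {..<V} \<Longrightarrow> card (copies s N V A) = N * card A"
  unfolding copies_def by (subst card_image[OF copies_inj]) (auto simp: card_cartesian_product)

lemma sum_copies:
  assumes A: "A \<subseteq> {..<V}" and g: "\<And>l a. l < N \<Longrightarrow> a \<in> A \<Longrightarrow> g (s + (l * V + a)) = h a"
  shows "(\<Sum>i\<in>copies s N V A. g i) = real N * (\<Sum>a\<in>A. h a)"
proof -
  have "(\<Sum>i\<in>copies s N V A. g i) = (\<Sum>(l, a)\<in>{..<N} \<times> A. g (s + (l * V + a)))"
    unfolding copies_def by (subst sum.reindex[OF copies_inj[OF A]]) (simp add: case_prod_unfold)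
  also have "\<dots> = (\<Sum>l<N. \<Sum>a\<in>A. h a)"
    by (subst sum.cartesian_product[symmetric]) (simp add: g)
  finally show ?thesis by simp
qed

lemma copies_disjoint:
  assumes "A \<subseteq> {..<V}" "B \<subseteq> {..<V}" "A \<inter> B = {}"
  shows "copies s N V A \<inter> copies s N V B = {}"
proof -
  have "i \<notin> copies s N V B" if "i \<in> copies s N V A" for i
  proof
    assume "i \<in> copies s N V B"
    with that obtain l a l' b where
      *: "a \<in> A" "b \<in> B" "s + (l * V + a) = s + (l' * V + b)" unfolding copies_def by auto
    then have e: "l * V + a = l' * V + b" by simp
    have "a < V" "b < V" using * assms by auto
    then have "a = b" using arg_cong[OF e, of "\<lambda>x. x mod V"] by simp
    with * assms(3) show False by auto
  qed
  then show ?thesis by auto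
qed

lemma incseq_min: "incseq q \<Longrightarrow> incseq (\<lambda>i. min (q i) (s::nat))"
  and incseq_max: "incseq q \<Longrightarrow> incseq (\<lambda>i. max (q i) (s::nat))"
  unfolding incseq_def by (blast intro: min.mono max.mono order_refl)+

lemma card_pieces:
  fixes h :: "'a \<Rightarrow> nat"
  assumes "finite I" "incseq q"
  shows "(\<Sum>l<r. card {i\<in>I. q l \<le> h i \<and> h i < q (Suc l)}) = card {i\<in>I. q 0 \<le> h i \<and> h i < q r}"
proof (induction r)
  case (Suc r)
  have "q 0 \<le> q r" "q r \<le> q (Suc r)" using assms(2) by (auto simp: incseq_def)
  then have "{i\<in>I. q 0 \<le> h i \<and> h i < q (Suc r)} =
      {i\<in>I. q 0 \<le> h i \<and> h i < q r} \<union> {i\<in>I. q r \<le> h i \<and> h i < q (Suc r)}" by auto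
  then have "card {i\<in>I. q 0 \<le> h i \<and> h i < q (Suc r)} =
      card {i\<in>I. q 0 \<le> h i \<and> h i < q r} + card {i\<in>I. q r \<le> h i \<and> h i < q (Suc r)}"
    using assms(1) by (simp only:) (rule card_Un_disjoint, auto)
  with Suc show ?case by simp
next
  case 0
  have "{i\<in>I. q 0 \<le> h i \<and> h i < q 0} = {}" by auto
  then show ?case by (simp only: card.empty sum.lessThan_Suc lessThan_0 sum.empty)
qed

section \<open>Partitions of vectors and averages of copies\<close>

context schlumprecht_norm
begin

lemma window_split:
  "F (window a c x) \<le> F (window (min a s) (min c s) x) + F (window (max a s) (max c s) x)"
proof -
  have "window a c x = window (min a s) (min c s) x + window (max a s) (max c s) x"
    by (auto simp: window_def fun_eq_iff)
  then show ?thesis using triangle[OF window_c00 window_c00, of "min a s" "min c s" x] by simp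
qed

text \<open>Whatever the number of pieces, a partition collects at most the l1-norm. This makes a
  fixed vector negligible once f(r) is large.\<close>

lemma interval_l1:
  assumes "incseq q"
  shows "(\<Sum>i<r. F (window (q i) (q (Suc i)) x)) \<le> (\<Sum>j\<in>{q 0..<q r}. norm (x j))"
proof (induction r)
  case (Suc r)
  have "q 0 \<le> q r" "q r \<le> q (Suc r)" using assms by (auto simp: incseq_def)
  then have "(\<Sum>j\<in>{q 0..<q (Suc r)}. norm (x j)) =
      (\<Sum>j\<in>{q 0..<q r}. norm (x j)) + (\<Sum>j\<in>{q r..<q (Suc r)}. norm (x j))"
    by (simp add: sum.atLeastLessThan_concat)
  with Suc F_window_le_sum[of "q r" "q (Suc r)" x] show ?case by simp
qed simp

lemma F_window_scale: "F (window a c (\<lambda>i. k * x i)) = norm k * F (window a c x)"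
proof -
  have "window a c (\<lambda>i. k * x i) = (\<lambda>i. k * window a c x i)" by (auto simp: window_def)
  then show ?thesis using homogeneous[OF window_c00, of k a c x] by simp
qed

lemma periodic_aligned:
  assumes c: "F (window 0 V v) \<le> c" and "a \<le> b"
  shows "F (window (a * V) (b * V) (\<lambda>i. v (i mod V))) \<le> c * real (b - a)"
  using assms(2)
proof (induction b rule: dec_induct)
  case base
  then show ?case by (simp add: window_empty)
next
  case (step b)
  have "window (b * V) (Suc b * V) (\<lambda>i. v (i mod V)) = window (0 + b * V) (V + b * V) (\<lambda>i. v (i - b * V))"
  proof
    fix i show "window (b * V) (Suc b * V) (\<lambda>i. v (i mod V)) i =
      window (0 + b * V) (V + b * V) (\<lambda>i. v (i - b * V)) i"
    proof (cases "b * V \<le> i \<and> i < Suc b * V")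
      case True
      then have "i mod V = i - b * V" by (intro mod_nat_eqI) auto
      then show ?thesis by (simp add: window_def)
    qed (auto simp: window_def)
  qed
  then have "F (window (b * V) (Suc b * V) (\<lambda>i. v (i mod V))) \<le> c" using F_shift[of 0 "b * V" V v] c by simp
  moreover have "F (window (a * V) (Suc b * V) (\<lambda>i. v (i mod V))) \<le>
      F (window (a * V) (b * V) (\<lambda>i. v (i mod V))) + F (window (b * V) (Suc b * V) (\<lambda>i. v (i mod V)))"
    using step by (intro F_window_triangle) auto
  moreover have "real (Suc b - a) = real (b - a) + 1" using step by simp
  ultimately show ?case using step.IH by (simp add: algebra_simps)
qed

text \<open>A window meets the copies that start inside it and at most one more, whose start is cut
  off. Hence the 1 added to the number of starting points.\<close>

lemma periodic_window:
  assumes c: "F (window 0 V v) \<le> c" and V: "0 < V" and t: "t \<le> N * V"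
  shows "F (window s t (\<lambda>i. v (i mod V))) \<le> c * (real (card {i\<in>{..<N}. s \<le> i * V \<and> i * V < t}) + 1)"
proof (cases "s < t")
  case True
  define a b where "a = s div V" and "b = Suc ((t - 1) div V)"
  have ab: "a < b" using True by (auto simp: a_def b_def less_Suc_eq_le intro!: div_le_mono)
  have s: "a * V \<le> s" "s < Suc a * V" using V dividend_less_div_times[of V s] by (auto simp: a_def add.commute)
  have t': "t \<le> b * V" using V dividend_less_div_times[of V "t - 1"] True by (simp add: b_def)
  have c0: "0 \<le> c" using F_window_nonneg[of 0 V v] c by linarith
  have "{Suc a..<b} \<subseteq> {i\<in>{..<N}. s \<le> i * V \<and> i * V < t}"
  proof
    fix i assume i: "i \<in> {Suc a..<b}"
    then have "Suc a * V \<le> i * V" by (intro mult_le_mono1) auto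
    moreover have "i * V \<le> (t - 1) div V * V" using i by (intro mult_le_mono1) (auto simp: b_def)
    then have "i * V < t" using True div_times_less_eq_dividend[of "t - 1" V] by linarith
    moreover from this t have "i < N" using mult_le_mono1[of N i V] by linarith
    ultimately show "i \<in> {i\<in>{..<N}. s \<le> i * V \<and> i * V < t}" using s by auto
  qed
  from card_mono[OF _ this] have "b - a \<le> card {i\<in>{..<N}. s \<le> i * V \<and> i * V < t} + 1" by simp
  then have "real (b - a) \<le> real (card {i\<in>{..<N}. s \<le> i * V \<and> i * V < t}) + 1" by linarith
  then have "c * real (b - a) \<le> c * (real (card {i\<in>{..<N}. s \<le> i * V \<and> i * V < t}) + 1)"
    using c0 by (rule mult_left_mono)
  moreover have "F (window s t (\<lambda>i. v (i mod V))) \<le> F (window (a * V) (b * V) (\<lambda>i. v (i mod V)))"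
    using s t' by (intro F_window_mono) auto
  ultimately show ?thesis using periodic_aligned[OF c less_imp_le[OF ab]] by linarith
next
  case False
  have "0 \<le> c" using F_window_nonneg[of 0 V v] c by linarith
  then show ?thesis using False by (simp add: window_empty)
qed

end

locale schlumprecht_real_norm = schlumprecht_norm F for F :: "(nat \<Rightarrow> real) \<Rightarrow> real"
begin

lemma average_window:
  assumes c: "F (window 0 V v) \<le> c" and V: "0 < V" and t: "t \<le> N * V"
  shows "F (window s t (\<lambda>i. v (i mod V) / real N)) \<le>
    c * (real (card {i\<in>{..<N}. s \<le> i * V \<and> i * V < t}) + 1) / real N"
proof -
  have "F (window s t (\<lambda>i. v (i mod V) / real N)) = F (window s t (\<lambda>i. v (i mod V))) / real N"
    using F_window_scale[of s t "1 / real N" "\<lambda>i. v (i mod V)"] by simp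
  then show ?thesis using divide_right_mono[OF periodic_window[OF assms], of "real N"] by simp
qed

lemma average_whole:
  assumes c: "F (window 0 V v) \<le> c" and N: "0 < N"
  shows "F (window 0 (N * V) (\<lambda>i. v (i mod V) / real N)) \<le> c"
proof -
  have "F (window 0 (N * V) (\<lambda>i. v (i mod V) / real N)) = F (window 0 (N * V) (\<lambda>i. v (i mod V))) / real N"
    using F_window_scale[of 0 "N * V" "1 / real N" "\<lambda>i. v (i mod V)"] by simp
  also have "\<dots> \<le> c" using periodic_aligned[OF c, of 0 N] N by (simp add: field_simps)
  finally show ?thesis .
qed

text \<open>Every piece cuts through at most one extra copy, of weight \<open>c / N\<close>. If
  \<open>r\<close> is small compared with \<open>N\<close>, the family gets hardly more than
  \<open>c\<close>, with no factor f(r): the average looks like a unit vector of l1.\<close>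

lemma average_pieces:
  assumes c: "F (window 0 V v) \<le> c" and V: "0 < V" and N: "0 < N"
    and q: "incseq q" "q r \<le> N * V"
  shows "(\<Sum>i<r. F (window (q i) (q (Suc i)) (\<lambda>i. v (i mod V) / real N))) \<le> c * (1 + real r / real N)"
proof -
  have c0: "0 \<le> c" using F_window_nonneg[of 0 V v] c by linarith
  let ?C = "\<lambda>l. card {i\<in>{..<N}. q l \<le> i * V \<and> i * V < q (Suc l)}"
  have "(\<Sum>i<r. F (window (q i) (q (Suc i)) (\<lambda>i. v (i mod V) / real N))) \<le>
     (\<Sum>i<r. c * (real (?C i) + 1) / real N)"
  proof (intro sum_mono average_window[OF c V])
    show "q (Suc i) \<le> N * V" if "i \<in> {..<r}" for i
      using that incseqD[OF q(1), of "Suc i" r] q(2) by simp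
  qed
  also have "\<dots> = c * (real (\<Sum>i<r. ?C i) + real r) / real N"
    by (simp add: sum.distrib flip: sum_divide_distrib sum_distrib_left)
  also have "(\<Sum>i<r. ?C i) = card {i\<in>{..<N}. q 0 \<le> i * V \<and> i * V < q r}"
    by (rule card_pieces) (use q in auto)
  also have "c * (real (card {i\<in>{..<N}. q 0 \<le> i * V \<and> i * V < q r}) + real r) / real N \<le>
      c * (real N + real r) / real N"
  proof (intro divide_right_mono mult_left_mono add_right_mono c0)
    have "card {i\<in>{..<N}. q 0 \<le> i * V \<and> i * V < q r} \<le> card {..<N}" by (rule card_mono) auto
    then show "real (card {i\<in>{..<N}. q 0 \<le> i * V \<and> i * V < q r}) \<le> real N" by simp
  qed simp
  also have "\<dots> = c * (1 + real r / real N)" using N by (simp add: field_simps)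
  finally show ?thesis .
qed

text \<open>\<open>N\<close> is the number of copies over which the vector will be averaged.
  Averaging keeps the sum over the piece \<open>A j\<close> but multiplies its number of coordinates
  by \<open>N\<close>; the functional that sums these coordinates and divides by f(N card(A j)) then
  has norm at most 1 and value at least 1/2. The bound \<open>3 - (1 / 2) ^ p\<close> leaves room
  for an induction on \<open>p\<close>.\<close>

definition linf_vector :: "nat \<Rightarrow> nat \<Rightarrow> nat \<Rightarrow> (nat \<Rightarrow> real) \<Rightarrow> (nat \<Rightarrow> nat set) \<Rightarrow> bool" where
  "linf_vector p N V v A \<longleftrightarrow> 0 < V \<and> (\<forall>i. 0 \<le> v i) \<and> F (window 0 V v) \<le> 3 - (1 / 2) ^ p \<and>
     (\<forall>j<p. A j \<subseteq> {..<V} \<and> A j \<noteq> {} \<and>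
        schlumprecht_f (real (N * card (A j))) \<le> 2 * (\<Sum>i\<in>A j. v i)) \<and>
     (\<forall>j<p. \<forall>j'<p. j \<noteq> j' \<longrightarrow> A j \<inter> A j' = {})"

text \<open>A flat vector of length \<open>M\<close>, which is only seen by families of about \<open>M\<close> sets, is put next to
  an average of so many copies of the previous vector that all families of fewer than \<open>R\<close> sets see
  the average as an \<open>l\<^sub>1\<close>-vector; families of at least \<open>R\<close> sets do not see the flat vector. The
  bound stays below \<open>3\<close> because \<open>1 + 3 / f 2 \<le> 3\<close>.\<close>

lemma linf_vector_exists: "0 < N \<Longrightarrow> \<exists>V v A. linf_vector p N V v A"
proof (induction p arbitrary: N)
  case 0
  show ?case by (rule exI[of _ 1], rule exI[of _ "\<lambda>_. 0"]) (simp add: window_def linf_vector_def)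
next
  case (Suc p)
  \<comment> \<open>A flat vector as long as the number of copies satisfies f(N M) \<le> 2 f(M),
    which is the lower bound asked of the new piece.\<close>
  define M where "M = N"
  define c where "c = 3 - (1 / 2 :: real) ^ p"
  define c' where "c' = 3 - (1 / 2 :: real) ^ Suc p"
  have M: "0 < M" using Suc by (simp add: M_def)
  have pp: "(0::real) < (1/2) ^ p" "(1/2::real) ^ p \<le> 1" by (auto simp: power_le_one)
  have c: "2 \<le> c" "c \<le> 3" "c' = c + (1/2) ^ Suc p" "c \<le> c'" using pp by (auto simp: c_def c'_def)
  have fM: "1 \<le> schlumprecht_f (real M)" using M schlumprecht_f_ge_1 by simp
  obtain R where R: "\<And>r. R \<le> r \<Longrightarrow> 2 ^ Suc p * schlumprecht_f (real M) \<le> schlumprecht_f (real r)"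
    using schlumprecht_f_unbounded by blast
  \<comment> \<open>Chosen so that for \<open>r < R\<close> the error \<open>c * r / N'\<close> of
    the average is at most a quarter of \<open>(1 / 2) ^ p\<close>.\<close>
  define N' where "N' = 12 * 2 ^ p * Suc R"
  have N': "0 < N'" "3 * real R / real N' \<le> (1/2) ^ p / 4"
  proof -
    show "0 < N'" by (simp add: N'_def)
    have rN: "real N' = 12 * 2 ^ p * (real R + 1)" by (simp add: N'_def algebra_simps)
    have key: "3 * x / (12 * y * (x + 1)) \<le> 1 / y / 4" if "0 \<le> x" "0 < y" for x y :: real
    proof -
      have *: "3 * z / (12 * y * z) = 1 / y / 4" if "0 < z" for z :: real
        using that by simp
      have "3 * x / (12 * y * (x + 1)) \<le> 3 * (x + 1) / (12 * y * (x + 1))"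
        using that by (intro divide_right_mono) auto
      also have "\<dots> = 1 / y / 4" by (rule *) (use that in simp)
      finally show ?thesis .
    qed
    have "3 * real R / (12 * 2 ^ p * (real R + 1)) \<le> 1 / 2 ^ p / 4" by (rule key) auto
    then show "3 * real R / real N' \<le> (1/2) ^ p / 4" unfolding rN power_one_over .
  qed
  \<comment> \<open>The old pieces are copied \<open>N'\<close> times here and \<open>N\<close>
    times later.\<close>
  have "0 < N * N'" using Suc.prems N'(1) by simp
  from Suc.IH[OF this] obtain V' v' A' where H: "linf_vector p (N * N') V' v' A'" by blast
  have V': "0 < V'" and v': "\<And>i. 0 \<le> v' i" "F (window 0 V' v') \<le> c"
    using H unfolding linf_vector_def c_def by blast+
  have A': "A' j \<subseteq> {..<V'}" "A' j \<noteq> {}"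
      "schlumprecht_f (real (N * N' * card (A' j))) \<le> 2 * (\<Sum>i\<in>A' j. v' i)" if "j < p" for j
    using H that unfolding linf_vector_def by blast+
  have disj: "A' j \<inter> A' j' = {}" if "j < p" "j' < p" "j \<noteq> j'" for j j'
    using H that unfolding linf_vector_def by blast
  let ?y = "\<lambda>i. v' (i mod V') / real N'"
  define V where "V = M + N' * V'"
  \<comment> \<open>The height f(M) / M gives the flat part norm at most 1 and l1-norm f(M).\<close>
  define v where "v i = (if i < M then schlumprecht_f (real M) / real M else ?y (i - M))" for i
  define A where "A j = (if j < p then copies M N' V' (A' j) else {..<M})" for j
  have v0: "0 \<le> v i" for i using v'(1) fM by (simp add: v_def)
  have U_l1: "(\<Sum>j\<in>{0..<M}. norm (v j)) = schlumprecht_f (real M)"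
    using fM M by (simp add: v_def)
  have U_norm: "F (window 0 M v) \<le> 1"
  proof -
    have "window 0 M v = window 0 M (\<lambda>i. schlumprecht_f (real M) / real M * 1)"
      by (auto simp: window_def v_def fun_eq_iff)
    then have "F (window 0 M v) = schlumprecht_f (real M) / real M * F (window 0 M (\<lambda>_. 1))"
      using fM by (simp only: F_window_scale) simp
    also have "\<dots> \<le> schlumprecht_f (real M) / real M * (real M / schlumprecht_f (real M))"
      using F_flat[of 0 M "\<lambda>_. 1"] M fM by (intro mult_left_mono) auto
    also have "\<dots> = 1" using M fM by simp
    finally show ?thesis .
  qed
  have Y: "F (window (a + M) (b + M) v) = F (window a b ?y)" for a b
  proof -
    have "window (a + M) (b + M) v = window (a + M) (b + M) (\<lambda>i. ?y (i - M))"
      by (auto simp: window_def v_def fun_eq_iff)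
    then show ?thesis using F_shift[of a M b ?y] by simp
  qed
  have Y_norm: "F (window M V v) \<le> c"
    using average_whole[OF v'(2) N'(1)] Y[of 0 "N' * V'"] by (simp add: V_def add.commute)
  have "F (window 0 V v) \<le> c'"
  proof (rule interval_upper)
    show "0 \<le> c'" using c(1,4) by linarith
    show "norm (v i) \<le> c'" if "0 \<le> i" "i < V" for i
    proof (cases "i < M")
      case True
      then have "norm (v i) \<le> F (window 0 M v)" by (intro norm_le_F_window) auto
      then show ?thesis using U_norm c(1,4) by linarith
    next
      case False
      then have "norm (v i) \<le> F (window M V v)" using that by (intro norm_le_F_window) auto
      then show ?thesis using Y_norm c(4) by linarith
    qed
  next
    fix r q assume r: "2 \<le> r" and q: "incseq q" "q 0 = 0" "q r = V"
    let ?l = "\<lambda>i. min (q i) M" and ?u = "\<lambda>i. max (q i) M"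
    have ql: "incseq ?l" and qu: "incseq ?u" by (intro incseq_min incseq_max q(1))+
    have qu': "incseq (\<lambda>i. ?u i - M)" using qu by (simp add: incseq_def diff_le_mono)
    have fr: "3/2 \<le> schlumprecht_f (real r)" using r by (intro schlumprecht_f_ge) simp
    have MV: "M \<le> V" by (simp add: V_def)
    have split: "(\<Sum>i<r. F (window (q i) (q (Suc i)) v)) \<le>
       (\<Sum>i<r. F (window (?l i) (?l (Suc i)) v)) + (\<Sum>i<r. F (window (?u i) (?u (Suc i)) v))"
      unfolding sum.distrib[symmetric] by (intro sum_mono window_split)
    have U1: "(\<Sum>i<r. F (window (?l i) (?l (Suc i)) v)) \<le> schlumprecht_f (real r)"
    proof -
      have "(\<Sum>i<r. F (window (?l i) (?l (Suc i)) v)) \<le> schlumprecht_f (real r) * F (window 0 M v)"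
        using interval_lower[OF ql, of v r] q MV by simp
      also have "\<dots> \<le> schlumprecht_f (real r) * 1" using U_norm fr by (intro mult_left_mono) auto
      finally show ?thesis by simp
    qed
    have U2: "(\<Sum>i<r. F (window (?l i) (?l (Suc i)) v)) \<le> schlumprecht_f (real M)"
      using interval_l1[OF ql, of v r] q MV U_l1 by simp
    have Y1: "(\<Sum>i<r. F (window (?u i) (?u (Suc i)) v)) \<le> schlumprecht_f (real r) * c"
    proof -
      have "(\<Sum>i<r. F (window (?u i) (?u (Suc i)) v)) \<le> schlumprecht_f (real r) * F (window M V v)"
        using interval_lower[OF qu, of v r] q MV by (simp add: max_def)
      also have "\<dots> \<le> schlumprecht_f (real r) * c" using Y_norm fr by (intro mult_left_mono) auto
      finally show ?thesis .
    qed
    have Y2: "(\<Sum>i<r. F (window (?u i) (?u (Suc i)) v)) \<le> c * (1 + real r / real N')"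
    proof -
      have "F (window (?u i) (?u (Suc i)) v) = F (window (?u i - M) (?u (Suc i) - M) ?y)" for i
        using Y[of "?u i - M" "?u (Suc i) - M"] by simp
      then show ?thesis
        using average_pieces[OF v'(2) V' N'(1) qu', of r] q MV by (simp add: V_def)
    qed
    show "(\<Sum>i<r. F (window (q i) (q (Suc i)) v)) \<le> schlumprecht_f (real r) * c'"
    proof (cases "R \<le> r")
      \<comment> \<open>The flat part is charged its l1-norm, which by the choice of
        \<open>R\<close> is at most f(r) times the increment from \<open>c\<close> to
        \<open>c'\<close>.\<close>
      case True
      have "schlumprecht_f (real M) = (1/2) ^ Suc p * (2 ^ Suc p * schlumprecht_f (real M))"
        by (simp add: power_one_over)
      also have "\<dots> \<le> (1/2) ^ Suc p * schlumprecht_f (real r)"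
        using R[OF True] by (intro mult_left_mono) auto
      finally have "(\<Sum>i<r. F (window (q i) (q (Suc i)) v)) \<le>
          (1/2) ^ Suc p * schlumprecht_f (real r) + schlumprecht_f (real r) * c"
        using split U2 Y1 by linarith
      then show ?thesis using c(3) by (simp add: algebra_simps)
    next
      case False
      have "c * (real r / real N') \<le> 3 * (real R / real N')"
        using c False by (intro mult_mono divide_right_mono) auto
      also have "\<dots> \<le> (1/2) ^ p / 4" using N'(2) by simp
      finally have "(\<Sum>i<r. F (window (q i) (q (Suc i)) v)) \<le> schlumprecht_f (real r) + (c + (1/2) ^ p / 4)"
        using split U1 Y2[unfolded distrib_left mult_1_right] by linarith
      \<comment> \<open>Once f(r) is given to the flat part, f(r) (c' - 1) is left for the average;
        because f(r) \<ge> 3/2 this covers \<open>c\<close> and the error of the average.\<close>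
      also have "c + (1/2) ^ p / 4 = 3 / 2 * (c' - 1)" by (simp add: c_def c'_def)
      also have "\<dots> \<le> schlumprecht_f (real r) * (c' - 1)"
        using fr c(1,4) by (intro mult_right_mono) auto
      finally show ?thesis by (simp add: algebra_simps)
    qed
  qed
  moreover have "A j \<subseteq> {..<V} \<and> A j \<noteq> {} \<and>
      schlumprecht_f (real (N * card (A j))) \<le> 2 * (\<Sum>i\<in>A j. v i)" if j: "j < Suc p" for j
  proof (cases "j < p")
    case True
    have "(\<Sum>i\<in>A j. v i) = real N' * (\<Sum>a\<in>A' j. v' a / real N')"
      unfolding A_def using True A'(1)[OF True]
      by (simp only: if_True) (rule sum_copies, auto simp: v_def)
    also have "\<dots> = (\<Sum>a\<in>A' j. v' a)" using N' by (simp flip: sum_divide_distrib)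
    finally have "(\<Sum>i\<in>A j. v i) = (\<Sum>a\<in>A' j. v' a)" .
    moreover have "N * card (A j) = N * N' * card (A' j)"
      using True A'(1)[OF True] by (simp add: A_def card_copies)
    moreover have "A j \<noteq> {}" using True A'(2)[OF True] N'(1) by (auto simp: A_def copies_def)
    moreover have "A j \<subseteq> {..<V}" using True copies_subset[OF A'(1)[OF True], of M N'] by (auto simp: A_def V_def)
    ultimately show ?thesis using A'(3)[OF True] by (simp only: simp_thms)
  next
    case False
    then have "A j = {0..<M}" by (auto simp: A_def)
    moreover have "(\<Sum>j\<in>{0..<M}. v j) = schlumprecht_f (real M)" using U_l1 v0 by simp
    moreover have "schlumprecht_f (real (N * M)) \<le> 2 * schlumprecht_f (real M)"
      using schlumprecht_f_square[of "real N" "real M"] by (simp add: M_def)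
    ultimately show ?thesis using M by (auto simp: V_def)
  qed
  moreover have "A j \<inter> A j' = {}" if jj: "j < Suc p" "j' < Suc p" "j \<noteq> j'" for j j'
  proof -
    have "A i \<inter> {..<M} = {}" if "i < p" for i
      using copies_subset[OF A'(1)[OF that], of M N'] that by (auto simp: A_def)
    moreover have "A i = {..<M}" if "i < Suc p" "\<not> i < p" for i
      using that by (simp add: A_def)
    moreover have "A j \<inter> A j' = {}" if "j < p" "j' < p"
      using copies_disjoint[OF A'(1) A'(1) disj[OF that jj(3)]] that by (simp add: A_def)
    moreover have "j = j'" if "\<not> j < p" "\<not> j' < p" using that jj by simp
    ultimately show ?thesis using jj by (metis Int_commute)
  qed
  moreover have "0 < V" using M by (simp add: V_def)
  ultimately have "linf_vector (Suc p) N V v A" using v0 unfolding c'_def linf_vector_def by simp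
  then show ?case by blast
qed

end

section \<open>Rapidly increasing blocks\<close>

lemma finite_downset_eq:
  fixes A :: "nat set"
  assumes "finite A" "\<And>i j. i < j \<Longrightarrow> j \<in> A \<Longrightarrow> i \<in> A"
  shows "A = {..<card A}"
proof -
  have ex: "\<exists>n. n \<notin> A" using assms(1) infinite_UNIV_nat by (metis UNIV_eq_I)
  define n where "n = (LEAST n. n \<notin> A)"
  have "n \<notin> A" unfolding n_def using ex by (metis LeastI)
  moreover have "i \<in> A" if "i < n" for i using that not_less_Least unfolding n_def by blast
  moreover from this have "i < n" if "i \<in> A" for i
    using assms(2)[of n i] \<open>n \<notin> A\<close> that by (cases i n rule: linorder_cases) auto
  ultimately have "A = {..<n}" by auto
  then show ?thesis by simp
qed

lemma sum_lessThan_add: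
  fixes m n :: nat
  shows "(\<Sum>j<m + n. g j) = (\<Sum>j<m. g j) + (\<Sum>j<n. g (m + j) :: real)"
  by (induction n) auto

lemma sum_pairs: "(\<Sum>i<r. g (2 * i) + g (Suc (2 * i)) :: real) = (\<Sum>j<2 * r. g j)"
  by (induction r) auto

lemma sum_mod:
  fixes g :: "nat \<Rightarrow> real"
  assumes "0 < n"
  shows "(\<Sum>\<omega><n * k. g (\<omega> mod n)) = real k * (\<Sum>i<n. g i)"
proof (induction k)
  case (Suc k)
  have e: "n * Suc k = n * k + n" by simp
  have "(\<Sum>\<omega><n * Suc k. g (\<omega> mod n)) = (\<Sum>\<omega><n * k. g (\<omega> mod n)) + (\<Sum>i<n. g ((n * k + i) mod n))"
    unfolding e by (rule sum_lessThan_add)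
  then show ?case using Suc by (simp add: algebra_simps)
qed simp

section \<open>The norm of an optimal splitting in two\<close>

context schlumprecht_real_norm
begin

definition split_norm :: "(nat \<Rightarrow> real) \<Rightarrow> nat \<Rightarrow> nat \<Rightarrow> real" where
  "split_norm b u v = Max ((\<lambda>s. F (window u s b) + F (window s v b)) ` {u..v})"

lemma split_norm_ge: "u \<le> s \<Longrightarrow> s \<le> v \<Longrightarrow> F (window u s b) + F (window s v b) \<le> split_norm b u v"
  unfolding split_norm_def by (intro Max_ge) auto

lemma split_norm_attained:
  assumes "u \<le> v"
  obtains s where "u \<le> s" "s \<le> v" "split_norm b u v = F (window u s b) + F (window s v b)"
proof -
  have "split_norm b u v \<in> (\<lambda>s. F (window u s b) + F (window s v b)) ` {u..v}"
    unfolding split_norm_def using assms by (intro Max_in) auto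
  then show ?thesis using that by auto
qed

lemma F_le_split_norm: "u \<le> v \<Longrightarrow> F (window u v b) \<le> split_norm b u v"
  using split_norm_ge[of u u v b] by (simp add: window_empty)

lemma split_norm_nonneg: "u \<le> v \<Longrightarrow> 0 \<le> split_norm b u v"
  using F_le_split_norm[of u v b] F_window_nonneg[of u v b] by linarith

lemma split_norm_le: "u \<le> v \<Longrightarrow> split_norm b u v \<le> 2 * F (window u v b)"
proof -
  assume "u \<le> v"
  then obtain s where s: "u \<le> s" "s \<le> v" "split_norm b u v = F (window u s b) + F (window s v b)"
    by (rule split_norm_attained)
  have "F (window u s b) \<le> F (window u v b)" "F (window s v b) \<le> F (window u v b)"
    using s by (auto intro!: F_window_mono)
  then show ?thesis using s by linarith
qed

lemma split_norm_mono:
  assumes "u' \<le> u" "u \<le> v" "v \<le> v'"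
  shows "split_norm b u v \<le> split_norm b u' v'"
proof -
  obtain s where s: "u \<le> s" "s \<le> v" "split_norm b u v = F (window u s b) + F (window s v b)"
    using split_norm_attained[OF assms(2)] by blast
  have "F (window u s b) + F (window s v b) \<le> F (window u' s b) + F (window s v' b)"
    using assms s by (intro add_mono F_window_mono) auto
  also have "\<dots> \<le> split_norm b u' v'" using assms s by (intro split_norm_ge) auto
  finally show ?thesis using s by simp
qed

text \<open>Splitting each of \<open>r\<close> intervals in two gives \<open>2 r\<close> intervals, which can be regrouped into
  two batches of \<open>r\<close> intervals: \<open>split_norm\<close> satisfies the implicit inequality without any loss.\<close>

lemma split_norm_sum:
  assumes p: "incseq p"
  shows "(\<Sum>i<r. split_norm b (p i) (p (Suc i))) \<le> schlumprecht_f (real r) * split_norm b (p 0) (p r)"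
    and "(\<Sum>i<r. split_norm b (p i) (p (Suc i))) \<le> schlumprecht_f (2 * real r) * F (window (p 0) (p r) b)"
proof -
  have "\<exists>s. p i \<le> s \<and> s \<le> p (Suc i) \<and> split_norm b (p i) (p (Suc i)) =
      F (window (p i) s b) + F (window s (p (Suc i)) b)" for i
    using split_norm_attained[of "p i" "p (Suc i)" b] p by (metis incseq_SucD)
  then obtain s where s: "\<And>i. p i \<le> s i" "\<And>i. s i \<le> p (Suc i)"
      "\<And>i. split_norm b (p i) (p (Suc i)) = F (window (p i) (s i) b) + F (window (s i) (p (Suc i)) b)"
    by metis
  define z where "z j = (if even j then p (j div 2) else s (j div 2))" for j
  have z: "incseq z"
  proof (rule incseq_SucI)
    fix j show "z j \<le> z (Suc j)" using s(1,2)[of "j div 2"] by (auto simp: z_def)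
  qed
  let ?g = "\<lambda>j. F (window (z j) (z (Suc j)) b)"
  have "(\<Sum>i<r. split_norm b (p i) (p (Suc i))) = (\<Sum>i<r. ?g (2 * i) + ?g (Suc (2 * i)))"
    by (simp add: s(3) z_def)
  also have "\<dots> = (\<Sum>j<2 * r. ?g j)" by (rule sum_pairs)
  finally have e: "(\<Sum>i<r. split_norm b (p i) (p (Suc i))) = (\<Sum>j<2 * r. ?g j)" .
  have z2: "z 0 = p 0" "z (2 * r) = p r" by (simp_all add: z_def)
  show "(\<Sum>i<r. split_norm b (p i) (p (Suc i))) \<le> schlumprecht_f (2 * real r) * F (window (p 0) (p r) b)"
    using interval_lower[OF z, of b "2 * r"] z2 unfolding e by simp
  \<comment> \<open>The point \<open>z r\<close> between the two batches is one of the cuts over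
    which \<open>split_norm\<close> of the whole interval takes its maximum.\<close>
  have "(\<Sum>j<2 * r. ?g j) = (\<Sum>j<r. ?g j) + (\<Sum>j<r. ?g (r + j))"
    using sum_lessThan_add[of ?g r r] by (simp add: mult_2)
  also have "\<dots> \<le> schlumprecht_f (real r) * F (window (z 0) (z r) b) +
      schlumprecht_f (real r) * F (window (z r) (z (2 * r)) b)"
  proof (rule add_mono)
    show "(\<Sum>j<r. ?g j) \<le> schlumprecht_f (real r) * F (window (z 0) (z r) b)"
      by (rule interval_lower[OF z])
    have "incseq (\<lambda>j. z (r + j))" using z by (simp add: incseq_def)
    from interval_lower[OF this, of b r]
    show "(\<Sum>j<r. ?g (r + j)) \<le> schlumprecht_f (real r) * F (window (z r) (z (2 * r)) b)"
      by (simp add: mult_2)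
  qed
  also have "\<dots> = schlumprecht_f (real r) * (F (window (p 0) (z r) b) + F (window (z r) (p r) b))"
    by (simp add: z2 distrib_left)
  also have "\<dots> \<le> schlumprecht_f (real r) * split_norm b (p 0) (p r)"
  proof (intro mult_left_mono split_norm_ge)
    show "p 0 \<le> z r" "z r \<le> p r" using incseqD[OF z, of 0 r] incseqD[OF z, of r "2 * r"] z2 by auto
  qed (simp add: schlumprecht_f_nonneg)
  finally show "(\<Sum>i<r. split_norm b (p i) (p (Suc i))) \<le> schlumprecht_f (real r) * split_norm b (p 0) (p r)"
    unfolding e .
qed

end

section \<open>Concatenated averages and a random choice of copies\<close>

text \<open>The three growth conditions have separate tasks. \<open>\<rho>_large\<close> bounds the
  price of passing from f(r) to f(2 r). \<open>N_large\<close> keeps block \<open>k\<close>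
  insensitive to \<open>k\<close> nested families of fewer than \<open>\<rho> k\<close> sets.
  \<open>v_l1\<close> makes it negligible, even in l1-norm, for families of at least
  \<open>\<rho> (Suc k)\<close> sets.\<close>

locale block_system = schlumprecht_real_norm F for F :: "(nat \<Rightarrow> real) \<Rightarrow> real" +
  fixes \<rho> N V :: "nat \<Rightarrow> nat" and v :: "nat \<Rightarrow> nat \<Rightarrow> real"
  assumes \<rho>_large: "2 ^ (k + 2) \<le> schlumprecht_f (real (\<rho> k))"
    and \<rho>_mono: "incseq \<rho>"
    and V_pos: "0 < V k"
    and N_large: "3 * 2 ^ k * \<rho> k ^ (k + 1) \<le> N k"
    and v_nonneg: "0 \<le> v k i"
    and v_norm: "F (window 0 (V k) (v k)) \<le> 3"
    and v_l1: "2 ^ k * real (\<rho> k) ^ k * (\<Sum>i<V k. v k i) \<le> schlumprecht_f (real (\<rho> (Suc k)))"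
begin

primrec t :: "nat \<Rightarrow> nat" where
  "t 0 = 0"
| "t (Suc k) = t k + N k * V k"

definition blk :: "nat \<Rightarrow> nat" where
  "blk i = (LEAST k. i < t (Suc k))"

definition w :: "nat \<Rightarrow> real" where
  "w i = v (blk i) ((i - t (blk i)) mod V (blk i)) / real (N (blk i))"

text \<open>The error allowed for block \<open>k\<close> at the deepest level: multiplied by
  \<open>\<rho> k\<close> for each of \<open>k\<close> nested families, it becomes
  \<open>1 / 2 ^ k\<close>, which is summable.\<close>

definition \<eta> :: "nat \<Rightarrow> real" where
  "\<eta> k = 1 / (2 ^ k * real (\<rho> k) ^ k)"

lemma \<rho>_pos: "0 < \<rho> k"
proof (rule ccontr)
  assume "\<not> ?thesis"
  then have "schlumprecht_f (real (\<rho> k)) = 0" by simp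
  moreover have "(0::real) < 2 ^ (k + 2)" by simp
  ultimately show False using \<rho>_large[of k] by linarith
qed

lemma N_pos: "0 < N k"
proof -
  have "0 < 3 * 2 ^ k * \<rho> k ^ (k + 1)" using \<rho>_pos[of k] by simp
  with N_large[of k] show ?thesis by linarith
qed

lemma \<eta>_pos: "0 < \<eta> k"
  using \<rho>_pos by (simp add: \<eta>_def)

lemma N_\<eta>: "3 * real (\<rho> k) / real (N k) \<le> \<eta> k" "3 / real (N k) \<le> \<eta> k"
proof -
  have "3 * 2 ^ k * real (\<rho> k) ^ (k + 1) \<le> real (N k)"
    using of_nat_mono[OF N_large[of k], where 'a = real] by simp
  then show *: "3 * real (\<rho> k) / real (N k) \<le> \<eta> k"
    using N_pos[of k] \<rho>_pos[of k] by (simp add: \<eta>_def field_simps)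
  have "3 / real (N k) \<le> 3 * real (\<rho> k) / real (N k)"
    using \<rho>_pos[of k] by (intro divide_right_mono) auto
  with * show "3 / real (N k) \<le> \<eta> k" by linarith
qed

lemma v_\<eta>: "(\<Sum>i<V k. v k i) \<le> \<eta> k * schlumprecht_f (real (\<rho> (Suc k)))"
  using v_l1[of k] \<rho>_pos[of k] by (simp add: \<eta>_def field_simps)

lemma t_strict: "t k < t (Suc k)"
  using N_pos V_pos by simp

lemma t_inc: "incseq t"
  using t_strict by (intro incseq_SucI) (simp add: less_imp_le)

lemma t_ge: "k \<le> t k"
proof (induction k)
  case (Suc k)
  then show ?case using t_strict[of k] by linarith
qed simp

lemma blk_bounds: "t (blk i) \<le> i" "i < t (Suc (blk i))"
proof -
  show *: "i < t (Suc (blk i))" unfolding blk_def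
    by (rule LeastI[of _ i]) (use t_ge[of "Suc i"] in simp)
  show "t (blk i) \<le> i"
  proof (cases "blk i")
    case (Suc j)
    then have "\<not> i < t (Suc j)" using not_less_Least[of j "\<lambda>k. i < t (Suc k)"] unfolding blk_def by simp
    then show ?thesis using Suc by simp
  qed simp
qed

lemma blk_eq: "t k \<le> i \<Longrightarrow> i < t (Suc k) \<Longrightarrow> blk i = k"
proof (rule linorder_cases[of "blk i" k])
  assume a: "t k \<le> i" "i < t (Suc k)" "blk i < k"
  then have "t (Suc (blk i)) \<le> t k" by (intro incseqD[OF t_inc]) auto
  with a blk_bounds(2)[of i] show ?thesis by linarith
next
  assume a: "t k \<le> i" "i < t (Suc k)" "k < blk i"
  then have "t (Suc k) \<le> t (blk i)" by (intro incseqD[OF t_inc]) auto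
  with a blk_bounds(1)[of i] show ?thesis by linarith
qed auto

lemma w_nonneg: "0 \<le> w i"
  by (simp add: w_def v_nonneg)

lemma w_window:
  assumes "t k \<le> s" "u \<le> t (Suc k)"
  shows "F (window s u (\<lambda>i. b (blk i) * w i)) \<le> \<bar>b k\<bar> *
    (3 * (real (card {i\<in>{..<N k}. s \<le> t k + i * V k \<and> t k + i * V k < u}) + 1) / real (N k))"
proof (cases "s < u")
  case False
  then show ?thesis by (simp add: window_empty)
next
  case True
  let ?y = "\<lambda>i. v k (i mod V k) / real (N k)"
  have "window s u (\<lambda>i. b (blk i) * w i) = window s u (\<lambda>i. b k * ?y (i - t k))"
  proof
    fix i show "window s u (\<lambda>i. b (blk i) * w i) i = window s u (\<lambda>i. b k * ?y (i - t k)) i"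
      using blk_eq[of k i] assms by (auto simp: window_def w_def)
  qed
  then have "F (window s u (\<lambda>i. b (blk i) * w i)) = \<bar>b k\<bar> * F (window s u (\<lambda>i. ?y (i - t k)))"
    using F_window_scale[of s u "b k" "\<lambda>i. ?y (i - t k)"] by simp
  also have "F (window s u (\<lambda>i. ?y (i - t k))) = F (window (s - t k) (u - t k) ?y)"
    using F_shift[of "s - t k" "t k" "u - t k" ?y] assms True by simp
  also have "\<bar>b k\<bar> * \<dots> \<le> \<bar>b k\<bar> *
    (3 * (real (card {i\<in>{..<N k}. s - t k \<le> i * V k \<and> i * V k < u - t k}) + 1) / real (N k))"
    using assms by (intro mult_left_mono average_window v_norm V_pos) auto
  also have "{i\<in>{..<N k}. s - t k \<le> i * V k \<and> i * V k < u - t k} =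
     {i\<in>{..<N k}. s \<le> t k + i * V k \<and> t k + i * V k < u}" by auto
  finally show ?thesis .
qed

lemma w_l1: "(\<Sum>i\<in>{t k..<t (Suc k)}. w i) = (\<Sum>i<V k. v k i)"
proof -
  have "(\<Sum>i\<in>{t k..<t (Suc k)}. w i) = (\<Sum>j<V k * N k. v k (j mod V k) / real (N k))"
    by (rule sum.reindex_bij_witness[of _ "\<lambda>j. t k + j" "\<lambda>i. i - t k"])
      (auto simp: w_def blk_eq mult.commute)
  also have "\<dots> = real (N k) * (\<Sum>i<V k. v k i / real (N k))"
    using sum_mod[OF V_pos, of "\<lambda>i. v k i / real (N k)" k "N k"] by simp
  also have "\<dots> = (\<Sum>i<V k. v k i)" using N_pos[of k] by (simp flip: sum_divide_distrib)
  finally show ?thesis .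
qed

text \<open>A random selection of one starting point of a copy in each block: \<open>\<omega>\<close> is uniform below a
  common multiple of the numbers \<open>N k\<close>. Intervals never split a selected point.\<close>

definition rep :: "nat \<Rightarrow> nat \<Rightarrow> nat" where
  "rep \<omega> k = t k + (\<omega> mod N k) * V k"

lemma rep_bounds: "t k \<le> rep \<omega> k" "rep \<omega> k < t (Suc k)"
proof -
  show "t k \<le> rep \<omega> k" by (simp add: rep_def)
  have "(\<omega> mod N k) * V k < N k * V k" using N_pos[of k] V_pos[of k] by simp
  then show "rep \<omega> k < t (Suc k)" by (simp add: rep_def)
qed

lemma rep_mono: "k < k' \<Longrightarrow> rep \<omega> k < rep \<omega> k'"
  using incseqD[OF t_inc, of "Suc k" k'] rep_bounds(1)[of k' \<omega>] rep_bounds(2)[of \<omega> k] by linarith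

text \<open>Translates positions into block indices. By \<open>less_\<kappa>\<close>, the blocks
  whose selected point lies in a window from \<open>a\<close> to \<open>c\<close> are those from
  \<open>\<kappa> m \<omega> a\<close> up to, but excluding, \<open>\<kappa> m \<omega> c\<close>; a
  partition of positions becomes a partition of indices.\<close>

definition \<kappa> :: "nat \<Rightarrow> nat \<Rightarrow> nat \<Rightarrow> nat" where
  "\<kappa> m \<omega> s = card {k. k < m \<and> rep \<omega> k < s}"

lemma less_\<kappa>: "k < \<kappa> m \<omega> s \<longleftrightarrow> k < m \<and> rep \<omega> k < s"
proof -
  have "{k. k < m \<and> rep \<omega> k < s} = {..<card {k. k < m \<and> rep \<omega> k < s}}"
    using rep_mono by (intro finite_downset_eq) (auto dest: less_trans)
  then have "k \<in> {k. k < m \<and> rep \<omega> k < s} \<longleftrightarrow> k < card {k. k < m \<and> rep \<omega> k < s}"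
    by (metis lessThan_iff)
  then show ?thesis by (simp add: \<kappa>_def)
qed

lemma \<kappa>_mono: "s \<le> u \<Longrightarrow> \<kappa> m \<omega> s \<le> \<kappa> m \<omega> u"
  using less_\<kappa>[of "\<kappa> m \<omega> u" m \<omega> s] less_\<kappa>[of "\<kappa> m \<omega> u" m \<omega> u] by (meson less_le_trans less_irrefl not_less)

end

section \<open>Expected norms of the selected blocks and the upper estimate\<close>

lemma sum_indicator_pieces:
  assumes "incseq q"
  shows "(\<Sum>l<r. of_bool (q l \<le> (h::nat) \<and> h < q (Suc l)) :: real) = of_bool (q 0 \<le> h \<and> h < q r)"
proof (induction r)
  case (Suc r)
  have "q 0 \<le> q r" "q r \<le> q (Suc r)" using assms by (auto simp: incseq_def)
  with Suc show ?case by auto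
qed auto

context block_system
begin

context
  fixes b :: "nat \<Rightarrow> real" and m :: nat
  assumes b_nonneg: "\<And>k. 0 \<le> b k"
begin

definition X :: "nat \<Rightarrow> real" where "X i = b (blk i) * w i"

definition W :: nat where "W = (\<Prod>k<m. N k)"

text \<open>The probability that the selected point of block \<open>k\<close> lies in the window.
  \<open>A\<close> and \<open>A1\<close> are the expected values of \<open>split_norm\<close> and of
  \<open>F\<close> for the selected part of \<open>b\<close>.\<close>

definition \<mu> :: "nat \<Rightarrow> nat \<Rightarrow> nat \<Rightarrow> real" where
  "\<mu> k a c = (\<Sum>\<omega><W. of_bool (a \<le> rep \<omega> k \<and> rep \<omega> k < c)) / real W"

definition A :: "nat \<Rightarrow> nat \<Rightarrow> real" where
  "A a c = (\<Sum>\<omega><W. split_norm b (\<kappa> m \<omega> a) (\<kappa> m \<omega> c)) / real W"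

definition A1 :: "nat \<Rightarrow> nat \<Rightarrow> real" where
  "A1 a c = (\<Sum>\<omega><W. F (window (\<kappa> m \<omega> a) (\<kappa> m \<omega> c) b)) / real W"

text \<open>\<open>d\<close> counts the nested families passed so far. Each may multiply the error
  of block \<open>k\<close> by \<open>\<rho> k\<close>, and the total allowance is
  \<open>e k 0 = 1 / 2 ^ k\<close>.\<close>

definition e :: "nat \<Rightarrow> nat \<Rightarrow> real" where
  "e k d = real (\<rho> k) ^ (k - d) * \<eta> k"

text \<open>Each nested family gains at least 3/2 from f(r), so the weight
  \<open>3 * (2 / 3) ^ k\<close> at the start has become 3, the norm bound of \<open>v k\<close>, at
  depth \<open>k\<close>.\<close>

definition h :: "nat \<Rightarrow> nat \<Rightarrow> real" where
  "h k d = 3 * (2 / 3) ^ (k - d)"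

text \<open>The drop from \<open>C k\<close> to \<open>C (Suc k)\<close> pays for replacing f(r) by
  f(2 r) at a family that norms block \<open>k\<close>.\<close>

definition C :: "nat \<Rightarrow> real" where
  "C K = 3 + 3 * (1 / 2) ^ K"

definition err :: "nat \<Rightarrow> nat \<Rightarrow> nat \<Rightarrow> nat \<Rightarrow> real" where
  "err K d a c = (\<Sum>k\<in>{K..<m}. b k * (e k d + h k d * \<mu> k a c))"

lemma W_pos: "0 < W"
  unfolding W_def using N_pos by (intro prod_pos) auto

lemma \<mu>_le:
  assumes "\<And>\<omega>. a \<le> rep \<omega> k \<Longrightarrow> rep \<omega> k < c \<Longrightarrow> a' \<le> rep \<omega> k \<and> rep \<omega> k < c'"
  shows "\<mu> k a c \<le> \<mu> k a' c'"
  unfolding \<mu>_def using assms by (intro divide_right_mono sum_mono) auto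

lemma \<mu>_nonneg: "0 \<le> \<mu> k a c"
  unfolding \<mu>_def by (intro divide_nonneg_nonneg sum_nonneg) auto

lemma \<mu>_le_1: "\<mu> k a c \<le> 1"
proof -
  have "(\<Sum>\<omega><W. of_bool (a \<le> rep \<omega> k \<and> rep \<omega> k < c) :: real) \<le> (\<Sum>\<omega><W. 1)"
    by (intro sum_mono) auto
  then show ?thesis using W_pos by (simp add: \<mu>_def)
qed

lemma \<mu>_max: "a \<le> c \<Longrightarrow> \<mu> k (max a s) (max c s) \<le> \<mu> k a c"
  by (rule \<mu>_le) auto

lemma \<mu>_sum:
  assumes "incseq q"
  shows "(\<Sum>i<r. \<mu> k (q i) (q (Suc i))) = \<mu> k (q 0) (q r)"
  unfolding \<mu>_def sum_divide_distrib[symmetric]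
  by (subst sum.swap) (simp only: sum_indicator_pieces[OF assms])

text \<open>As \<open>N k\<close> divides \<open>W\<close>, the residue of \<open>\<omega>\<close>
  is uniform, and the probability is the proportion of copies starting in the window, the very
  quantity that bounds the norm of an average.\<close>

lemma \<mu>_eq:
  assumes "k < m"
  shows "\<mu> k a c = real (card {i\<in>{..<N k}. a \<le> t k + i * V k \<and> t k + i * V k < c}) / real (N k)"
proof -
  let ?P = "\<lambda>i. a \<le> t k + i * V k \<and> t k + i * V k < c"
  obtain j where j: "W = N k * j" unfolding W_def using assms by (metis dvd_prodI dvdE finite_lessThan lessThan_iff)
  then have "0 < j" using W_pos by (cases j) auto
  have "(\<Sum>\<omega><W. of_bool (a \<le> rep \<omega> k \<and> rep \<omega> k < c) :: real) = (\<Sum>\<omega><N k * j. of_bool (?P (\<omega> mod N k)))"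
    by (simp add: j rep_def)
  also have "\<dots> = real j * (\<Sum>i<N k. of_bool (?P i))"
    by (rule sum_mod[OF N_pos])
  also have "(\<Sum>i<N k. of_bool (?P i) :: real) = real (card {i\<in>{..<N k}. ?P i})"
    by (simp add: Int_def)
  finally show ?thesis using \<open>0 < j\<close> N_pos[of k] by (simp add: \<mu>_def j)
qed

lemma block_le:
  assumes "k < m" "t k \<le> s" "u \<le> t (Suc k)"
  shows "F (window s u X) \<le> b k * (3 * \<mu> k s u + 3 / real (N k))"
proof -
  have "X = (\<lambda>i. b (blk i) * w i)" by (simp add: X_def fun_eq_iff)
  with w_window[OF assms(2,3), of b] b_nonneg[of k] show ?thesis
    by (simp add: \<mu>_eq[OF assms(1)] add_divide_distrib distrib_left)
qed

lemma X_nonneg: "0 \<le> X i"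
  by (simp add: X_def w_nonneg b_nonneg)

lemma X_l1:
  assumes "t K \<le> a" "c \<le> t k"
  shows "(\<Sum>j\<in>{a..<c}. norm (X j)) \<le> (\<Sum>l\<in>{K..<k}. b l * (\<eta> l * schlumprecht_f (real (\<rho> (Suc l)))))"
proof (cases "K \<le> k")
  case True
  have "(\<Sum>j\<in>{a..<c}. norm (X j)) \<le> (\<Sum>j\<in>{t K..<t k}. X j)"
    using assms X_nonneg by (auto intro!: sum_mono2)
  also have "\<dots> \<le> (\<Sum>l\<in>{K..<k}. b l * (\<eta> l * schlumprecht_f (real (\<rho> (Suc l)))))"
    using True
  proof (induction k rule: dec_induct)
    case (step k)
    have "t K \<le> t k" "t k \<le> t (Suc k)" using step t_inc by (auto simp: incseq_def)
    then have "(\<Sum>j\<in>{t K..<t (Suc k)}. X j) = (\<Sum>j\<in>{t K..<t k}. X j) + (\<Sum>j\<in>{t k..<t (Suc k)}. X j)"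
      by (simp add: sum.atLeastLessThan_concat del: t.simps)
    also have "(\<Sum>j\<in>{t k..<t (Suc k)}. X j) = (\<Sum>j\<in>{t k..<t (Suc k)}. b k * w j)"
      by (intro sum.cong refl) (auto simp: X_def blk_eq simp del: t.simps)
    also have "\<dots> = b k * (\<Sum>i<V k. v k i)"
      unfolding sum_distrib_left[symmetric] w_l1 ..
    also have "\<dots> \<le> b k * (\<eta> k * schlumprecht_f (real (\<rho> (Suc k))))"
      using b_nonneg v_\<eta> by (intro mult_left_mono)
    finally show ?case using step by simp
  qed simp
  finally show ?thesis .
next
  case False
  then have "t k \<le> t K" by (intro incseqD[OF t_inc]) simp
  then show ?thesis using assms False by simp
qed

lemma A_nonneg: "a \<le> c \<Longrightarrow> 0 \<le> A a c"
  unfolding A_def by (intro divide_nonneg_nonneg sum_nonneg split_norm_nonneg \<kappa>_mono) auto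

lemma A_max:
  assumes "a \<le> c"
  shows "A (max a s) (max c s) \<le> A a c"
proof (cases "c \<le> s")
  case True
  then have "A (max a s) (max c s) = 0" using assms by (simp add: A_def split_norm_def window_empty max_def)
  then show ?thesis using A_nonneg[OF assms] by simp
next
  case False
  then have "A (max a s) c \<le> A a c" unfolding A_def using assms
    by (intro divide_right_mono sum_mono split_norm_mono \<kappa>_mono) auto
  then show ?thesis using False by (simp add: max_def)
qed

text \<open>For each \<open>\<omega>\<close> the partition induces one of the block indices, to
  which \<open>split_norm_sum\<close> applies. The second estimate ends in the smaller quantity
  \<open>A1\<close>, leaving the rest of \<open>A\<close> for one block in \<open>A_bonus\<close>,
  and costs a factor 2 inside f.\<close>

lemma A_sum:
  assumes "incseq q"
  shows "(\<Sum>i<r. A (q i) (q (Suc i))) \<le> schlumprecht_f (real r) * A (q 0) (q r)"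
    and "(\<Sum>i<r. A (q i) (q (Suc i))) \<le> schlumprecht_f (2 * real r) * A1 (q 0) (q r)"
proof -
  have inc: "incseq (\<lambda>i. \<kappa> m \<omega> (q i))" for \<omega>
    using assms \<kappa>_mono by (simp add: incseq_def)
  have e: "(\<Sum>i<r. A (q i) (q (Suc i))) =
      (\<Sum>\<omega><W. \<Sum>i<r. split_norm b (\<kappa> m \<omega> (q i)) (\<kappa> m \<omega> (q (Suc i)))) / real W"
    unfolding A_def sum_divide_distrib[symmetric] by (subst sum.swap) simp
  show "(\<Sum>i<r. A (q i) (q (Suc i))) \<le> schlumprecht_f (real r) * A (q 0) (q r)"
    unfolding e unfolding A_def times_divide_eq_right sum_distrib_left
    by (intro divide_right_mono sum_mono split_norm_sum(1)[OF inc]) simp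
  show "(\<Sum>i<r. A (q i) (q (Suc i))) \<le> schlumprecht_f (2 * real r) * A1 (q 0) (q r)"
    unfolding e unfolding A1_def times_divide_eq_right sum_distrib_left
    by (intro divide_right_mono sum_mono split_norm_sum(2)[OF inc]) simp
qed

lemma A1_nonneg: "0 \<le> A1 a c"
  unfolding A1_def by (intro divide_nonneg_nonneg sum_nonneg F_window_nonneg) auto

text \<open>The selected point of block \<open>k\<close> is paid for by the first part of the split, the later
  blocks by the second part.\<close>

lemma A_bonus:
  assumes k: "k < m" and ac: "a \<le> c"
  shows "b k * \<mu> k a c + A1 (max a (t (Suc k))) (max c (t (Suc k))) \<le> A a c"
proof -
  let ?s = "t (Suc k)"
  have *: "b k * of_bool (a \<le> rep \<omega> k \<and> rep \<omega> k < c) +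
      F (window (\<kappa> m \<omega> (max a ?s)) (\<kappa> m \<omega> (max c ?s)) b) \<le> split_norm b (\<kappa> m \<omega> a) (\<kappa> m \<omega> c)" for \<omega>
  proof -
    have le: "F (window (\<kappa> m \<omega> (max a ?s)) (\<kappa> m \<omega> (max c ?s)) b) \<le> F (window l (\<kappa> m \<omega> c) b)"
      if "l \<le> \<kappa> m \<omega> (max a ?s)" for l
    proof (cases "c \<le> ?s")
      case True
      then show ?thesis using ac by (simp add: max_def window_empty F_window_nonneg)
    next
      case False
      then have "max c ?s = c" by simp
      then show ?thesis using that by (auto intro!: F_window_mono simp del: t.simps)
    qed
    show ?thesis
    proof (cases "a \<le> rep \<omega> k \<and> rep \<omega> k < c")
      case True
      have k1: "\<kappa> m \<omega> a \<le> k" using True less_\<kappa>[of k m \<omega> a] by simp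
      have k2: "k < \<kappa> m \<omega> c" using True less_\<kappa>[of k m \<omega> c] k by simp
      have "rep \<omega> k < max a ?s" using rep_bounds(2)[of \<omega> k] by simp
      then have "Suc k \<le> \<kappa> m \<omega> (max a ?s)" using less_\<kappa>[of k m \<omega> "max a ?s"] k by (simp del: t.simps)
      note le[OF this]
      moreover have "b k \<le> F (window (\<kappa> m \<omega> a) (Suc k) b)"
        using norm_le_F_window[of "\<kappa> m \<omega> a" k "Suc k" b] k1 b_nonneg[of k] by simp
      moreover have "F (window (\<kappa> m \<omega> a) (Suc k) b) + F (window (Suc k) (\<kappa> m \<omega> c) b) \<le>
          split_norm b (\<kappa> m \<omega> a) (\<kappa> m \<omega> c)"
        using k1 k2 by (intro split_norm_ge) auto
      ultimately show ?thesis using True by (simp del: t.simps)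
    next
      case False
      have "\<kappa> m \<omega> a \<le> \<kappa> m \<omega> (max a ?s)" by (rule \<kappa>_mono) simp
      note le[OF this] F_le_split_norm[OF \<kappa>_mono[OF ac, of m \<omega>], of b]
      moreover have "of_bool (a \<le> rep \<omega> k \<and> rep \<omega> k < c) = (0::real)" using False by simp
      ultimately show ?thesis by (simp only: mult_zero_right add_0_left)
    qed
  qed
  have "b k * \<mu> k a c + A1 (max a ?s) (max c ?s) = (\<Sum>\<omega><W. b k * of_bool (a \<le> rep \<omega> k \<and> rep \<omega> k < c) +
      F (window (\<kappa> m \<omega> (max a ?s)) (\<kappa> m \<omega> (max c ?s)) b)) / real W"
    by (simp add: \<mu>_def A1_def sum.distrib add_divide_distrib sum_distrib_left del: t.simps)
  also have "\<dots> \<le> A a c" unfolding A_def by (intro divide_right_mono sum_mono *) simp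
  finally show ?thesis .
qed

lemma \<eta>_le_e: "\<eta> k \<le> e k d"
proof -
  have "1 \<le> real (\<rho> k) ^ (k - d)" using \<rho>_pos[of k] by (intro one_le_power) simp
  then show ?thesis using \<eta>_pos[of k] by (simp add: e_def)
qed

lemma e_nonneg: "0 \<le> e k d"
  using \<eta>_le_e[of k d] \<eta>_pos[of k] by linarith

lemma h_nonneg: "0 \<le> h k d"
  by (simp add: h_def)

lemma e_Suc: "Suc d \<le> k \<Longrightarrow> real (\<rho> k) * e k (Suc d) = e k d"
proof -
  assume "Suc d \<le> k"
  then have "k - d = Suc (k - Suc d)" by simp
  then show ?thesis by (simp add: e_def)
qed

lemma h_Suc: "Suc d \<le> k \<Longrightarrow> h k (Suc d) = 3 / 2 * h k d"
proof -
  assume "Suc d \<le> k"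
  then have "k - d = Suc (k - Suc d)" by simp
  then show ?thesis by (simp add: h_def)
qed

lemma C_bounds: "3 \<le> C K" "C K \<le> 6" "C (Suc K) \<le> C K"
  by (auto simp: C_def power_le_one)

lemma C_antimono: "K \<le> k \<Longrightarrow> C k \<le> C K"
  using C_bounds(3) by (rule lift_Suc_antimono_le)

text \<open>Since f(2 r) \<le> f(r) + 1, the extra cost is at most 6. This is
  \<open>C k - C (Suc k)\<close> times \<open>2 ^ (k + 2)\<close>, and f(r) is at least that
  power.\<close>

lemma C_step:
  assumes "\<rho> k \<le> r"
  shows "C (Suc k) * schlumprecht_f (2 * real r) \<le> C k * schlumprecht_f (real r)"
proof -
  have f: "2 ^ (k + 2) \<le> schlumprecht_f (real r)"
    using \<rho>_large[of k] schlumprecht_f_mono[of "real (\<rho> k)" "real r"] assms by simp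
  have "C (Suc k) * schlumprecht_f (2 * real r) \<le> C (Suc k) * (schlumprecht_f (real r) + 1)"
    using C_bounds(1)[of "Suc k"] by (intro mult_left_mono schlumprecht_f_double) auto
  also have "\<dots> \<le> C (Suc k) * schlumprecht_f (real r) + 3 / 2 * (1 / 2) ^ k * 2 ^ (k + 2)"
    using C_bounds(2)[of "Suc k"] by (simp add: distrib_left power_one_over)
  also have "\<dots> \<le> C (Suc k) * schlumprecht_f (real r) + 3 / 2 * (1 / 2) ^ k * schlumprecht_f (real r)"
    using f by (intro add_left_mono mult_left_mono) auto
  also have "\<dots> = C k * schlumprecht_f (real r)" by (simp add: C_def algebra_simps)
  finally show ?thesis .
qed

lemma err_term_nonneg: "0 \<le> b k * (e k d + h k d * \<mu> k a c)"
  using b_nonneg e_nonneg h_nonneg \<mu>_nonneg by (intro mult_nonneg_nonneg add_nonneg_nonneg)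

lemma err_nonneg: "0 \<le> err K d a c"
  unfolding err_def by (intro sum_nonneg err_term_nonneg)

lemma err_split: "K \<le> k \<Longrightarrow> k < m \<Longrightarrow>
  err K d a c = (\<Sum>l\<in>{K..<k}. b l * (e l d + h l d * \<mu> l a c)) +
    b k * (e k d + h k d * \<mu> k a c) + err (Suc k) d a c"
  unfolding err_def
  by (subst sum.atLeastLessThan_concat[of K k m, symmetric], simp, simp, subst sum.atLeast_Suc_lessThan[of k m]) auto

text \<open>Families of \<open>r\<close> intervals with \<open>r < \<rho> K\<close> barely notice how they cut the blocks from \<open>K\<close> on;
  the cost of a cut is charged to \<open>e\<close>, which tolerates \<open>k\<close> nested cuts of block \<open>k\<close>. Deeper down,
  block \<open>k\<close> carries a weight of at most \<open>(2 / 3) ^ k\<close> and is charged to \<open>h\<close>. A family with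
  \<open>\<rho> k \<le> r < \<rho> (Suc k)\<close> sees the earlier blocks as negligible and block \<open>k\<close> with its full norm;
  this happens only once for each \<open>k\<close> on a branch of nested families, at the cost of the factor
  \<open>C k / C (Suc k)\<close>.\<close>

lemma window_estimate:
  assumes "t K \<le> a" "a \<le> c" "c \<le> t m" "d \<le> K"
  shows "F (window a c X) \<le> C K * A a c + err K d a c"
  using assms
proof (induction "c - a" arbitrary: a c K d rule: less_induct)
  case less
  let ?B = "C K * A a c + err K d a c"
  have CA: "0 \<le> C K * A a c" using C_bounds(1)[of K] A_nonneg[OF less.prems(2)] by simp
  then have B0: "0 \<le> ?B" using err_nonneg[of K d a c] by simp
  show ?case
  proof (cases "a < c")
    case False
    then show ?thesis using B0 by (simp add: window_empty)
  next
    case ac: True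
    have Km: "K < m" using less.prems ac incseqD[OF t_inc, of m K] by (cases "K < m") auto
    show ?thesis
    proof (rule interval_upper[OF B0])
      fix i assume i: "a \<le> i" "i < c"
      define k where "k = blk i"
      have k: "t k \<le> i" "i < t (Suc k)" unfolding k_def by (rule blk_bounds)+
      have "K \<le> k" using incseqD[OF t_inc, of "Suc k" K] k less.prems i by (cases "K \<le> k") auto
      moreover have "k < m" using incseqD[OF t_inc, of m k] k less.prems i by (cases "k < m") auto
      ultimately have kI: "k \<in> {K..<m}" by simp
      have "norm (X i) = X i" using X_nonneg[of i] by simp
      also have "\<dots> = b k * (v k ((i - t k) mod V k) / real (N k))"
        by (simp add: X_def w_def k_def)
      also have "\<dots> \<le> b k * (3 / real (N k))"
      proof (intro mult_left_mono divide_right_mono b_nonneg)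
        show "v k ((i - t k) mod V k) \<le> 3"
          using norm_le_F_window[of 0 "(i - t k) mod V k" "V k" "v k"] v_norm[of k] V_pos[of k] by simp
      qed simp
      also have "\<dots> \<le> b k * (e k d + h k d * \<mu> k a c)"
      proof (intro mult_left_mono b_nonneg)
        show "3 / real (N k) \<le> e k d + h k d * \<mu> k a c"
          using N_\<eta>(2)[of k] \<eta>_le_e[of k d] mult_nonneg_nonneg[OF h_nonneg[of k d] \<mu>_nonneg[of k a c]] by linarith
      qed
      also have "\<dots> \<le> err K d a c"
        unfolding err_def by (rule member_le_sum[OF kI]) (auto intro: err_term_nonneg)
      finally show "norm (X i) \<le> ?B" using CA by linarith
    next
      fix r q assume r: "2 \<le> r" and q: "incseq q" "q 0 = a" "q r = c"
        and short: "\<And>i. i < r \<Longrightarrow> q (Suc i) - q i < c - a"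
      let ?f = "schlumprecht_f (real r)"
      have f: "3/2 \<le> ?f" using r by (intro schlumprecht_f_ge) simp
      \<comment> \<open>One level deeper, for the part from position \<open>s\<close> on: fewer than
        \<open>\<rho> k\<close> pieces with error \<open>e k (Suc d)\<close> each add up to at most
        \<open>e k d\<close>, and the growth of \<open>h\<close> by 3/2 is absorbed by f(r).\<close>
      have tail: "(\<Sum>i<r. F (window (max (q i) s) (max (q (Suc i)) s) X)) \<le>
          C K' * (\<Sum>i<r. A (max (q i) s) (max (q (Suc i)) s)) + ?f * err K' d a c"
        if K': "Suc d \<le> K'" "r < \<rho> K'" "t K' \<le> max a s" "s \<le> t m" for K' s
      proof -
        let ?q = "\<lambda>i. max (q i) s"
        have inc: "incseq ?q" by (rule incseq_max[OF q(1)])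
        have "(\<Sum>i<r. F (window (?q i) (?q (Suc i)) X)) \<le>
            (\<Sum>i<r. C K' * A (?q i) (?q (Suc i)) + err K' (Suc d) (?q i) (?q (Suc i)))"
        proof (intro sum_mono less.hyps)
          fix i assume "i \<in> {..<r}"
          then have i: "i < r" by simp
          have qi: "q i \<le> q (Suc i)" "q 0 \<le> q i" "q (Suc i) \<le> q r"
            using i by (auto intro!: incseqD[OF q(1)])
          show "?q (Suc i) - ?q i < c - a" using short[OF i] qi by linarith
          show "t K' \<le> ?q i" using K'(3) qi q(2) by linarith
          show "?q i \<le> ?q (Suc i)" using qi by linarith
          show "?q (Suc i) \<le> t m" using K'(4) qi q(3) less.prems(3) by linarith
          show "Suc d \<le> K'" by (rule K'(1))
        qed
        also have "\<dots> = C K' * (\<Sum>i<r. A (?q i) (?q (Suc i))) +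
            (\<Sum>i<r. err K' (Suc d) (?q i) (?q (Suc i)))"
          by (simp add: sum.distrib sum_distrib_left)
        also have "(\<Sum>i<r. err K' (Suc d) (?q i) (?q (Suc i))) =
            (\<Sum>k\<in>{K'..<m}. b k * (real r * e k (Suc d) + h k (Suc d) * \<mu> k (?q 0) (?q r)))"
          unfolding err_def \<mu>_sum[OF inc, symmetric]
          by (subst sum.swap) (simp add: sum.distrib flip: sum_distrib_left)
        also have "\<dots> \<le> (\<Sum>k\<in>{K'..<m}. ?f * (b k * (e k d + h k d * \<mu> k a c)))"
        proof (rule sum_mono)
          fix k assume "k \<in> {K'..<m}"
          then have k: "K' \<le> k" "Suc d \<le> k" using K' by auto
          have "real r \<le> real (\<rho> k)" using K'(2) incseqD[OF \<rho>_mono k(1)] by simp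
          then have "real r * e k (Suc d) \<le> real (\<rho> k) * e k (Suc d)"
            by (intro mult_right_mono e_nonneg)
          also have "\<dots> = 1 * e k d" using e_Suc[OF k(2)] by simp
          also have "\<dots> \<le> ?f * e k d" using f by (intro mult_right_mono e_nonneg) auto
          finally have 1: "real r * e k (Suc d) \<le> ?f * e k d" .
          have "h k (Suc d) \<le> ?f * h k d"
            unfolding h_Suc[OF k(2)] by (intro mult_right_mono f h_nonneg)
          moreover have "\<mu> k (?q 0) (?q r) \<le> \<mu> k a c"
            using \<mu>_max[OF less.prems(2), of k s] q(2,3) by simp
          ultimately have "h k (Suc d) * \<mu> k (?q 0) (?q r) \<le> (?f * h k d) * \<mu> k a c"
            using f h_nonneg[of k d] by (intro mult_mono \<mu>_nonneg mult_nonneg_nonneg) auto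
          with 1 have "b k * (real r * e k (Suc d) + h k (Suc d) * \<mu> k (?q 0) (?q r)) \<le>
              b k * (?f * e k d + ?f * h k d * \<mu> k a c)"
            by (intro mult_left_mono add_mono b_nonneg)
          then show "b k * (real r * e k (Suc d) + h k (Suc d) * \<mu> k (?q 0) (?q r)) \<le>
              ?f * (b k * (e k d + h k d * \<mu> k a c))"
            by (simp add: algebra_simps)
        qed
        also have "\<dots> = ?f * err K' d a c" by (simp add: err_def sum_distrib_left)
        finally show ?thesis by simp
      qed
      have A_tail: "(\<Sum>i<r. A (max (q i) s) (max (q (Suc i)) s)) \<le> ?f * A a c" for s
      proof -
        have "(\<Sum>i<r. A (max (q i) s) (max (q (Suc i)) s)) \<le> ?f * A (max a s) (max c s)"
          using A_sum(1)[OF incseq_max[OF q(1)], of s r] q by simp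
        also have "\<dots> \<le> ?f * A a c" using f A_max[OF less.prems(2)] by (intro mult_left_mono) auto
        finally show ?thesis .
      qed
      \<comment> \<open>For a family with \<open>\<rho> k \<le> r\<close> the full l1-norms of the
        blocks before \<open>k\<close> fit into their error terms.\<close>
      have far: "(\<Sum>j\<in>{a..<min c (t k)}. norm (X j)) \<le>
          ?f * (\<Sum>l\<in>{K..<k}. b l * (e l d + h l d * \<mu> l a c))" if "\<rho> k \<le> r" for k
      proof -
        have "(\<Sum>j\<in>{a..<min c (t k)}. norm (X j)) \<le>
            (\<Sum>l\<in>{K..<k}. b l * (\<eta> l * schlumprecht_f (real (\<rho> (Suc l)))))"
          using less.prems by (intro X_l1) auto
        also have "\<dots> \<le> (\<Sum>l\<in>{K..<k}. b l * ((e l d + h l d * \<mu> l a c) * ?f))"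
        proof (intro sum_mono mult_left_mono b_nonneg mult_mono)
          fix l assume "l \<in> {K..<k}"
          then have "\<rho> (Suc l) \<le> r" using that incseqD[OF \<rho>_mono, of "Suc l" k] by simp
          then show "schlumprecht_f (real (\<rho> (Suc l))) \<le> ?f" by (intro schlumprecht_f_mono) auto
          show "\<eta> l \<le> e l d + h l d * \<mu> l a c"
            using \<eta>_le_e[of l d] mult_nonneg_nonneg[OF h_nonneg[of l d] \<mu>_nonneg[of l a c]] by linarith
          show "0 \<le> e l d + h l d * \<mu> l a c"
            using e_nonneg h_nonneg \<mu>_nonneg by simp
          show "0 \<le> schlumprecht_f (real (\<rho> (Suc l)))" by (simp add: schlumprecht_f_nonneg)
        qed
        also have "\<dots> = ?f * (\<Sum>l\<in>{K..<k}. b l * (e l d + h l d * \<mu> l a c))"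
          by (simp add: sum_distrib_left mult_ac)
        finally show ?thesis .
      qed
      \<comment> \<open>While \<open>d < K\<close>, the depth may still grow. At
        \<open>d = K\<close> the first block is split off and charged to \<open>h K K = 3\<close>.
        With \<open>\<rho> m \<le> r\<close> all blocks are negligible; otherwise exactly one block
        is normed.\<close>
      consider "r < \<rho> K" "d < K" | "r < \<rho> K" "d = K" | "\<rho> m \<le> r" | "\<rho> K \<le> r" "r < \<rho> m"
        using less.prems(4) by linarith
      then show "(\<Sum>i<r. F (window (q i) (q (Suc i)) X)) \<le> ?f * ?B"
      proof cases
        case 1
        have "(\<Sum>i<r. F (window (q i) (q (Suc i)) X)) \<le>
            C K * (\<Sum>i<r. A (q i) (q (Suc i))) + ?f * err K d a c"
          using tail[of K 0] 1 less.prems(1) by simp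
        also have "C K * (\<Sum>i<r. A (q i) (q (Suc i))) \<le> C K * (?f * A a c)"
          using A_tail[of 0] C_bounds(1)[of K] by (intro mult_left_mono) auto
        finally show ?thesis by (simp add: algebra_simps)
      next
        case 2
        let ?s = "t (Suc K)"
        have sm: "?s \<le> t m" using Km by (intro incseqD[OF t_inc]) simp
        have rK: "r < \<rho> (Suc K)" using 2(1) incseqD[OF \<rho>_mono, of K "Suc K"] by simp
        have "(\<Sum>i<r. F (window (min (q i) ?s) (min (q (Suc i)) ?s) X)) \<le>
            (\<Sum>i<r. b K * (3 * \<mu> K (q i) (q (Suc i)) + 3 / real (N K)))"
        proof (rule sum_mono)
          fix i
          have "a \<le> q i" using incseqD[OF q(1), of 0 i] q(2) by simp
          then have "F (window (min (q i) ?s) (min (q (Suc i)) ?s) X) \<le>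
              b K * (3 * \<mu> K (min (q i) ?s) (min (q (Suc i)) ?s) + 3 / real (N K))"
            using less.prems(1) t_strict[of K] by (intro block_le[OF Km]) auto
          also have "\<mu> K (min (q i) ?s) (min (q (Suc i)) ?s) \<le> \<mu> K (q i) (q (Suc i))"
          proof (rule \<mu>_le)
            fix \<omega> assume "min (q i) ?s \<le> rep \<omega> K" "rep \<omega> K < min (q (Suc i)) ?s"
            then show "q i \<le> rep \<omega> K \<and> rep \<omega> K < q (Suc i)" by linarith
          qed
          finally show "F (window (min (q i) ?s) (min (q (Suc i)) ?s) X) \<le>
              b K * (3 * \<mu> K (q i) (q (Suc i)) + 3 / real (N K))"
            using b_nonneg[of K] by (simp add: mult_left_mono)
        qed
        also have "\<dots> = b K * (3 * \<mu> K a c + 3 * real r / real (N K))"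
          using \<mu>_sum[OF q(1), of K r] q by (simp add: sum.distrib mult.commute flip: sum_distrib_left)
        also have "\<dots> \<le> b K * (?f * (e K d + h K d * \<mu> K a c))"
        proof (intro mult_left_mono b_nonneg)
          have "3 * real r / real (N K) \<le> 3 * real (\<rho> K) / real (N K)"
            using 2(1) by (intro divide_right_mono) auto
          then have "3 * real r / real (N K) \<le> e K d" using N_\<eta>(1)[of K] \<eta>_le_e[of K d] by linarith
          moreover have "h K d = 3" using 2 by (simp add: h_def)
          ultimately have "3 * \<mu> K a c + 3 * real r / real (N K) \<le> 1 * (e K d + h K d * \<mu> K a c)" by simp
          also have "\<dots> \<le> ?f * (e K d + h K d * \<mu> K a c)"
            using f e_nonneg h_nonneg \<mu>_nonneg by (intro mult_right_mono add_nonneg_nonneg mult_nonneg_nonneg) auto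
          finally show "3 * \<mu> K a c + 3 * real r / real (N K) \<le> ?f * (e K d + h K d * \<mu> K a c)" .
        qed
        finally have low: "(\<Sum>i<r. F (window (min (q i) ?s) (min (q (Suc i)) ?s) X)) \<le> \<dots>" .
        have "(\<Sum>i<r. F (window (q i) (q (Suc i)) X)) \<le>
            (\<Sum>i<r. F (window (min (q i) ?s) (min (q (Suc i)) ?s) X)) +
            (\<Sum>i<r. F (window (max (q i) ?s) (max (q (Suc i)) ?s) X))"
          unfolding sum.distrib[symmetric] by (intro sum_mono window_split)
        also have "\<dots> \<le> b K * (?f * (e K d + h K d * \<mu> K a c)) +
            (C (Suc K) * (\<Sum>i<r. A (max (q i) ?s) (max (q (Suc i)) ?s)) + ?f * err (Suc K) d a c)"
          using 2 by (intro add_mono low tail rK sm) auto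
        also have "C (Suc K) * (\<Sum>i<r. A (max (q i) ?s) (max (q (Suc i)) ?s)) \<le> C (Suc K) * (?f * A a c)"
          using A_tail[of ?s] C_bounds(1)[of "Suc K"] by (intro mult_left_mono) auto
        also have "\<dots> \<le> C K * (?f * A a c)"
          using C_bounds(3)[of K] f A_nonneg[OF less.prems(2)] by (intro mult_right_mono) auto
        finally have "(\<Sum>i<r. F (window (q i) (q (Suc i)) X)) \<le>
          b K * (?f * (e K d + h K d * \<mu> K a c)) + (C K * (?f * A a c) + ?f * err (Suc K) d a c)"
          by simp
        also have "\<dots> = ?f * ?B" unfolding err_split[OF order_refl Km, of d a c]
          by (simp add: algebra_simps)
        finally show ?thesis .
      next
        case 3
        have "(\<Sum>i<r. F (window (q i) (q (Suc i)) X)) \<le> (\<Sum>j\<in>{a..<min c (t m)}. norm (X j))"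
          using interval_l1[OF q(1), of X r] q less.prems(3) by (simp add: min_def)
        also have "\<dots> \<le> ?f * err K d a c" unfolding err_def by (rule far[OF 3])
        finally show ?thesis using mult_nonneg_nonneg[OF _ CA, of ?f] f by (simp add: distrib_left)
      next
        case 4
        \<comment> \<open>The block normed by the family is \<open>n - 1\<close>; monotonicity of
          \<open>\<rho>\<close> puts it between \<open>K\<close> and \<open>m\<close>.\<close>
        define n where "n = (LEAST n. r < \<rho> n)"
        have n: "r < \<rho> n" unfolding n_def by (rule LeastI[of _ m]) (rule 4)
        have nm: "n \<le> m" unfolding n_def by (rule Least_le) (rule 4)
        have Kn: "K < n" using 4(1) n incseqD[OF \<rho>_mono, of n K] by (cases "K < n") auto
        define k where "k = n - 1"
        have nk: "n = Suc k" and Kk: "K \<le> k" and km: "k < m" using Kn nm by (auto simp: k_def)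
        have rk: "\<rho> k \<le> r" using not_less_Least[of k "\<lambda>n. r < \<rho> n"] nk unfolding n_def by auto
        have rk': "r < \<rho> (Suc k)" using n nk by simp
        let ?s = "t k" and ?s' = "t (Suc k)"
        have ss': "?s \<le> ?s'" using t_strict[of k] by simp
        have sm: "?s' \<le> t m" using km by (intro incseqD[OF t_inc]) simp
        let ?p = "\<lambda>i. min (max (q i) ?s) ?s'"
        have p: "incseq ?p" by (intro incseq_min incseq_max q(1))
        have "(\<Sum>i<r. F (window (q i) (q (Suc i)) X)) \<le>
            (\<Sum>i<r. F (window (min (q i) ?s) (min (q (Suc i)) ?s) X)) +
            ((\<Sum>i<r. F (window (?p i) (?p (Suc i)) X)) +
            (\<Sum>i<r. F (window (max (q i) ?s') (max (q (Suc i)) ?s') X)))"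
          unfolding sum.distrib[symmetric]
        proof (rule sum_mono)
          fix i
          have "max (max (q i) ?s) ?s' = max (q i) ?s'" for i using ss' by linarith
          then show "F (window (q i) (q (Suc i)) X) \<le> F (window (min (q i) ?s) (min (q (Suc i)) ?s) X) +
            (F (window (?p i) (?p (Suc i)) X) + F (window (max (q i) ?s') (max (q (Suc i)) ?s') X))"
            using window_split[of "q i" "q (Suc i)" X ?s]
              window_split[of "max (q i) ?s" "max (q (Suc i)) ?s" X ?s'] by (simp del: t.simps)
        qed
        also have "(\<Sum>i<r. F (window (min (q i) ?s) (min (q (Suc i)) ?s) X)) \<le>
            ?f * (\<Sum>l\<in>{K..<k}. b l * (e l d + h l d * \<mu> l a c))"
        proof -
          have "(\<Sum>i<r. F (window (min (q i) ?s) (min (q (Suc i)) ?s) X)) \<le>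
              (\<Sum>j\<in>{min a ?s..<min c ?s}. norm (X j))"
            using interval_l1[OF incseq_min[OF q(1)], of ?s X r] q by simp
          also have "{min a ?s..<min c ?s} = {a..<min c ?s}" by auto
          finally show ?thesis using far[OF rk] by linarith
        qed
        also have "(\<Sum>i<r. F (window (?p i) (?p (Suc i)) X)) \<le> ?f * (b k * (3 * \<mu> k a c + e k d))"
        proof -
          have "(\<Sum>i<r. F (window (?p i) (?p (Suc i)) X)) \<le> ?f * F (window (?p 0) (?p r) X)"
            by (rule interval_lower[OF p])
          also have "\<dots> \<le> ?f * (b k * (3 * \<mu> k (?p 0) (?p r) + 3 / real (N k)))"
            using f ss' by (intro mult_left_mono block_le km) auto
          also have "\<dots> \<le> ?f * (b k * (3 * \<mu> k a c + e k d))"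
          proof (intro mult_left_mono add_mono b_nonneg)
            show "\<mu> k (?p 0) (?p r) \<le> \<mu> k a c"
            proof (rule \<mu>_le)
              fix \<omega> assume "?p 0 \<le> rep \<omega> k" "rep \<omega> k < ?p r"
              then show "a \<le> rep \<omega> k \<and> rep \<omega> k < c"
                using rep_bounds[of k \<omega>] q(2,3) by linarith
            qed
            show "3 / real (N k) \<le> e k d" using N_\<eta>(2)[of k] \<eta>_le_e[of k d] by linarith
          qed (use f in auto)
          finally show ?thesis .
        qed
        \<comment> \<open>The later blocks are charged to \<open>A1\<close> and not to
          \<open>A\<close>. Lowering the constant from \<open>C k\<close> to
          \<open>C (Suc k)\<close> in the induction hypothesis makes up for the factor f(2
          r).\<close>
        also have "(\<Sum>i<r. F (window (max (q i) ?s') (max (q (Suc i)) ?s') X)) \<le>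
            ?f * (C K * A1 (max a ?s') (max c ?s')) + ?f * err (Suc k) d a c"
        proof -
          have "(\<Sum>i<r. F (window (max (q i) ?s') (max (q (Suc i)) ?s') X)) \<le>
              C (Suc k) * (\<Sum>i<r. A (max (q i) ?s') (max (q (Suc i)) ?s')) + ?f * err (Suc k) d a c"
            using less.prems(4) Kk by (intro tail rk' sm) auto
          also have "C (Suc k) * (\<Sum>i<r. A (max (q i) ?s') (max (q (Suc i)) ?s')) \<le>
              C (Suc k) * (schlumprecht_f (2 * real r) * A1 (max a ?s') (max c ?s'))"
            using A_sum(2)[OF incseq_max[OF q(1)], of ?s' r] q C_bounds(1)[of "Suc k"]
            by (intro mult_left_mono) auto
          also have "\<dots> = (C (Suc k) * schlumprecht_f (2 * real r)) * A1 (max a ?s') (max c ?s')" by simp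
          also have "\<dots> \<le> (C k * ?f) * A1 (max a ?s') (max c ?s')"
            by (intro mult_right_mono C_step rk A1_nonneg)
          also have "\<dots> \<le> (C K * ?f) * A1 (max a ?s') (max c ?s')"
            using f by (intro mult_right_mono C_antimono Kk A1_nonneg) auto
          finally show ?thesis by (simp add: mult_ac)
        qed
        finally have total: "(\<Sum>i<r. F (window (q i) (q (Suc i)) X)) \<le>
            ?f * ((\<Sum>l\<in>{K..<k}. b l * (e l d + h l d * \<mu> l a c)) + (b k * (3 * \<mu> k a c + e k d) +
            (C K * A1 (max a ?s') (max c ?s') + err (Suc k) d a c)))"
          by (simp add: distrib_left)
        have bonus: "3 * (b k * \<mu> k a c) + C K * A1 (max a ?s') (max c ?s') \<le> C K * A a c"
        proof -
          have "3 * (b k * \<mu> k a c) \<le> C K * (b k * \<mu> k a c)"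
            using C_bounds(1)[of K] b_nonneg \<mu>_nonneg by (intro mult_right_mono mult_nonneg_nonneg)
          moreover have "C K * (b k * \<mu> k a c + A1 (max a ?s') (max c ?s')) \<le> C K * A a c"
            using C_bounds(1)[of K] by (intro mult_left_mono A_bonus km less.prems(2)) auto
          ultimately show ?thesis by (simp add: distrib_left)
        qed
        have "0 \<le> b k * (h k d * \<mu> k a c)" using b_nonneg h_nonneg \<mu>_nonneg by simp
        then have "(\<Sum>l\<in>{K..<k}. b l * (e l d + h l d * \<mu> l a c)) + (b k * (3 * \<mu> k a c + e k d) +
            (C K * A1 (max a ?s') (max c ?s') + err (Suc k) d a c)) \<le> ?B"
          using bonus unfolding err_split[OF Kk km, of d a c] by (simp add: distrib_left)
        then have "?f * ((\<Sum>l\<in>{K..<k}. b l * (e l d + h l d * \<mu> l a c)) + (b k * (3 * \<mu> k a c + e k d) +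
            (C K * A1 (max a ?s') (max c ?s') + err (Suc k) d a c))) \<le> ?f * ?B"
          using f by (intro mult_left_mono) auto
        with total show ?thesis by linarith
      qed
    qed
  qed
qed

lemma sum_geometric_le:
  fixes x :: real
  assumes "0 \<le> x" "x < 1"
  shows "(\<Sum>k<n. x ^ k) \<le> 1 / (1 - x)"
proof -
  have "(\<Sum>k<n. x ^ k) = (1 - x ^ n) / (1 - x)" using assms sum_gp_strict[of x n] by simp
  also have "\<dots> \<le> 1 / (1 - x)" using assms by (intro divide_right_mono) auto
  finally show ?thesis .
qed

text \<open>The constant is 6 * 2 + 2 + 9: a bound for \<open>C 0\<close> times the comparison of
  \<open>split_norm\<close> with \<open>F\<close>, and bounds for the sums of (1/2)^k and 3 (2/3)^k
  in the error.\<close>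

lemma blocks_dominated: "F (window 0 (t m) X) \<le> 23 * F (window 0 m b)"
proof -
  let ?B = "F (window 0 m b)"
  have "F (window 0 (t m) X) \<le> C 0 * A 0 (t m) + err 0 0 0 (t m)"
    by (rule window_estimate) auto
  also have "C 0 * A 0 (t m) \<le> 6 * (2 * ?B)"
  proof -
    have \<kappa>: "\<kappa> m \<omega> 0 = 0" "\<kappa> m \<omega> (t m) = m" for \<omega>
    proof -
      show "\<kappa> m \<omega> 0 = 0" by (simp add: \<kappa>_def)
      have "rep \<omega> k < t m" if "k < m" for k
        using rep_bounds(2)[of \<omega> k] incseqD[OF t_inc, of "Suc k" m] that by simp
      then have "{k. k < m \<and> rep \<omega> k < t m} = {..<m}" by auto
      then show "\<kappa> m \<omega> (t m) = m" by (simp add: \<kappa>_def)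
    qed
    have "A 0 (t m) \<le> (\<Sum>\<omega><W. 2 * ?B) / real W"
      unfolding A_def \<kappa> by (intro divide_right_mono sum_mono split_norm_le) auto
    also have "\<dots> = 2 * ?B" using W_pos by simp
    finally show ?thesis using C_bounds[of 0] F_window_nonneg[of 0 m b] A_nonneg[of 0 "t m"]
      by (intro mult_mono) auto
  qed
  also have "err 0 0 0 (t m) \<le> (\<Sum>k<m. ?B * ((1/2) ^ k + 3 * (2/3) ^ k))"
    unfolding err_def atLeast0LessThan
  proof (rule sum_mono)
    fix k assume "k \<in> {..<m}"
    then have "b k \<le> ?B" using norm_le_F_window[of 0 k m b] b_nonneg[of k] by simp
    moreover have "e k 0 = (1/2) ^ k" using \<rho>_pos[of k] by (simp add: e_def \<eta>_def power_one_over)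
    moreover have "h k 0 * \<mu> k 0 (t m) \<le> 3 * (2/3) ^ k * 1"
      unfolding h_def by (intro mult_mono \<mu>_le_1) (auto simp: \<mu>_nonneg)
    moreover have "0 \<le> e k 0 + h k 0 * \<mu> k 0 (t m)"
      using e_nonneg h_nonneg \<mu>_nonneg by simp
    ultimately show "b k * (e k 0 + h k 0 * \<mu> k 0 (t m)) \<le> ?B * ((1/2) ^ k + 3 * (2/3) ^ k)"
      using F_window_nonneg[of 0 m b] by (intro mult_mono[of "b k"]) auto
  qed
  also have "\<dots> = ?B * ((\<Sum>k<m. (1/2) ^ k) + 3 * (\<Sum>k<m. (2/3) ^ k))"
    by (simp add: sum.distrib flip: sum_distrib_left)
  also have "\<dots> \<le> ?B * (2 + 3 * 3)"
    using sum_geometric_le[of "1/2" m] sum_geometric_le[of "2/3" m]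
    by (intro mult_left_mono F_window_nonneg) auto
  finally show ?thesis by simp
qed

end

end

section \<open>Summing functionals and bounded completeness\<close>

context schlumprecht_norm
begin

text \<open>Cutting at the points of \<open>S\<close> gives one interval for each of them. Thus
  summation over \<open>S\<close>, divided by f(card S), is a functional of norm at most 1 even with
  arbitrary signs.\<close>

lemma sum_le_F_window:
  assumes "S \<subseteq> {a..<c}"
  shows "(\<Sum>i\<in>S. norm (x i)) \<le> schlumprecht_f (real (card S)) * F (window a c x)"
proof -
  have fin: "finite S" using assms by (rule finite_subset) simp
  define xs where "xs = sorted_list_of_set S"
  define r where "r = card S"
  have xs: "sorted_wrt (<) xs" "set xs = S" "length xs = r" "distinct xs"
    using fin by (auto simp: xs_def r_def)
  define q where "q i = (if i < r then xs ! i else c)" for i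
  have mem: "xs ! i \<in> S" if "i < r" for i using that xs(2,3) nth_mem by blast
  have q: "incseq q"
  proof (rule incseq_SucI)
    fix i show "q i \<le> q (Suc i)"
      using sorted_wrt_nth_less[OF xs(1), of i "Suc i"] mem[of i] assms xs(3) by (auto simp: q_def)
  qed
  have "(\<Sum>i\<in>S. norm (x i)) = (\<Sum>i<r. norm (x (xs ! i)))"
    using sum.reindex_bij_betw[OF bij_betw_nth[OF xs(4), of "{..<r}" S], of "\<lambda>i. norm (x i)"] xs by simp
  also have "\<dots> \<le> (\<Sum>i<r. F (window (q i) (q (Suc i)) x))"
  proof (rule sum_mono)
    fix i assume "i \<in> {..<r}"
    then have i: "i < r" by simp
    have "xs ! i < q (Suc i)"
      using sorted_wrt_nth_less[OF xs(1), of i "Suc i"] mem[OF i] assms xs(3) by (auto simp: q_def)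
    then show "norm (x (xs ! i)) \<le> F (window (q i) (q (Suc i)) x)"
      using i by (intro norm_le_F_window) (auto simp: q_def)
  qed
  also have "\<dots> \<le> schlumprecht_f (real r) * F (window (q 0) (q r) x)"
    by (rule interval_lower[OF q])
  also have "\<dots> \<le> schlumprecht_f (real r) * F (window a c x)"
  proof (intro mult_left_mono F_window_mono)
    fix i assume "q 0 \<le> i" "i < q r"
    moreover have "a \<le> q 0 \<or> c \<le> q 0" using mem[of 0] assms by (auto simp: q_def)
    ultimately show "a \<le> i \<and> i < c \<and> norm (x i) \<le> norm (x i)" by (auto simp: q_def)
  qed (simp add: schlumprecht_f_nonneg)
  finally show ?thesis by (simp add: r_def)
qed

text \<open>Otherwise there are arbitrarily many successive blocks of norm above
  \<open>\<epsilon>\<close>, and the implicit equation gives r \<epsilon> \<le> f(r) B for all r,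
  although f grows only logarithmically.\<close>

lemma boundedly_complete:
  assumes B: "\<And>n. F (window 0 n x) \<le> B" and \<epsilon>: "0 < \<epsilon>"
  obtains M where "\<And>n. F (window M n x) \<le> \<epsilon>"
proof (rule ccontr)
  assume "\<not> thesis"
  then have "\<exists>n. \<epsilon> < F (window M n x)" for M using that not_le by blast
  then obtain g where g: "\<And>M. \<epsilon> < F (window M (g M) x)" by metis
  define q where "q i = (g ^^ i) 0" for i
  have gM: "M \<le> g M" for M
  proof (rule ccontr)
    assume "\<not> M \<le> g M"
    then have "F (window M (g M) x) = 0" by (simp add: window_empty)
    with g[of M] \<epsilon> show False by simp
  qed
  have q: "incseq q" by (rule incseq_SucI) (simp add: q_def gM)
  have B0: "0 \<le> B" using B[of 0] F_window_nonneg[of 0 0 x] by linarith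
  have bound: "real r * \<epsilon> \<le> schlumprecht_f (real r) * B" for r
  proof -
    have "real r * \<epsilon> = (\<Sum>i<r. \<epsilon>)" by simp
    also have "\<dots> \<le> (\<Sum>i<r. F (window (q i) (q (Suc i)) x))"
      by (rule sum_mono) (simp add: q_def less_imp_le[OF g])
    also have "\<dots> \<le> schlumprecht_f (real r) * F (window (q 0) (q r) x)" by (rule interval_lower[OF q])
    also have "\<dots> \<le> schlumprecht_f (real r) * B"
      using B[of "q r"] by (intro mult_left_mono) (auto simp: q_def schlumprecht_f_nonneg)
    finally show ?thesis .
  qed
  \<comment> \<open>The contradiction is taken at r = 4^i, where f(r) \<le> 2 i + 1 while r \<ge> (i
    + 1)^2.\<close>
  obtain i where i: "2 * (B / \<epsilon>) \<le> real i" using real_arch_simple by blast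
  have "real i + 1 \<le> 2 ^ i"
    using of_nat_mono[OF Suc_leI[OF less_exp[of i]], where 'a = real] by simp
  then have "(real i + 1) * (real i + 1) \<le> 2 ^ i * 2 ^ i" by (intro mult_mono) auto
  also have "\<dots> = (2::real) ^ (2 * i)" by (simp add: mult_2 power_add)
  finally have "(real i + 1) * (real i + 1) * \<epsilon> \<le> real (2 ^ (2 * i)) * \<epsilon>"
    using \<epsilon> by (intro mult_right_mono) auto
  also have "\<dots> \<le> schlumprecht_f (real (2 ^ (2 * i))) * B" by (rule bound)
  also have "\<dots> \<le> (real (2 * i) + 1) * B"
    using schlumprecht_f_pow2(2)[of "2 * i"] B0 by (intro mult_right_mono) auto
  also have "\<dots> = (2 * real i + 1) * B" by simp
  finally have 1: "(real i + 1) * (real i + 1) * \<epsilon> \<le> (2 * real i + 1) * B" .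
  have "2 * B \<le> real i * \<epsilon>" using i \<epsilon> by (simp add: field_simps)
  then have "(real i + 1) * (2 * B) \<le> (real i + 1) * (real i * \<epsilon>)" by (intro mult_left_mono) auto
  moreover have "0 < (real i + 1) * \<epsilon>" using \<epsilon> by simp
  ultimately show False using 1 B0 by (simp add: algebra_simps)
qed

end

section \<open>Choice of the parameters\<close>

context schlumprecht_real_norm
begin

text \<open>\<open>\<rho> k\<close> determines \<open>N k\<close>, this determines the vector of
  block \<open>k\<close>, and its l1-norm dictates the size of \<open>\<rho> (Suc k)\<close>. So
  only \<open>\<rho>\<close> is chosen recursively; all other data are functions of \<open>k\<close>
  and \<open>\<rho> k\<close>.\<close>

lemma block_system_exists:
  fixes p :: "nat \<Rightarrow> nat"
  obtains \<rho> N V v A where "block_system F \<rho> N V v" "\<And>k. linf_vector (p k) (N k) (V k) (v k) (A k)"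
proof -
  define NN where "NN k r = 3 * 2 ^ k * r ^ (k + 1)" for k r :: nat
  have NN: "0 < NN k r" if "0 < r" for k r using that by (simp add: NN_def)
  define Z where "Z k r = (SOME z. linf_vector (p k) (NN k r) (fst z) (fst (snd z)) (snd (snd z)))" for k r
  define VV where "VV k r = fst (Z k r)" for k r
  define vv where "vv k r = fst (snd (Z k r))" for k r
  define AA where "AA k r = snd (snd (Z k r))" for k r
  have vec: "linf_vector (p k) (NN k r) (VV k r) (vv k r) (AA k r)" if r: "0 < r" for k r
  proof -
    obtain V v A where "linf_vector (p k) (NN k r) V v A"
      using linf_vector_exists[OF NN[OF r, of k], of "p k"] by blast
    then have "linf_vector (p k) (NN k r) (fst (V, v, A)) (fst (snd (V, v, A))) (snd (snd (V, v, A)))" by simp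
    then show ?thesis unfolding VV_def vv_def AA_def Z_def by (rule someI)
  qed
  have large: "\<exists>r. s \<le> r \<and> B1 \<le> schlumprecht_f (real r) \<and> B2 \<le> schlumprecht_f (real r)" for s B1 B2
  proof -
    obtain R1 R2 where "\<forall>r\<ge>R1. B1 \<le> schlumprecht_f (real r)" "\<forall>r\<ge>R2. B2 \<le> schlumprecht_f (real r)"
      using schlumprecht_f_unbounded by meson
    then show ?thesis by (intro exI[of _ "max s (max R1 R2)"]) auto
  qed
  have "\<exists>\<rho>. \<forall>k. 2 ^ (k + 2) \<le> schlumprecht_f (real (\<rho> k)) \<and> (\<rho> k \<le> \<rho> (Suc k) \<and>
    2 ^ k * real (\<rho> k) ^ k * (\<Sum>i<VV k (\<rho> k). vv k (\<rho> k) i) \<le> schlumprecht_f (real (\<rho> (Suc k))))"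
    by (rule dependent_nat_choice[where P = "\<lambda>k r. 2 ^ (k + 2) \<le> schlumprecht_f (real r)"])
       (use large in blast)+
  then obtain \<rho> where \<rho>: "\<And>k. 2 ^ (k + 2) \<le> schlumprecht_f (real (\<rho> k))" "\<And>k. \<rho> k \<le> \<rho> (Suc k)"
    "\<And>k. 2 ^ k * real (\<rho> k) ^ k * (\<Sum>i<VV k (\<rho> k). vv k (\<rho> k) i) \<le> schlumprecht_f (real (\<rho> (Suc k)))"
    by blast
  have pos: "0 < \<rho> k" for k
  proof (rule ccontr)
    assume "\<not> ?thesis"
    then have "schlumprecht_f (real (\<rho> k)) = 0" by simp
    moreover have "(0::real) < 2 ^ (k + 2)" by simp
    ultimately show False using \<rho>(1)[of k] by linarith
  qed
  have vec': "linf_vector (p k) (NN k (\<rho> k)) (VV k (\<rho> k)) (vv k (\<rho> k)) (AA k (\<rho> k))" for k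
    by (rule vec[OF pos])
  have le3: "F (window 0 (VV k (\<rho> k)) (vv k (\<rho> k))) \<le> 3" for k
  proof -
    have "F (window 0 (VV k (\<rho> k)) (vv k (\<rho> k))) \<le> 3 - (1/2) ^ p k"
      using vec'[of k] unfolding linf_vector_def by blast
    moreover have "0 < (1/2::real) ^ p k" by simp
    ultimately show ?thesis by linarith
  qed
  have "block_system F \<rho> (\<lambda>k. NN k (\<rho> k)) (\<lambda>k. VV k (\<rho> k)) (\<lambda>k. vv k (\<rho> k))"
  proof (unfold_locales)
    show "incseq \<rho>" by (rule incseq_SucI) (rule \<rho>)
    show "0 < VV k (\<rho> k)" for k using vec'[of k] unfolding linf_vector_def by blast
    show "0 \<le> vv k (\<rho> k) i" for k i using vec'[of k] unfolding linf_vector_def by blast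
  qed (use \<rho> le3 in \<open>auto simp: NN_def\<close>)
  then show ?thesis using vec' by (rule that)
qed

text \<open>The blocks \<open>{t k..<t (Suc k)}\<close> carry copies of \<open>l\<^sub>\<infinity>\<close> of dimension \<open>p k\<close>, spanned by the
  restrictions of \<open>w\<close> to the sets \<open>S k j\<close>; the functionals biorthogonal to these vectors are
  bounded because of the last condition.\<close>

lemma linf_blocks_exist:
  fixes p :: "nat \<Rightarrow> nat"
  obtains t :: "nat \<Rightarrow> nat" and w :: "nat \<Rightarrow> real" and S :: "nat \<Rightarrow> nat \<Rightarrow> nat set"
  where "incseq t" "\<And>k. k \<le> t k" "t 0 = 0"
    and "\<forall>b x m. (\<forall>k. 0 \<le> b k) \<longrightarrow> (\<forall>k i. t k \<le> i \<longrightarrow> i < t (Suc k) \<longrightarrow> \<bar>x i\<bar> \<le> b k * w i) \<longrightarrow>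
        F (window 0 (t m) x) \<le> 23 * F (window 0 m b)"
    and "\<And>i. 0 \<le> w i"
    and "\<And>k j. j < p k \<Longrightarrow> S k j \<subseteq> {t k..<t (Suc k)}" "\<And>k j. j < p k \<Longrightarrow> S k j \<noteq> {}"
    and "\<And>k j j'. j < p k \<Longrightarrow> j' < p k \<Longrightarrow> j \<noteq> j' \<Longrightarrow> S k j \<inter> S k j' = {}"
    and "\<And>k j. j < p k \<Longrightarrow> schlumprecht_f (real (card (S k j))) \<le> 2 * (\<Sum>i\<in>S k j. w i)"
proof -
  obtain \<rho> N V v A where bs: "block_system F \<rho> N V v"
    and vec: "\<And>k. linf_vector (p k) (N k) (V k) (v k) (A k)"
    using block_system_exists[of p] by blast
  interpret block_system F \<rho> N V v by (rule bs)
  let ?S = "\<lambda>k j. copies (t k) (N k) (V k) (A k j)"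
  have A: "A k j \<subseteq> {..<V k}" "A k j \<noteq> {}" "schlumprecht_f (real (N k * card (A k j))) \<le> 2 * (\<Sum>i\<in>A k j. v k i)"
    if "j < p k" for k j
    using vec[of k] that unfolding linf_vector_def by blast+
  have disj: "A k j \<inter> A k j' = {}" if "j < p k" "j' < p k" "j \<noteq> j'" for k j j'
    using vec[of k] that unfolding linf_vector_def by blast
  show ?thesis
  proof (rule that[of t w ?S])
    show "incseq t" by (rule t_inc)
    show "k \<le> t k" for k by (rule t_ge)
    show "t 0 = 0" by simp
    show "0 \<le> w i" for i by (rule w_nonneg)
    show "\<forall>b x m. (\<forall>k. 0 \<le> b k) \<longrightarrow> (\<forall>k i. t k \<le> i \<longrightarrow> i < t (Suc k) \<longrightarrow> \<bar>x i\<bar> \<le> b k * w i) \<longrightarrow>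
        F (window 0 (t m) x) \<le> 23 * F (window 0 m b)"
    proof (intro allI impI)
      fix b :: "nat \<Rightarrow> real" and x m
      assume "\<forall>k. 0 \<le> b k" and x: "\<forall>k i. t k \<le> i \<longrightarrow> i < t (Suc k) \<longrightarrow> \<bar>x i\<bar> \<le> b k * w i"
      then have b: "0 \<le> b k" for k by simp
      have "F (window 0 (t m) x) \<le> F (window 0 (t m) (X b))"
        using x[rule_format, OF blk_bounds] X_nonneg[of b, OF b] b w_nonneg
        by (intro F_window_mono) (auto simp: X_def[of b, OF b] simp del: t.simps)
      also have "\<dots> \<le> 23 * F (window 0 m b)" by (rule blocks_dominated[OF b])
      finally show "F (window 0 (t m) x) \<le> 23 * F (window 0 m b)" .
    qed
  next
    fix k j assume j: "j < p k"
    show "?S k j \<subseteq> {t k..<t (Suc k)}" using copies_subset[OF A(1)[OF j]] by simp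
    show "?S k j \<noteq> {}" using A(2)[OF j] N_pos[of k] by (auto simp: copies_def)
    have "(\<Sum>i\<in>?S k j. w i) = real (N k) * (\<Sum>a\<in>A k j. v k a / real (N k))"
    proof (rule sum_copies[OF A(1)[OF j]])
      fix l a assume la: "l < N k" "a \<in> A k j"
      have "t k + (l * V k + a) \<in> ?S k j" using la by (auto simp: copies_def)
      then have "t k + (l * V k + a) < t (Suc k)"
        using copies_subset[OF A(1)[OF j], of "t k" "N k"] by auto
      then have "blk (t k + (l * V k + a)) = k" by (intro blk_eq) auto
      moreover have "a < V k" using la A(1)[OF j] by auto
      ultimately show "w (t k + (l * V k + a)) = v k a / real (N k)" by (simp add: w_def)
    qed
    also have "\<dots> = (\<Sum>a\<in>A k j. v k a)" using N_pos[of k] by (simp flip: sum_divide_distrib)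
    finally show "schlumprecht_f (real (card (?S k j))) \<le> 2 * (\<Sum>i\<in>?S k j. w i)"
      using A(3)[OF j] card_copies[OF A(1)[OF j]] by simp
    show "?S k j \<inter> ?S k j' = {}" if "j' < p k" "j \<noteq> j'" for j'
      by (intro copies_disjoint A disj j that)
  qed
qed

end

section \<open>Isomorphisms of normed spaces\<close>

text \<open>Triples of scalar multiplication, carrier and norm: the sums are proper subsets of a
  function type, with norms that are meaningful only on these subsets.\<close>

type_synonym ('k, 'a) lin_space = "('k \<Rightarrow> 'a \<Rightarrow> 'a) \<times> 'a set \<times> ('a \<Rightarrow> real)"

fun carrier_of :: "('k, 'a) lin_space \<Rightarrow> 'a set" where
  "carrier_of (s, V, n) = V"

fun nonneg_norm :: "('k, 'a) lin_space \<Rightarrow> bool" where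
  "nonneg_norm (s, V, n) \<longleftrightarrow> (\<forall>x\<in>V. 0 \<le> n x)"

fun bounded_linear_map ::
  "('k, 'a::ab_group_add) lin_space \<Rightarrow> ('k, 'b::ab_group_add) lin_space \<Rightarrow> ('a \<Rightarrow> 'b) \<Rightarrow> bool" where
  "bounded_linear_map (s1, V1, n1) (s2, V2, n2) T \<longleftrightarrow>
     (\<forall>x\<in>V1. T x \<in> V2) \<and> (\<forall>x\<in>V1. \<forall>y\<in>V1. T (x + y) = T x + T y) \<and>
     (\<forall>c. \<forall>x\<in>V1. T (s1 c x) = s2 c (T x)) \<and> (\<exists>C\<ge>0. \<forall>x\<in>V1. n2 (T x) \<le> C * n1 x)"

definition linear_iso :: "('k, 'a::ab_group_add) lin_space \<Rightarrow> ('k, 'b::ab_group_add) lin_space \<Rightarrow> bool" where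
  "linear_iso X Y \<longleftrightarrow> nonneg_norm X \<and> nonneg_norm Y \<and>
     (\<exists>T S. bounded_linear_map X Y T \<and> bounded_linear_map Y X S \<and>
        (\<forall>x\<in>carrier_of X. S (T x) = x) \<and> (\<forall>y\<in>carrier_of Y. T (S y) = y))"

fun prod_space :: "('k, 'a) lin_space \<Rightarrow> ('k, 'b) lin_space \<Rightarrow> ('k, 'a \<times> 'b) lin_space" where
  "prod_space (s1, V1, n1) (s2, V2, n2) =
     (\<lambda>c (x, y). (s1 c x, s2 c y), V1 \<times> V2, \<lambda>(x, y). n1 x + n2 y)"

lemma linear_isoI:
  assumes "nonneg_norm X" "nonneg_norm Y" "bounded_linear_map X Y T" "bounded_linear_map Y X S"
    "\<And>x. x \<in> carrier_of X \<Longrightarrow> S (T x) = x" "\<And>y. y \<in> carrier_of Y \<Longrightarrow> T (S y) = y"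
  shows "linear_iso X Y"
  using assms unfolding linear_iso_def by blast

lemma linear_isoE:
  assumes "linear_iso X Y"
  obtains T S where "bounded_linear_map X Y T" "bounded_linear_map Y X S"
    "\<And>x. x \<in> carrier_of X \<Longrightarrow> S (T x) = x" "\<And>y. y \<in> carrier_of Y \<Longrightarrow> T (S y) = y"
    "nonneg_norm X" "nonneg_norm Y"
  using assms unfolding linear_iso_def by blast

lemma bounded_linear_map_mem:
  "bounded_linear_map X Y T \<Longrightarrow> x \<in> carrier_of X \<Longrightarrow> T x \<in> carrier_of Y"
  by (cases X; cases Y) simp

lemma bounded_linear_map_comp:
  assumes "bounded_linear_map X Y T" "bounded_linear_map Y Z S"
  shows "bounded_linear_map X Z (S \<circ> T)"
proof -
  obtain s1 V1 n1 s2 V2 n2 s3 V3 n3 where e: "X = (s1, V1, n1)" "Y = (s2, V2, n2)" "Z = (s3, V3, n3)"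
    by (metis surj_pair)
  obtain C D where C: "0 \<le> C" "\<forall>x\<in>V1. n2 (T x) \<le> C * n1 x" and D: "0 \<le> D" "\<forall>x\<in>V2. n3 (S x) \<le> D * n2 x"
    using assms unfolding e by auto
  have "n3 (S (T x)) \<le> (D * C) * n1 x" if "x \<in> V1" for x
  proof -
    have "n3 (S (T x)) \<le> D * n2 (T x)" using that D assms(1) unfolding e by auto
    also have "\<dots> \<le> D * (C * n1 x)" using that C D by (intro mult_left_mono) auto
    finally show ?thesis by simp
  qed
  then have "\<exists>C\<ge>0. \<forall>x\<in>V1. n3 ((S \<circ> T) x) \<le> C * n1 x" using C D by (intro exI[of _ "D * C"]) auto
  then show ?thesis using assms unfolding e by simp
qed

lemma linear_iso_sym: "linear_iso X Y \<Longrightarrow> linear_iso Y X"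
  unfolding linear_iso_def by blast

lemma linear_iso_trans [trans]:
  assumes "linear_iso X Y" "linear_iso Y Z"
  shows "linear_iso X Z"
proof -
  obtain T S where T: "bounded_linear_map X Y T" "bounded_linear_map Y X S"
    "\<And>x. x \<in> carrier_of X \<Longrightarrow> S (T x) = x" "\<And>y. y \<in> carrier_of Y \<Longrightarrow> T (S y) = y" "nonneg_norm X" "nonneg_norm Y"
    using linear_isoE[OF assms(1)] by blast
  obtain T' S' where T': "bounded_linear_map Y Z T'" "bounded_linear_map Z Y S'"
    "\<And>x. x \<in> carrier_of Y \<Longrightarrow> S' (T' x) = x" "\<And>y. y \<in> carrier_of Z \<Longrightarrow> T' (S' y) = y" "nonneg_norm Y" "nonneg_norm Z"
    using linear_isoE[OF assms(2)] by blast
  show ?thesis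
    by (rule linear_isoI[of _ _ "T' \<circ> T" "S \<circ> S'"])
      (use T T' bounded_linear_map_mem[OF T(1)] bounded_linear_map_mem[OF T'(2)]
        in \<open>auto intro: bounded_linear_map_comp\<close>)
qed

lemma bounded_linear_map_prod:
  assumes "bounded_linear_map X X' T" "bounded_linear_map Y Y' S" "nonneg_norm X" "nonneg_norm Y"
  shows "bounded_linear_map (prod_space X Y) (prod_space X' Y') (map_prod T S)"
proof -
  obtain s1 V1 n1 s2 V2 n2 where e: "X = (s1, V1, n1)" "Y = (s2, V2, n2)" by (metis surj_pair)
  obtain s1' V1' n1' s2' V2' n2' where e': "X' = (s1', V1', n1')" "Y' = (s2', V2', n2')" by (metis surj_pair)
  obtain C D where C: "0 \<le> C" "\<And>x. x \<in> V1 \<Longrightarrow> n1' (T x) \<le> C * n1 x"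
    and D: "0 \<le> D" "\<And>x. x \<in> V2 \<Longrightarrow> n2' (S x) \<le> D * n2 x"
    using assms(1,2) unfolding e e' by auto
  have "n1' (T x) + n2' (S y) \<le> (C + D) * (n1 x + n2 y)" if "x \<in> V1" "y \<in> V2" for x y
  proof -
    have "0 \<le> D * n1 x" "0 \<le> C * n2 y" using that C(1) D(1) assms(3,4) unfolding e by auto
    then show ?thesis using C(2)[OF that(1)] D(2)[OF that(2)] by (simp add: algebra_simps)
  qed
  then have "\<exists>C\<ge>0. \<forall>x\<in>V1 \<times> V2. (\<lambda>(x, y). n1' x + n2' y) (map_prod T S x) \<le> C * (\<lambda>(x, y). n1 x + n2 y) x"
    using C(1) D(1) by (intro exI[of _ "C + D"]) auto
  then show ?thesis using assms(1,2) unfolding e e' by (auto simp: plus_prod_def)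
qed

lemma nonneg_norm_prod: "nonneg_norm X \<Longrightarrow> nonneg_norm Y \<Longrightarrow> nonneg_norm (prod_space X Y)"
  by (cases X; cases Y) auto

lemma carrier_of_prod: "carrier_of (prod_space X Y) = carrier_of X \<times> carrier_of Y"
  by (cases X; cases Y) simp

lemma linear_iso_prod:
  assumes "linear_iso X X'" "linear_iso Y Y'"
  shows "linear_iso (prod_space X Y) (prod_space X' Y')"
proof -
  obtain T S where T: "bounded_linear_map X X' T" "bounded_linear_map X' X S"
    "\<And>x. x \<in> carrier_of X \<Longrightarrow> S (T x) = x" "\<And>y. y \<in> carrier_of X' \<Longrightarrow> T (S y) = y"
    "nonneg_norm X" "nonneg_norm X'"
    using linear_isoE[OF assms(1)] by blast
  obtain T' S' where T': "bounded_linear_map Y Y' T'" "bounded_linear_map Y' Y S'"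
    "\<And>x. x \<in> carrier_of Y \<Longrightarrow> S' (T' x) = x" "\<And>y. y \<in> carrier_of Y' \<Longrightarrow> T' (S' y) = y"
    "nonneg_norm Y" "nonneg_norm Y'"
    using linear_isoE[OF assms(2)] by blast
  show ?thesis
    by (rule linear_isoI[of _ _ "map_prod T T'" "map_prod S S'"])
      (use T T' in \<open>auto intro!: bounded_linear_map_prod nonneg_norm_prod simp: carrier_of_prod\<close>)
qed

lemma bounded_linear_map_id: "bounded_linear_map X X (\<lambda>x. x)"
  by (cases X) (auto intro!: exI[of _ "1::real"])

lemma linear_iso_refl: "nonneg_norm X \<Longrightarrow> linear_iso X X"
  by (rule linear_isoI) (auto intro: bounded_linear_map_id)

lemma bounded_linear_map_swap: "bounded_linear_map (prod_space X Y) (prod_space Y X) prod.swap"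
  by (cases X; cases Y) (auto intro!: exI[of _ "1::real"])

lemma linear_iso_commute:
  assumes "nonneg_norm X" "nonneg_norm Y"
  shows "linear_iso (prod_space X Y) (prod_space Y X)"
  by (rule linear_isoI[OF _ _ bounded_linear_map_swap bounded_linear_map_swap])
    (use assms in \<open>auto intro: nonneg_norm_prod\<close>)

lemma linear_iso_assoc:
  assumes "nonneg_norm X" "nonneg_norm Y" "nonneg_norm Z"
  shows "linear_iso (prod_space (prod_space X Y) Z) (prod_space X (prod_space Y Z))"
proof (rule linear_isoI[of _ _ "\<lambda>((x, y), z). (x, y, z)" "\<lambda>(x, y, z). ((x, y), z)"])
  show "bounded_linear_map (prod_space (prod_space X Y) Z) (prod_space X (prod_space Y Z)) (\<lambda>((x, y), z). (x, y, z))"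
    by (cases X; cases Y; cases Z) (auto intro!: exI[of _ "1::real"])
  show "bounded_linear_map (prod_space X (prod_space Y Z)) (prod_space (prod_space X Y) Z) (\<lambda>(x, y, z). ((x, y), z))"
    by (cases X; cases Y; cases Z) (auto intro!: exI[of _ "1::real"])
qed (use assms in \<open>auto intro!: nonneg_norm_prod\<close>)

text \<open>\<open>T \<circ> Q\<close> is a projection onto the range of \<open>T\<close>; a vector
  splits into the coordinate \<open>Q x\<close> and the remainder \<open>x - T (Q x)\<close> in the
  kernel of \<open>Q\<close>.\<close>

lemma linear_iso_complement:
  fixes s1 :: "'k \<Rightarrow> 'a::real_normed_vector \<Rightarrow> 'a"
  assumes T: "bounded_linear_map Y (s1, UNIV, norm) T" and Q: "bounded_linear_map (s1, UNIV, norm) Y Q"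
    and QT: "\<And>y. y \<in> carrier_of Y \<Longrightarrow> Q (T y) = y" and Y: "nonneg_norm Y"
    and s1: "\<And>c x y. s1 c (x - y) = s1 c x - s1 c y"
  shows "linear_iso (s1, UNIV, norm) (prod_space Y (s1, {x. Q x = 0}, norm))"
proof -
  obtain s2 V2 n2 where e: "Y = (s2, V2, n2)" by (metis surj_pair)
  have Q_mem: "Q x \<in> V2" for x using Q unfolding e by simp
  have Q_add: "Q (x + y) = Q x + Q y" for x y using Q unfolding e by simp
  have Q_diff: "Q (x - y) = Q x - Q y" for x y using Q_add[of "x - y" y] by simp
  have Q_s: "Q (s1 c x) = s2 c (Q x)" for c x using Q unfolding e by simp
  have T_add: "T (x + y) = T x + T y" if "x \<in> V2" "y \<in> V2" for x y using T that unfolding e by simp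
  have T_s: "T (s2 c x) = s1 c (T x)" if "x \<in> V2" for c x using T that unfolding e by simp
  obtain C where C: "0 \<le> C" "\<And>y. y \<in> V2 \<Longrightarrow> norm (T y) \<le> C * n2 y" using T unfolding e by auto
  obtain D where D: "0 \<le> D" "\<And>x. n2 (Q x) \<le> D * norm x" using Q unfolding e by auto
  let ?Z = "{x. Q x = 0}"
  let ?P = "\<lambda>x. (Q x, x - T (Q x))" and ?R = "\<lambda>(y, z). T y + z"
  have s1_add: "s1 c (x + y) = s1 c x + s1 c y" for c x y
  proof -
    have "s1 c (x - (0 - y)) = s1 c x - (s1 c 0 - s1 c y)" by (simp only: s1)
    moreover have "s1 c 0 = 0" using s1[of c 0 0] by simp
    ultimately show ?thesis by simp
  qed
  show ?thesis
  proof (rule linear_isoI[of _ _ ?P ?R])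
    have "n2 (Q x) + norm (x - T (Q x)) \<le> (D + 1 + C * D) * norm x" for x
    proof -
      have "norm (x - T (Q x)) \<le> norm x + norm (T (Q x))" by (rule norm_triangle_ineq4)
      moreover have "norm (T (Q x)) \<le> C * n2 (Q x)" by (rule C(2)[OF Q_mem])
      moreover have "C * n2 (Q x) \<le> C * (D * norm x)" using C(1) D(2) by (intro mult_left_mono)
      ultimately show ?thesis using D(2)[of x] by (simp add: algebra_simps)
    qed
    then have "\<exists>C\<ge>0. \<forall>x. n2 (Q x) + norm (x - T (Q x)) \<le> C * norm x"
      using C(1) D(1) by (intro exI[of _ "D + 1 + C * D"]) auto
    then show "bounded_linear_map (s1, UNIV, norm) (prod_space Y (s1, ?Z, norm)) ?P"
      unfolding e by (auto simp: Q_mem Q_add Q_diff Q_s T_add T_s s1 QT e)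
    have "norm (T y + z) \<le> (C + 1) * (n2 y + norm z)" if "y \<in> V2" for y z
    proof -
      have "norm (T y + z) \<le> norm (T y) + norm z" by (rule norm_triangle_ineq)
      moreover have "norm (T y) \<le> C * n2 y" by (rule C(2)[OF that])
      moreover have "0 \<le> n2 y" "0 \<le> C * norm z" using Y that C(1) unfolding e by auto
      ultimately show ?thesis by (simp add: algebra_simps)
    qed
    then have "\<exists>C\<ge>0. \<forall>y\<in>V2. \<forall>z. Q z = 0 \<longrightarrow> norm (T y + z) \<le> C * (n2 y + norm z)"
      using C(1) by (intro exI[of _ "C + 1"]) auto
    then show "bounded_linear_map (prod_space Y (s1, ?Z, norm)) (s1, UNIV, norm) ?R"
      unfolding e by (auto simp: T_add T_s s1_add)
    show "?P (?R y) = y" if "y \<in> carrier_of (prod_space Y (s1, ?Z, norm))" for y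
      using that by (auto simp: carrier_of_prod Q_add QT)
  qed (use Y in \<open>auto intro: nonneg_norm_prod\<close>)
qed

text \<open>The norms may differ off the carrier, because \<open>direct_sum_norm\<close> is the norm
  of a series that need not converge there.\<close>

lemma linear_iso_imp_isomorphic_spaces:
  assumes "linear_iso (s1, V1, n1) (s2, V2, n2)" "\<And>y. y \<in> V2 \<Longrightarrow> n2' y = n2 y"
  shows "isomorphic_spaces s1 V1 n1 s2 V2 n2'"
proof -
  obtain T S where T: "bounded_linear_map (s1, V1, n1) (s2, V2, n2) T"
    "bounded_linear_map (s2, V2, n2) (s1, V1, n1) S"
    "\<And>x. x \<in> V1 \<Longrightarrow> S (T x) = x" "\<And>y. y \<in> V2 \<Longrightarrow> T (S y) = y"
    using linear_isoE[OF assms(1)] by (metis carrier_of.simps)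
  have bij: "bij_betw T V1 V2"
    by (rule bij_betw_byWitness[of _ S]) (use T in auto)
  have inv: "inv_into V1 T y = S y" if "y \<in> V2" for y
    using that T bij by (intro inv_into_f_eq) (auto simp: bij_betw_def)
  show ?thesis unfolding isomorphic_spaces_def
  proof (intro exI[of _ T] conjI)
    show "\<exists>C. \<forall>x\<in>V1. n2' (T x) \<le> C * n1 x" using T(1) assms(2) by auto
    show "\<exists>C. \<forall>y\<in>V2. n1 (inv_into V1 T y) \<le> C * n2' y" using T(2) assms(2) inv by auto
  qed (use bij T(1) in auto)
qed

section \<open>The unit vector basis\<close>

lemma norm_window: "norm (window a c y i) = window a c (\<lambda>k. norm (y k)) i"
  by (simp add: window_def)

lemma norm_c00: "x \<in> c00 \<Longrightarrow> (\<lambda>i. norm (x i)) \<in> c00"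
  by (simp add: c00_def)

section \<open>Reduction to real sequences\<close>

context schlumprecht_space
begin

text \<open>By comparison of the two norms, the norm of \<open>J x\<close> depends only on the
  absolute values of the coordinates (\<open>norm_J_eq_F\<close>), so the estimates over the reals
  serve every scalar field.\<close>

definition F :: "(nat \<Rightarrow> real) \<Rightarrow> real" where
  "F a = norm (J (\<lambda>i. of_real (a i)))"

lemma of_real_c00: "x \<in> c00 \<Longrightarrow> (\<lambda>i. of_real (x i) :: 'k) \<in> c00"
  by (simp add: c00_def)

sublocale J: schlumprecht_norm "\<lambda>x. norm (J x)"
proof
  show "schlumprecht_equation (\<lambda>x. norm (J x))" by (rule norm_J)
  show "norm (J (x + y)) \<le> norm (J x) + norm (J y)" if "x \<in> c00" "y \<in> c00" for x y
    using that by (simp add: J_add norm_triangle_ineq)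
  show "norm (J (\<lambda>i. c * x i)) = norm c * norm (J x)" if "x \<in> c00" for c x
    using that by (simp add: J_scale norm_scale)
qed

sublocale schlumprecht_real_norm F
proof
  show "schlumprecht_equation F"
    unfolding schlumprecht_equation_def
  proof
    fix x :: "nat \<Rightarrow> real" assume x: "x \<in> c00"
    have "coord_proj E (\<lambda>i. of_real (x i) :: 'k) = (\<lambda>i. of_real (coord_proj E x i))" for E
      by (auto simp: coord_proj_def fun_eq_iff)
    then show "F x = max (SUP i. norm (x i)) (Sup {(\<Sum>i=1..r. F (coord_proj (E i) x)) / schlumprecht_f (real r) |r E.
         2 \<le> r \<and> (\<forall>i\<in>{1..r}. finite (E i)) \<and> (\<forall>i\<in>{1..r}. \<forall>j\<in>{1..r}. i < j \<longrightarrow> set_before (E i) (E j))})"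
      using norm_J[unfolded schlumprecht_equation_def, rule_format, OF of_real_c00[OF x]]
      by (simp add: F_def)
  qed
  show "F (x + y) \<le> F x + F y" if "x \<in> c00" "y \<in> c00" for x y
  proof -
    have "(\<lambda>i. of_real ((x + y) i) :: 'k) = (\<lambda>i. of_real (x i)) + (\<lambda>i. of_real (y i))"
      by (simp add: fun_eq_iff)
    then show ?thesis unfolding F_def using J.triangle[OF of_real_c00[OF that(1)] of_real_c00[OF that(2)]] by simp
  qed
  show "F (\<lambda>i. c * x i) = norm c * F x" if "x \<in> c00" for c x
    unfolding F_def using J.homogeneous[OF of_real_c00[OF that], of "of_real c"] by simp
qed

lemma norm_J_eq_F:
  assumes "x \<in> c00" shows "norm (J x) = F (\<lambda>i. norm (x i))"
proof (rule antisym)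
  note loc = J.schlumprecht_norm_axioms schlumprecht_norm_axioms
  show "norm (J x) \<le> F (\<lambda>i. norm (x i))"
    by (rule schlumprecht_norm_compare[OF loc assms norm_c00[OF assms]]) simp
  show "F (\<lambda>i. norm (x i)) \<le> norm (J x)"
    by (rule schlumprecht_norm_compare[OF loc(2,1) norm_c00[OF assms] assms]) simp
qed

lemma norm_J_window: "norm (J (window a c y)) = F (window a c (\<lambda>k. norm (y k)))"
  by (subst norm_J_eq_F) (simp_all add: norm_window)

text \<open>By bounded completeness this characterizes the series that converge in S, and
  \<open>F_sup\<close> is then the norm of the sum. Convergence thereby becomes a condition on
  finite windows.\<close>

definition F_bounded :: "(nat \<Rightarrow> real) \<Rightarrow> bool" where
  "F_bounded a \<longleftrightarrow> bdd_above (range (\<lambda>n. F (window 0 n a)))"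

definition F_sup :: "(nat \<Rightarrow> real) \<Rightarrow> real" where
  "F_sup a = (SUP n. F (window 0 n a))"

lemma F_sup_upper: "F_bounded a \<Longrightarrow> F (window 0 n a) \<le> F_sup a"
  unfolding F_sup_def F_bounded_def by (rule cSUP_upper) auto

lemma F_sup_least: "(\<And>n. F (window 0 n a) \<le> B) \<Longrightarrow> F_sup a \<le> B"
  unfolding F_sup_def by (rule cSUP_least) auto

lemma F_boundedI: "(\<And>n. F (window 0 n a) \<le> B) \<Longrightarrow> F_bounded a"
  unfolding F_bounded_def by (rule bdd_aboveI) auto

lemma F_sup_nonneg: "F_bounded a \<Longrightarrow> 0 \<le> F_sup a"
  using F_sup_upper[of a 0] F_window_nonneg[of 0 0 a] by linarith

lemma F_sup_dominated:
  assumes "F_bounded b" "0 \<le> C" and *: "\<And>n. \<exists>l. F (window 0 n a) \<le> C * F (window 0 l b)"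
  shows "F_bounded a" "F_sup a \<le> C * F_sup b"
proof -
  have "F (window 0 n a) \<le> C * F_sup b" for n
  proof -
    obtain l where "F (window 0 n a) \<le> C * F (window 0 l b)" using * by blast
    also have "\<dots> \<le> C * F_sup b" using assms F_sup_upper by (intro mult_left_mono) auto
    finally show ?thesis .
  qed
  then show "F_bounded a" "F_sup a \<le> C * F_sup b" by (auto intro: F_boundedI F_sup_least)
qed

lemma F_sup_dominated_sum:
  assumes "F_bounded b" "F_bounded b'"
    and *: "\<And>n. \<exists>l l'. F (window 0 n a) \<le> F (window 0 l b) + F (window 0 l' b')"
  shows "F_bounded a" "F_sup a \<le> F_sup b + F_sup b'"
proof -
  have "F (window 0 n a) \<le> F_sup b + F_sup b'" for n
  proof -
    obtain l l' where "F (window 0 n a) \<le> F (window 0 l b) + F (window 0 l' b')" using * by blast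
    also have "\<dots> \<le> F_sup b + F_sup b'" using assms F_sup_upper by (intro add_mono) auto
    finally show ?thesis .
  qed
  then show "F_bounded a" "F_sup a \<le> F_sup b + F_sup b'" by (auto intro: F_boundedI F_sup_least)
qed

lemma F_window_add:
  assumes "\<And>k. \<bar>c k\<bar> \<le> \<bar>a k + b k\<bar>"
  shows "F (window 0 n c) \<le> F (window 0 n a) + F (window 0 n b)"
proof -
  have "window 0 n (\<lambda>k. a k + b k) = window 0 n a + window 0 n b"
    by (auto simp: window_def fun_eq_iff)
  then have "F (window 0 n (\<lambda>k. a k + b k)) \<le> F (window 0 n a) + F (window 0 n b)"
    using triangle[OF window_c00 window_c00, of 0 n a 0 n b] by simp
  moreover have "F (window 0 n c) \<le> F (window 0 n (\<lambda>k. a k + b k))"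
    using assms by (intro F_window_mono) auto
  ultimately show ?thesis by linarith
qed

section \<open>Coordinates of the vectors of S\<close>

definition represents :: "(nat \<Rightarrow> 'k) \<Rightarrow> 's \<Rightarrow> bool" where
  "represents y x \<longleftrightarrow> (\<lambda>n. J (window 0 n y)) \<longlonglongrightarrow> x"

lemma J_diff: "m \<le> n \<Longrightarrow> J (window 0 n y) = J (window 0 m y) + J (window m n y)"
proof -
  assume "m \<le> n"
  then have "window 0 n y = window 0 m y + window m n y" by (auto simp: window_def fun_eq_iff)
  then show ?thesis by (simp add: J_add)
qed

text \<open>Bounded completeness makes the tails uniformly small, so the partial sums are
  Cauchy.\<close>

lemma represents_ex:
  assumes "F_bounded (\<lambda>k. norm (y k))"
  shows "\<exists>x. represents y x"
proof -
  have "Cauchy (\<lambda>n. J (window 0 n y))"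
  proof (rule CauchyI')
    fix e :: real assume e: "0 < e"
    obtain M where M: "\<And>n. F (window M n (\<lambda>k. norm (y k))) \<le> e / 4"
      using boundedly_complete[of "\<lambda>k. norm (y k)", OF F_sup_upper[OF assms], of "e / 4"] e by auto
    have near: "norm (J (window 0 n y) - J (window 0 M y)) \<le> e / 4" if "M \<le> n" for n
      using that M[of n] by (simp add: J_diff norm_J_window)
    have "dist (J (window 0 m y)) (J (window 0 n y)) < e" if "M \<le> m" "m < n" for m n
    proof -
      have "dist (J (window 0 m y)) (J (window 0 n y)) \<le> e / 4 + e / 4"
        using near[of m] near[of n] that unfolding dist_norm[symmetric]
        by (intro dist_triangle_le[of _ "J (window 0 M y)"]) (simp add: dist_commute)
      then show ?thesis using e by linarith
    qed
    then show "\<exists>M. \<forall>m\<ge>M. \<forall>n>m. dist (J (window 0 m y)) (J (window 0 n y)) < e" by blast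
  qed
  then show ?thesis unfolding represents_def by (metis Cauchy_convergent_iff convergent_def)
qed

lemma represents_norm:
  assumes "represents y x"
  shows "F_bounded (\<lambda>k. norm (y k))" "norm x = F_sup (\<lambda>k. norm (y k))"
proof -
  let ?a = "\<lambda>k. norm (y k)"
  have lim: "(\<lambda>n. F (window 0 n ?a)) \<longlonglongrightarrow> norm x"
    using tendsto_norm[OF assms[unfolded represents_def]] by (simp add: norm_J_window)
  have inc: "incseq (\<lambda>n. F (window 0 n ?a))"
    unfolding incseq_def by (intro allI impI F_window_mono) auto
  have le: "F (window 0 n ?a) \<le> norm x" for n by (rule incseq_le[OF inc lim])
  then show b: "F_bounded ?a" by (rule F_boundedI)
  have "norm x \<le> F_sup ?a" by (rule LIMSEQ_le_const2[OF lim]) (use F_sup_upper[OF b] in auto)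
  then show "norm x = F_sup ?a" using F_sup_least[of ?a, OF le] by simp
qed

lemma represents_unique: "represents y x \<Longrightarrow> represents y x' \<Longrightarrow> x = x'"
  unfolding represents_def by (rule LIMSEQ_unique)

lemma represents_add:
  assumes "represents y x" "represents y' x'"
  shows "represents (\<lambda>k. y k + y' k) (x + x')"
proof -
  have "window 0 n (\<lambda>k. y k + y' k) = window 0 n y + window 0 n y'" for n
    by (auto simp: window_def fun_eq_iff)
  then show ?thesis using tendsto_add[OF assms[unfolded represents_def]]
    by (simp add: represents_def J_add)
qed

lemma represents_scale:
  assumes "represents y x"
  shows "represents (\<lambda>k. c * y k) (scale c x)"
proof -
  have e: "norm (J (window 0 n (\<lambda>k. c * y k)) - scale c x) = norm c * norm (J (window 0 n y) - x)" for n
  proof -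
    have "window 0 n (\<lambda>k. c * y k) = (\<lambda>k. c * window 0 n y k)"
      by (auto simp: window_def fun_eq_iff)
    then have "J (window 0 n (\<lambda>k. c * y k)) = scale c (J (window 0 n y))"
      using J_scale[OF window_c00, of c 0 n y] by (rule trans[OF arg_cong[of _ _ J]])
    then show ?thesis using norm_scale[of c "J (window 0 n y) - x"]
      by (simp only: scale_right_diff_distrib)
  qed
  have "(\<lambda>n. norm c * norm (J (window 0 n y) - x)) \<longlonglongrightarrow> norm c * 0"
    by (rule tendsto_mult_left[OF tendsto_norm_zero[OF LIM_zero[OF assms[unfolded represents_def]]]])
  then have "(\<lambda>n. norm (J (window 0 n (\<lambda>k. c * y k)) - scale c x)) \<longlonglongrightarrow> 0"
    unfolding e by (simp only: mult_zero_right)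
  then show ?thesis unfolding represents_def by (rule LIM_zero_cancel[OF tendsto_norm_zero_cancel])
qed

lemma represents_inj:
  assumes "represents y x" "represents y' x"
  shows "y = y'"
proof
  fix k
  have "represents (\<lambda>k. y k + (- 1) * y' k) (x + scale (- 1) x)"
    by (intro represents_add represents_scale assms)
  then have *: "represents (\<lambda>k. y k - y' k) 0" by simp
  have "norm (y k - y' k) \<le> F (window 0 (Suc k) (\<lambda>k. norm (y k - y' k)))"
    using norm_le_F_window[of 0 k "Suc k" "\<lambda>k. norm (y k - y' k)"] by simp
  also have "\<dots> \<le> F_sup (\<lambda>k. norm (y k - y' k))" by (rule F_sup_upper[OF represents_norm(1)[OF *]])
  also have "\<dots> = 0" using represents_norm(2)[OF *] by simp
  finally show "y k = y' k" by simp
qed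

lemma J_diff_scale: "x \<in> c00 \<Longrightarrow> y \<in> c00 \<Longrightarrow> J (\<lambda>i. x i - y i) = J x - J y"
proof -
  assume x: "x \<in> c00" and y: "y \<in> c00"
  have "(\<lambda>i. x i - y i) = x + (\<lambda>i. (- 1) * y i)" by (auto simp: fun_eq_iff)
  then show ?thesis using J_add[OF x scale_c00[OF y, of "- 1"]] J_scale[OF y, of "- 1"] by simp
qed

lemma window_eq_c00:
  assumes "x \<in> c00" shows "\<exists>m. \<forall>n\<ge>m. window 0 n x = x"
proof -
  obtain m where "\<forall>i. x i \<noteq> 0 \<longrightarrow> i < m"
    using assms finite_nat_set_iff_bounded[of "{i. x i \<noteq> 0}"] by (auto simp: c00_def)
  then show ?thesis by (intro exI[of _ m]) (force simp: window_def fun_eq_iff)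
qed

lemma J_window_tendsto:
  assumes "\<And>i. (\<lambda>j. z j i) \<longlonglongrightarrow> y i"
  shows "(\<lambda>j. norm (J (window 0 n (\<lambda>i. y i - z j i)))) \<longlonglongrightarrow> 0"
proof (rule tendsto_sandwich[of "\<lambda>_. 0"])
  show "\<forall>\<^sub>F j in sequentially. norm (J (window 0 n (\<lambda>i. y i - z j i))) \<le> (\<Sum>i\<in>{0..<n}. norm (y i - z j i))"
    using J.F_window_le_sum by simp
  have "(\<lambda>j. \<Sum>i\<in>{0..<n}. norm (y i - z j i)) \<longlonglongrightarrow> (\<Sum>i\<in>{0..<n}. norm (y i - y i))"
    by (intro tendsto_intros assms)
  then show "(\<lambda>j. \<Sum>i\<in>{0..<n}. norm (y i - z j i)) \<longlonglongrightarrow> 0" by simp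
qed auto

text \<open>Each coordinate is dominated by the norm, so the coordinates of approximating vectors
  from \<open>c00\<close> converge; their limits are the coordinates of \<open>x\<close>.\<close>

lemma represents_surj: "\<exists>y. represents y x"
proof -
  have "x \<in> closure (J ` c00)" using J_dense by simp
  then obtain u where u: "\<And>j. u j \<in> J ` c00" "u \<longlonglongrightarrow> x"
    unfolding closure_sequential by blast
  have "\<forall>j. \<exists>z\<in>c00. u j = J z" using u(1) by blast
  then obtain z where "\<forall>j. z j \<in> c00 \<and> u j = J (z j)" unfolding Bex_def by (rule choice[THEN exE])
  then have z: "\<And>j. z j \<in> c00" "\<And>j. u j = J (z j)" by blast+
  have u_eq: "u = (\<lambda>j. J (z j))" using z(2) by (rule ext)
  have lim: "(\<lambda>j. J (z j)) \<longlonglongrightarrow> x" using u(2) unfolding u_eq .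
  have diff: "norm (J (z j) - J (z l)) = norm (J (\<lambda>i. z j i - z l i))" for j l
    by (simp add: J_diff_scale z)
  have diff_c00: "(\<lambda>i. z j i - z l i) \<in> c00" for j l
  proof -
    have "{i. z j i - z l i \<noteq> 0} \<subseteq> {i. z j i \<noteq> 0} \<union> {i. z l i \<noteq> 0}" by auto
    then show ?thesis using z(1)[of j] z(1)[of l] unfolding c00_def
      by (auto intro: finite_subset[of _ "{i. z j i \<noteq> 0} \<union> {i. z l i \<noteq> 0}"])
  qed
  have "Cauchy (\<lambda>j. z j i)" for i
  proof (rule CauchyI')
    fix e :: real assume "0 < e"
    then obtain M where M: "\<And>m n. m \<ge> M \<Longrightarrow> n \<ge> M \<Longrightarrow> dist (J (z m)) (J (z n)) < e"
      using LIMSEQ_imp_Cauchy[OF lim] unfolding Cauchy_def by meson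
    have "dist (z m i) (z n i) \<le> dist (J (z m)) (J (z n))" for m n
      using J.norm_le_F[OF diff_c00[of m n], of i] by (simp add: dist_norm diff)
    then show "\<exists>M. \<forall>m\<ge>M. \<forall>n>m. dist (z m i) (z n i) < e"
      using M by (intro exI[of _ M] allI impI) (rule le_less_trans, assumption, simp)
  qed
  then have "\<exists>l. (\<lambda>j. z j i) \<longlonglongrightarrow> l" for i
    by (simp only: Cauchy_convergent_iff convergent_def)
  then obtain y where y: "\<And>i. (\<lambda>j. z j i) \<longlonglongrightarrow> y i" by metis
  have key0: "norm (J (window 0 n (\<lambda>i. y i - z l i))) \<le>
      norm (J (window 0 n (\<lambda>i. y i - z j i))) + norm (J (z j) - J (z l))" for n j l
  proof -
    have "window 0 n (\<lambda>i. y i - z l i) = window 0 n (\<lambda>i. y i - z j i) + window 0 n (\<lambda>i. z j i - z l i)"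
      by (auto simp: window_def fun_eq_iff)
    then have "norm (J (window 0 n (\<lambda>i. y i - z l i))) \<le>
        norm (J (window 0 n (\<lambda>i. y i - z j i))) + norm (J (window 0 n (\<lambda>i. z j i - z l i)))"
      using J.triangle[OF window_c00 window_c00] by simp
    also have "norm (J (window 0 n (\<lambda>i. z j i - z l i))) \<le> norm (J (z j) - J (z l))"
      unfolding diff by (rule J.F_mono[OF window_c00 diff_c00]) (simp add: window_def)
    finally show ?thesis by simp
  qed
  \<comment> \<open>Letting \<open>j\<close> tend to infinity in \<open>key0\<close> removes the
    first term and leaves an estimate uniform in the length of the window.\<close>
  have key: "norm (J (window 0 n (\<lambda>i. y i - z l i))) \<le> norm (x - J (z l))" for n l
  proof -
    have "(\<lambda>j. norm (J (window 0 n (\<lambda>i. y i - z j i))) + norm (J (z j) - J (z l))) \<longlonglongrightarrow> 0 + norm (x - J (z l))"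
      by (intro tendsto_add J_window_tendsto y tendsto_norm tendsto_diff lim tendsto_const)
    then have "norm (J (window 0 n (\<lambda>i. y i - z l i))) \<le> 0 + norm (x - J (z l))"
      by (rule LIMSEQ_le_const) (use key0 in blast)
    then show ?thesis by simp
  qed
  have "represents y x" unfolding represents_def
  proof (rule LIMSEQ_I)
    fix e :: real assume e: "0 < e"
    then obtain l where l: "norm (J (z l) - x) < e / 2" using LIMSEQ_D[OF lim, of "e/2"] by auto
    obtain m where m: "\<And>n. n \<ge> m \<Longrightarrow> window 0 n (z l) = z l" using window_eq_c00[OF z(1)] by blast
    have "norm (J (window 0 n y) - x) < e" if "m \<le> n" for n
    proof -
      have "(\<lambda>i. window 0 n y i - window 0 n (z l) i) = window 0 n (\<lambda>i. y i - z l i)"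
        by (auto simp: window_def fun_eq_iff)
      then have "J (window 0 n y) - J (z l) = J (window 0 n (\<lambda>i. y i - z l i))"
        using J_diff_scale[OF window_c00 window_c00, of 0 n y 0 n "z l"] m[OF that] by simp
      then have "norm (J (window 0 n y) - J (z l)) < e / 2"
        using key[of n l] l by (simp add: norm_minus_commute)
      then show ?thesis using l norm_triangle_ineq[of "J (window 0 n y) - J (z l)" "J (z l) - x"] by simp
    qed
    then show "\<exists>m. \<forall>n\<ge>m. norm (J (window 0 n y) - x) < e" by blast
  qed
  then show ?thesis by blast
qed

end

section \<open>Sums over the Schlumprecht space\<close>

lemma bounded_linear_map_bound:
  assumes "bounded_linear_map (s1, V1, n1) (s2, V2, n2) T"
  obtains C where "0 \<le> C" "\<And>x. x \<in> V1 \<Longrightarrow> n2 (T x) \<le> C * n1 x"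
  using assms by auto

context schlumprecht_space
begin

text \<open>Inserting 0 gives the right value for a block of dimension 0 as well, and such a block
  occurs because the partial sums \<open>p\<close> of the dimensions start with 0.\<close>

definition block_max :: "(nat \<Rightarrow> nat) \<Rightarrow> (nat \<Rightarrow> nat \<Rightarrow> 'k) \<Rightarrow> nat \<Rightarrow> real" where
  "block_max m y k = Max (insert 0 ((\<lambda>i. norm (y k i)) ` {..<m k}))"

lemma block_max_ge: "i < m k \<Longrightarrow> norm (y k i) \<le> block_max m y k"
  unfolding block_max_def by (intro Max_ge) auto

lemma block_max_nonneg: "0 \<le> block_max m y k"
  unfolding block_max_def by (intro Max_ge) auto

lemma block_max_le: "0 \<le> B \<Longrightarrow> (\<And>i. i < m k \<Longrightarrow> norm (y k i) \<le> B) \<Longrightarrow> block_max m y k \<le> B"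
  unfolding block_max_def by (intro Max.boundedI) auto

lemma block_max_1:
  "block_max (\<lambda>_. 1) y k = norm (y k 0)" "block_max (\<lambda>_. Suc 0) y k = norm (y k 0)"
  by (simp_all add: block_max_def lessThan_Suc max_def)

lemma block_max_linf_norm: "0 < m k \<Longrightarrow> block_max m y k = linf_norm (m k) (y k)"
proof -
  assume m: "0 < m k"
  have "norm (y k 0) \<le> Max ((\<lambda>i. norm (y k i)) ` {..<m k})" using m by (intro Max_ge) auto
  then have "0 \<le> Max ((\<lambda>i. norm (y k i)) ` {..<m k})" using norm_ge_zero order_trans by blast
  moreover have "(\<lambda>i. norm (y k i)) ` {..<m k} \<noteq> {}" using m by auto
  ultimately show ?thesis by (simp add: block_max_def linf_norm_def max_def)
qed

text \<open>The sum over S with convergence replaced by boundedness, for arbitrary dimensions.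
  \<open>direct_sum_eq\<close> identifies it with \<open>direct_sum\<close> when all dimensions are
  positive.\<close>

definition linf_sum :: "(nat \<Rightarrow> nat) \<Rightarrow> ('k, nat \<Rightarrow> nat \<Rightarrow> 'k) lin_space" where
  "linf_sum m = (\<lambda>c y k i. c * y k i, {y. (\<forall>k. y k \<in> linf (m k)) \<and> F_bounded (block_max m y)},
     \<lambda>y. F_sup (block_max m y))"

abbreviation S_space :: "('k, 's) lin_space" where
  "S_space \<equiv> (scale, UNIV, norm)"

lemma nonneg_linf_sum: "nonneg_norm (linf_sum m)"
  by (simp add: linf_sum_def F_sup_nonneg)

text \<open>The estimate is asked on finite windows, and the window on the right may be a longer
  one; taking suprema gives both membership and the norm bound.\<close>

lemma linf_sum_map:
  assumes "\<And>x y. T (x + y) = T x + T y" "\<And>c y. T (\<lambda>k i. c * y k i) = (\<lambda>k i. c * T y k i)"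
    and "\<And>y k. (\<And>k. y k \<in> linf (m k)) \<Longrightarrow> T y k \<in> linf (m' k)" and C: "0 \<le> C"
    and *: "\<And>y n. (\<And>k. y k \<in> linf (m k)) \<Longrightarrow>
      \<exists>l. F (window 0 n (block_max m' (T y))) \<le> C * F (window 0 l (block_max m y))"
  shows "bounded_linear_map (linf_sum m) (linf_sum m') T"
proof -
  have "F_bounded (block_max m' (T y))" "F_sup (block_max m' (T y)) \<le> C * F_sup (block_max m y)"
    if "\<forall>k. y k \<in> linf (m k)" "F_bounded (block_max m y)" for y
    using F_sup_dominated[OF that(2) C, of "block_max m' (T y)"] * that(1) by blast+
  then show ?thesis using assms(1-3) C unfolding linf_sum_def by auto
qed

text \<open>Makes S itself one of the sums. The two maps are taking coordinates and summing the
  series.\<close>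

lemma linf_sum_of_S: "linear_iso S_space (linf_sum (\<lambda>_. 1))"
proof -
  define cf where "cf x = (THE y. represents y x)" for x
  have cf: "represents (cf x) x" for x
  proof -
    obtain y where "represents y x" using represents_surj by blast
    then show ?thesis unfolding cf_def
      by (rule theI[where P = "\<lambda>y. represents y x"]) (rule represents_inj[OF _ \<open>represents y x\<close>])
  qed
  have cf_eq: "cf x = y" if "represents y x" for x y by (rule represents_inj[OF cf that])
  define T where "T x = (\<lambda>k i. if i = (0::nat) then cf x k else 0)" for x
  define R where "R y = (THE x. represents (\<lambda>k. y k 0) x)" for y :: "nat \<Rightarrow> nat \<Rightarrow> 'k"
  have R_eq: "R y = x" if "represents (\<lambda>k. y k 0) x" for x y
    unfolding R_def using that represents_unique by blast
  have bm: "block_max (\<lambda>_. 1) (T x) = (\<lambda>k. norm (cf x k))" for x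
    by (simp add: block_max_1 T_def fun_eq_iff)
  have bm': "block_max (\<lambda>_. 1) y = (\<lambda>k. norm (y k 0))" for y
    by (simp add: block_max_1 fun_eq_iff)
  have R: "represents (\<lambda>k. y k 0) (R y)" if "F_bounded (block_max (\<lambda>_. 1) y)" for y
    using represents_ex[of "\<lambda>k. y k 0"] that R_eq unfolding bm' by blast
  show ?thesis
  proof (rule linear_isoI[OF _ nonneg_linf_sum])
    have T1: "T (x + y) = T x + T y" for x y
    proof -
      have "cf (x + y) = (\<lambda>k. cf x k + cf y k)" by (intro cf_eq represents_add cf)
      then show ?thesis by (auto simp: T_def fun_eq_iff)
    qed
    have T2: "T (scale c x) = (\<lambda>k i. c * T x k i)" for c x
    proof -
      have "cf (scale c x) = (\<lambda>k. c * cf x k)" by (intro cf_eq represents_scale cf)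
      then show ?thesis by (auto simp: T_def fun_eq_iff)
    qed
    have T3: "T x k \<in> linf 1" for x k by (simp add: T_def linf_def)
    show "bounded_linear_map S_space (linf_sum (\<lambda>_. 1)) T"
      unfolding linf_sum_def bounded_linear_map.simps
      using T1 T2 T3 represents_norm[OF cf] by (auto simp: bm[unfolded One_nat_def] intro!: exI[of _ "1::real"])
    show "bounded_linear_map (linf_sum (\<lambda>_. 1)) S_space R"
      unfolding linf_sum_def bounded_linear_map.simps
    proof (intro conjI ballI allI)
      fix x y assume "x \<in> {y. (\<forall>k. y k \<in> linf 1) \<and> F_bounded (block_max (\<lambda>_. 1) y)}"
        "y \<in> {y. (\<forall>k. y k \<in> linf 1) \<and> F_bounded (block_max (\<lambda>_. 1) y)}"
      then show "R (x + y) = R x + R y"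
        using represents_add[OF R R, of x y] by (intro R_eq) simp
    next
      fix c x assume "x \<in> {y. (\<forall>k. y k \<in> linf 1) \<and> F_bounded (block_max (\<lambda>_. 1) y)}"
      then show "R (\<lambda>k i. c * x k i) = scale c (R x)"
        using represents_scale[OF R, of x c] by (intro R_eq) simp
    next
      show "\<exists>C\<ge>0. \<forall>y\<in>{y. (\<forall>k. y k \<in> linf 1) \<and> F_bounded (block_max (\<lambda>_. 1) y)}.
          norm (R y) \<le> C * F_sup (block_max (\<lambda>_. 1) y)"
        using represents_norm(2)[OF R] by (intro exI[of _ "1::real"]) (auto simp: bm'[unfolded One_nat_def])
    qed auto
    show "R (T x) = x" for x by (rule R_eq) (simp add: T_def cf)
    show "T (R y) = y" if "y \<in> carrier_of (linf_sum (\<lambda>_. 1))" for y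
    proof -
      have y: "\<And>k. y k \<in> linf 1" "F_bounded (block_max (\<lambda>_. 1) y)" using that by (auto simp: linf_sum_def)
      have "cf (R y) = (\<lambda>k. y k 0)" by (rule cf_eq[OF R[OF y(2)]])
      then show ?thesis using y(1) by (auto simp: T_def fun_eq_iff linf_def)
    qed
  qed simp
qed

text \<open>Blocks are joined index by index: the maximum over a joined block is at most the sum of
  the two maxima and at least each of them.\<close>

lemma linf_sum_add:
  "linear_iso (prod_space (linf_sum m) (linf_sum m')) (linf_sum (\<lambda>k. m k + m' k))"
proof -
  let ?D = "\<lambda>m y. (\<forall>k. y k \<in> linf (m k)) \<and> F_bounded (block_max m y)"
  let ?a = "\<lambda>k. m k + m' k"
  let ?T = "\<lambda>(y, y') k i. if i < m k then y k i else y' k (i - m k)"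
  let ?R = "\<lambda>z. (\<lambda>k i. if i < m k then z k i else 0, \<lambda>k i. z k (m k + i))"
  let ?R1 = "\<lambda>z k i. if i < m k then z k i else (0::'k)"
  let ?R2 = "\<lambda>z k i. z k (m k + i) :: 'k"
  have T: "F_bounded (block_max ?a (?T (y, y')))"
    "F_sup (block_max ?a (?T (y, y'))) \<le> F_sup (block_max m y) + F_sup (block_max m' y')"
    if "F_bounded (block_max m y)" "F_bounded (block_max m' y')" for y y'
  proof -
    have "block_max ?a (?T (y, y')) k \<le> block_max m y k + block_max m' y' k" for k
    proof (rule block_max_le)
      show "0 \<le> block_max m y k + block_max m' y' k" by (simp add: block_max_nonneg)
      fix i assume i: "i < m k + m' k"
      have "i - m k < m' k" if "\<not> i < m k" using i that by linarith
      then show "norm (?T (y, y') k i) \<le> block_max m y k + block_max m' y' k"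
        using block_max_ge[of i m k y] block_max_ge[of "i - m k" m' k y']
          block_max_nonneg[of m y k] block_max_nonneg[of m' y' k] by (cases "i < m k") auto
    qed
    then have "F (window 0 n (block_max ?a (?T (y, y')))) \<le>
        F (window 0 n (block_max m y)) + F (window 0 n (block_max m' y'))" for n
      by (intro F_window_add) (simp add: abs_of_nonneg block_max_nonneg)
    then show "F_bounded (block_max ?a (?T (y, y')))"
      "F_sup (block_max ?a (?T (y, y'))) \<le> F_sup (block_max m y) + F_sup (block_max m' y')"
      using F_sup_dominated_sum[OF that] by blast+
  qed
  have R: "bounded_linear_map (linf_sum ?a) (linf_sum m) ?R1"
    "bounded_linear_map (linf_sum ?a) (linf_sum m') ?R2"
  proof -
    have le: "block_max m (?R1 z) k \<le> block_max ?a z k" "block_max m' (?R2 z) k \<le> block_max ?a z k" for z k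
      using block_max_ge[of _ ?a k z] by (auto intro!: block_max_le block_max_nonneg)
    have *: "\<exists>l. F (window 0 n b) \<le> 1 * F (window 0 l (block_max ?a z))"
      if "\<And>k. 0 \<le> b k" "\<And>k. b k \<le> block_max ?a z k" for n b z
      using that by (intro exI[of _ n]) (auto intro!: F_window_mono simp: abs_of_nonneg block_max_nonneg)
    show "bounded_linear_map (linf_sum ?a) (linf_sum m) ?R1"
      by (rule linf_sum_map[of _ _ _ 1])
        (use * le block_max_nonneg in \<open>auto simp: fun_eq_iff linf_def\<close>)
    show "bounded_linear_map (linf_sum ?a) (linf_sum m') ?R2"
      by (rule linf_sum_map[of _ _ _ 1])
        (use * le block_max_nonneg in \<open>auto simp: fun_eq_iff linf_def\<close>)
  qed
  show ?thesis
  proof (rule linear_isoI[of _ _ ?T ?R])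
    show "bounded_linear_map (prod_space (linf_sum m) (linf_sum m')) (linf_sum ?a) ?T"
      unfolding linf_sum_def prod_space.simps bounded_linear_map.simps
    proof (intro conjI ballI allI)
      fix x assume "x \<in> Collect (?D m) \<times> Collect (?D m')"
      then show "?T x \<in> Collect (?D ?a)" using T by (cases x) (auto simp: linf_def)
    next
      show "\<exists>C\<ge>0. \<forall>x\<in>Collect (?D m) \<times> Collect (?D m'). F_sup (block_max ?a (?T x)) \<le>
          C * (case x of (x, y) \<Rightarrow> F_sup (block_max m x) + F_sup (block_max m' y))"
        using T(2) by (intro exI[of _ "1::real"]) auto
    qed (auto simp: fun_eq_iff)
    obtain C where C: "0 \<le> C" "\<And>z. z \<in> Collect (?D ?a) \<Longrightarrow> F_sup (block_max m (?R1 z)) \<le> C * F_sup (block_max ?a z)"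
      using bounded_linear_map_bound[OF R(1)[unfolded linf_sum_def]] by blast
    obtain C' where C': "0 \<le> C'" "\<And>z. z \<in> Collect (?D ?a) \<Longrightarrow> F_sup (block_max m' (?R2 z)) \<le> C' * F_sup (block_max ?a z)"
      using bounded_linear_map_bound[OF R(2)[unfolded linf_sum_def]] by blast
    show "bounded_linear_map (linf_sum ?a) (prod_space (linf_sum m) (linf_sum m')) ?R"
      unfolding linf_sum_def prod_space.simps bounded_linear_map.simps
    proof (intro conjI ballI allI)
      fix x assume "x \<in> Collect (?D ?a)"
      then show "?R x \<in> Collect (?D m) \<times> Collect (?D m')"
        using bounded_linear_map_mem[OF R(1), of x] bounded_linear_map_mem[OF R(2), of x]
        by (simp add: linf_sum_def)
    next
      show "\<exists>C\<ge>0. \<forall>x\<in>Collect (?D ?a). (case ?R x of (x, y) \<Rightarrow> F_sup (block_max m x) + F_sup (block_max m' y)) \<le>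
          C * F_sup (block_max ?a x)"
        using C C' by (intro exI[of _ "C + C'"]) (auto simp: distrib_right intro!: add_mono)
    qed (auto simp: fun_eq_iff)
    show "?R (?T x) = x" if "x \<in> carrier_of (prod_space (linf_sum m) (linf_sum m'))" for x
      using that by (auto simp: linf_sum_def fun_eq_iff linf_def)
    show "?T (?R z) = z" for z by (auto simp: fun_eq_iff)
  qed (auto intro: nonneg_norm_prod nonneg_linf_sum)
qed

text \<open>Only the empty block of index 0 is dropped, and shifting the basis preserves the
  norm.\<close>

lemma linf_sum_shift:
  assumes "m 0 = 0"
  shows "linear_iso (linf_sum (\<lambda>k. m (Suc k))) (linf_sum m)"
proof -
  let ?T = "\<lambda>y k. case k of 0 \<Rightarrow> (\<lambda>_. 0) | Suc j \<Rightarrow> (y j :: nat \<Rightarrow> 'k)" and ?R = "\<lambda>z k. z (Suc k) :: nat \<Rightarrow> 'k"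
  have bmT: "block_max m (?T y) k = (case k of 0 \<Rightarrow> 0 | Suc j \<Rightarrow> block_max (\<lambda>k. m (Suc k)) y j)" for y k
    by (cases k) (simp_all add: block_max_def assms)
  have bmR: "block_max (\<lambda>k. m (Suc k)) (?R z) k = block_max m z (Suc k)" for z k
    by (simp add: block_max_def)
  show ?thesis
  proof (rule linear_isoI[OF nonneg_linf_sum nonneg_linf_sum, where T = ?T and S = ?R])
    show "bounded_linear_map (linf_sum (\<lambda>k. m (Suc k))) (linf_sum m) ?T"
    proof (rule linf_sum_map[of _ _ _ 1])
      show "\<exists>l. F (window 0 n (block_max m (?T y))) \<le> 1 * F (window 0 l (block_max (\<lambda>k. m (Suc k)) y))" for y n
      proof -
        have "F (window 0 n (block_max m (?T y))) \<le> F (window (0 - 1) (n - 1) (block_max (\<lambda>k. m (Suc k)) y))"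
        proof (rule spread_upper[where \<phi> = Suc])
          show "block_max m (?T y) i = 0" if "i \<notin> range Suc" for i
            using that by (cases i) (auto simp: bmT)
        qed (auto simp: bmT)
        then show ?thesis by auto
      qed
    qed (auto simp: fun_eq_iff linf_def split: nat.splits)
    show "bounded_linear_map (linf_sum m) (linf_sum (\<lambda>k. m (Suc k))) ?R"
    proof (rule linf_sum_map[of _ _ _ 1])
      show "\<exists>l. F (window 0 n (block_max (\<lambda>k. m (Suc k)) (?R y))) \<le> 1 * F (window 0 l (block_max m y))" for y n
      proof -
        have "F (window 0 n (block_max (\<lambda>k. m (Suc k)) (?R y))) \<le> F (window (Suc 0) (Suc n) (block_max m y))"
          by (rule block_lower[of Suc]) (auto simp: bmR F_singleton incseq_def)
        also have "\<dots> \<le> F (window 0 (Suc n) (block_max m y))" by (rule F_window_mono) auto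
        finally show ?thesis by auto
      qed
    qed (auto simp: fun_eq_iff)
    show "?T (?R z) = z" if "z \<in> carrier_of (linf_sum m)" for z
      using that assms by (auto simp: linf_sum_def fun_eq_iff linf_def split: nat.splits)
  qed simp
qed

text \<open>Together with \<open>linf_sum_add\<close> this makes S isomorphic to its square: the two
  coordinates of a block become an even and an odd coordinate.\<close>

lemma linf_sum_interleave: "linear_iso (linf_sum (\<lambda>_. 2)) (linf_sum (\<lambda>_. 1))"
proof -
  let ?T = "\<lambda>y k i. if i = (0::nat) then y (k div 2) (k mod 2) else (0::'k)"
  let ?R = "\<lambda>z k i. if i < 2 then z (2 * k + i) 0 else (0::'k)"
  show ?thesis
  proof (rule linear_isoI[OF nonneg_linf_sum nonneg_linf_sum, where T = ?T and S = ?R])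
    show "bounded_linear_map (linf_sum (\<lambda>_. 2)) (linf_sum (\<lambda>_. 1)) ?T"
    proof (rule linf_sum_map[of _ _ _ 2])
      fix y :: "nat \<Rightarrow> nat \<Rightarrow> 'k" and n
      let ?b = "block_max (\<lambda>_. 2) y"
      let ?x = "block_max (\<lambda>_. 1) (?T y)"
      \<comment> \<open>The even and the odd half are each a spread of a sequence dominated by
        \<open>?b\<close>, whence the constant 2. The bounds of the windows below arise because
        \<open>(s + 1) div 2\<close> numbers \<open>k\<close> satisfy \<open>2 * k < s\<close>, and
        \<open>s div 2\<close> satisfy \<open>2 * k + 1 < s\<close>.\<close>
      let ?e = "\<lambda>k. if even k then ?x k else 0" and ?o = "\<lambda>k. if odd k then ?x k else 0"
      have x: "?x k \<le> ?b (k div 2)" "0 \<le> ?x k" for k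
        by (auto simp: block_max_1 intro!: block_max_ge)
      have "F (window 0 n ?x) \<le> F (window 0 n ?e) + F (window 0 n ?o)"
        by (intro F_window_add) auto
      also have "F (window 0 n ?e) \<le> F (window ((0 + 1) div 2) ((n + 1) div 2) ?b)"
      proof (rule spread_upper[where \<phi> = "\<lambda>k. 2 * k"])
        show "?e i = 0" if "i \<notin> range (\<lambda>k. 2 * k)" for i using that by (auto elim: evenE)
        show "norm (?e (2 * k)) \<le> norm (?b k)" for k using x[of "2 * k"] by simp
      qed auto
      also have "\<dots> \<le> F (window 0 (n + 1) ?b)" by (rule F_window_mono) auto
      also have "F (window 0 n ?o) \<le> F (window (0 div 2) (n div 2) ?b)"
      proof (rule spread_upper[where \<phi> = "\<lambda>k. 2 * k + 1"])
        show "?o i = 0" if "i \<notin> range (\<lambda>k. 2 * k + 1)" for i using that by (auto elim: oddE)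
        show "norm (?o (2 * k + 1)) \<le> norm (?b k)" for k using x[of "2 * k + 1"] by simp
      qed auto
      also have "\<dots> \<le> F (window 0 (n + 1) ?b)" by (rule F_window_mono) auto
      finally show "\<exists>l. F (window 0 n ?x) \<le> 2 * F (window 0 l ?b)" by (intro exI[of _ "n + 1"]) simp
    qed (auto simp: fun_eq_iff linf_def)
    show "bounded_linear_map (linf_sum (\<lambda>_. 1)) (linf_sum (\<lambda>_. 2)) ?R"
    proof (rule linf_sum_map[of _ _ _ 1])
      fix z :: "nat \<Rightarrow> nat \<Rightarrow> 'k" and n
      let ?b = "block_max (\<lambda>_. 1) z"
      have "F (window 0 n (block_max (\<lambda>_. 2) (?R z))) \<le> F (window (2 * 0) (2 * n) ?b)"
      proof (rule block_lower[of "\<lambda>k. 2 * k"])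
        fix k
        have "block_max (\<lambda>_. 2) (?R z) k \<le> F (window (2 * k) (2 * Suc k) ?b)"
        proof (rule block_max_le[OF F_window_nonneg])
          fix i :: nat assume "i < 2"
          then show "norm (?R z k i) \<le> F (window (2 * k) (2 * Suc k) ?b)"
            using norm_le_F_window[of "2 * k" "2 * k + i" "2 * Suc k" ?b] by (simp add: block_max_1)
        qed
        then show "norm (block_max (\<lambda>_. 2) (?R z) k) \<le> F (window (2 * k) (2 * Suc k) ?b)"
          by (simp add: block_max_nonneg)
      qed (simp add: incseq_def)
      then show "\<exists>l. F (window 0 n (block_max (\<lambda>_. 2) (?R z))) \<le> 1 * F (window 0 l ?b)" by auto
    qed (auto simp: fun_eq_iff linf_def)
    show "?R (?T y) = y" if "y \<in> carrier_of (linf_sum (\<lambda>_. 2))" for y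
      using that by (auto simp: linf_sum_def fun_eq_iff linf_def)
    show "?T (?R z) = z" if "z \<in> carrier_of (linf_sum (\<lambda>_. 1))" for z
      using that by (auto simp: linf_sum_def fun_eq_iff linf_def)
  qed
qed

text \<open>\<open>T\<close> spreads each coordinate over its piece of a block, \<open>Q\<close>
  recovers it by a weighted mean over the piece. \<open>T\<close> is bounded because the blocks are
  dominated by the basis; \<open>Q\<close> is bounded because each of its functionals has norm at
  most 2 on its block and successive blocks dominate the basis.\<close>

lemma linf_sum_complemented:
  fixes p :: "nat \<Rightarrow> nat"
  obtains Z where "linear_iso S_space (prod_space (linf_sum p) (scale, Z, norm))"
proof -
  obtain t w S where t: "incseq t" "\<And>k. k \<le> t k" "t 0 = 0"
    and dom: "\<forall>b x m. (\<forall>k. 0 \<le> b k) \<longrightarrow> (\<forall>k i. t k \<le> i \<longrightarrow> i < t (Suc k) \<longrightarrow> \<bar>x i\<bar> \<le> b k * w i) \<longrightarrow>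
        F (window 0 (t m) x) \<le> 23 * F (window 0 m b)"
    and w: "\<And>i. 0 \<le> w i"
    and S: "\<And>k j. j < p k \<Longrightarrow> S k j \<subseteq> {t k..<t (Suc k)}" "\<And>k j. j < p k \<Longrightarrow> S k j \<noteq> {}"
    and disj: "\<And>k j j'. j < p k \<Longrightarrow> j' < p k \<Longrightarrow> j \<noteq> j' \<Longrightarrow> S k j \<inter> S k j' = {}"
    and big: "\<And>k j. j < p k \<Longrightarrow> schlumprecht_f (real (card (S k j))) \<le> 2 * (\<Sum>i\<in>S k j. w i)"
    by (rule linf_blocks_exist[of p]) (rule that)
  \<comment> \<open>As the pieces are pairwise disjoint, also across blocks, \<open>pos\<close>
    picks the only piece that contains \<open>i\<close>.\<close>
  define occ where "occ i kj \<longleftrightarrow> snd kj < p (fst kj) \<and> i \<in> S (fst kj) (snd kj)" for i kj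
  define pos where "pos i = (SOME kj. occ i kj)" for i
  have same_block: "k' = k" if "t k' \<le> i" "i < t (Suc k')" "t k \<le> i" "i < t (Suc k)" for i k k'
    using that incseqD[OF t(1), of "Suc k'" k] incseqD[OF t(1), of "Suc k" k']
    by (cases k k' rule: linorder_cases) auto
  have uniq: "kj = (k, j)" if "occ i kj" "j < p k" "i \<in> S k j" for i kj k j
  proof -
    obtain k' j' where kj: "kj = (k', j')" by (cases kj)
    have o: "j' < p k'" "i \<in> S k' j'" using that(1) by (auto simp: occ_def kj)
    have b: "t k' \<le> i" "i < t (Suc k')" "t k \<le> i" "i < t (Suc k)"
      using S(1)[OF o(1)] S(1)[OF that(2)] o(2) that(3) by auto
    have "k' = k" using same_block b by blast
    then show ?thesis using disj[OF o(1), of j] o(2) that(2,3) kj by auto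
  qed
  have pos: "pos i = (k, j)" if "j < p k" "i \<in> S k j" for i k j
  proof -
    have "occ i (k, j)" using that by (simp add: occ_def)
    then have "occ i (pos i)" unfolding pos_def by (rule someI)
    then show ?thesis using that by (rule uniq)
  qed
  define T where "T y = (\<lambda>i l. if l = (0::nat) \<and> (\<exists>kj. occ i kj) then
      y (fst (pos i)) (snd (pos i)) * of_real (w i) else 0)" for y :: "nat \<Rightarrow> nat \<Rightarrow> 'k"
  have T_on: "T y i 0 = y k j * of_real (w i)" if "j < p k" "i \<in> S k j" for y i k j
  proof -
    have "occ i (k, j)" using that by (simp add: occ_def)
    then have "\<exists>kj. occ i kj" by blast
    then show ?thesis using pos[OF that] by (simp add: T_def)
  qed
  define Q where "Q x = (\<lambda>k j. if j < p k then (\<Sum>i\<in>S k j. x i (0::nat)) / of_real (\<Sum>i\<in>S k j. w i) else 0)"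
    for x :: "nat \<Rightarrow> nat \<Rightarrow> 'k"
  have sum_pos: "0 < (\<Sum>i\<in>S k j. w i)" if "j < p k" for k j
  proof -
    have "finite (S k j)" using S(1)[OF that] by (rule finite_subset) simp
    then have "1 \<le> card (S k j)" using S(2)[OF that] by (simp add: Suc_le_eq card_gt_0_iff)
    then have "1 \<le> schlumprecht_f (real (card (S k j)))" by (intro schlumprecht_f_ge_1) simp
    then show ?thesis using big[OF that] by linarith
  qed
  have T: "bounded_linear_map (linf_sum p) (linf_sum (\<lambda>_. 1)) T"
  proof (rule linf_sum_map[of _ _ _ 23])
    fix y :: "nat \<Rightarrow> nat \<Rightarrow> 'k" and n
    have "F (window 0 n (block_max (\<lambda>_. 1) (T y))) \<le> F (window 0 (t n) (block_max (\<lambda>_. 1) (T y)))"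
      using t(2)[of n] by (intro F_window_mono) auto
    also have "\<dots> \<le> 23 * F (window 0 n (block_max p y))"
    proof (rule dom[rule_format])
      fix k i assume i: "t k \<le> i" "i < t (Suc k)"
      show "\<bar>block_max (\<lambda>_. 1) (T y) i\<bar> \<le> block_max p y k * w i"
      proof (cases "\<exists>kj. occ i kj")
        case True
        then obtain k' j where o: "j < p k'" "i \<in> S k' j" by (auto simp: occ_def)
        have "t k' \<le> i" "i < t (Suc k')" using S(1)[OF o(1)] o(2) by auto
        then have "k' = k" using same_block i by blast
        then have "norm (y k' j) * w i \<le> block_max p y k * w i"
          using block_max_ge[of j p k y] o w by (intro mult_right_mono) auto
        then show ?thesis using w[of i] unfolding block_max_1 T_on[OF o] by (simp add: norm_mult)
      next
        case False
        then show ?thesis unfolding block_max_1 using w[of i] block_max_nonneg[of p y k] by (simp add: T_def)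
      qed
    qed (rule block_max_nonneg)
    finally show "\<exists>l. F (window 0 n (block_max (\<lambda>_. 1) (T y))) \<le> 23 * F (window 0 l (block_max p y))" by blast
  qed (auto simp: T_def fun_eq_iff linf_def distrib_right)
  have Q: "bounded_linear_map (linf_sum (\<lambda>_. 1)) (linf_sum p) Q"
  proof (rule linf_sum_map[of _ _ _ 2])
    fix x :: "nat \<Rightarrow> nat \<Rightarrow> 'k" and n
    let ?a = "block_max (\<lambda>_. 1) x"
    have "F (window 0 n (block_max p (Q x))) \<le> F (window (t 0) (t n) (\<lambda>i. 2 * ?a i))"
    proof (rule block_lower[OF t(1)])
      fix k
      have "block_max p (Q x) k \<le> F (window (t k) (t (Suc k)) (\<lambda>i. 2 * ?a i))"
      proof (rule block_max_le[OF F_window_nonneg])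
        fix j assume j: "j < p k"
        let ?s = "\<Sum>i\<in>S k j. w i"
        have "norm (Q x k j) = norm (\<Sum>i\<in>S k j. x i 0) / ?s"
          using j sum_pos[OF j] by (simp add: Q_def norm_divide del: of_real_sum)
        also have "\<dots> \<le> (\<Sum>i\<in>S k j. norm (?a i)) / ?s"
          using sum_pos[OF j] by (intro divide_right_mono order_trans[OF norm_sum]) (auto simp: block_max_1)
        also have "\<dots> \<le> (2 * ?s * F (window (t k) (t (Suc k)) ?a)) / ?s"
          using sum_pos[OF j] by (intro divide_right_mono order_trans[OF sum_le_F_window[OF S(1)[OF j]]]
            mult_right_mono big[OF j] F_window_nonneg) auto
        also have "\<dots> = F (window (t k) (t (Suc k)) (\<lambda>i. 2 * ?a i))"
          using sum_pos[OF j] by (simp add: F_window_scale)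
        finally show "norm (Q x k j) \<le> F (window (t k) (t (Suc k)) (\<lambda>i. 2 * ?a i))" .
      qed
      then show "norm (block_max p (Q x) k) \<le> F (window (t k) (t (Suc k)) (\<lambda>i. 2 * ?a i))"
        by (simp add: block_max_nonneg)
    qed
    also have "\<dots> = 2 * F (window 0 (t n) ?a)" by (simp add: F_window_scale t(3))
    finally show "\<exists>l. F (window 0 n (block_max p (Q x))) \<le> 2 * F (window 0 l ?a)" by blast
  next
    show "Q (x + y) = Q x + Q y" for x y
      by (simp add: Q_def fun_eq_iff sum.distrib add_divide_distrib del: of_real_sum)
    show "Q (\<lambda>k i. c * y k i) = (\<lambda>k i. c * Q y k i)" for c y
      by (simp add: Q_def fun_eq_iff del: of_real_sum flip: sum_distrib_left)
    show "Q x k \<in> linf (p k)" for x k by (simp add: Q_def linf_def)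
  qed simp
  have QT: "Q (T y) = y" if "y \<in> carrier_of (linf_sum p)" for y
  proof (intro ext)
    fix k j
    show "Q (T y) k j = y k j"
    proof (cases "j < p k")
      case True
      have "(\<Sum>i\<in>S k j. T y i 0) = (\<Sum>i\<in>S k j. y k j * of_real (w i))"
        by (intro sum.cong refl T_on True)
      also have "\<dots> = y k j * of_real (\<Sum>i\<in>S k j. w i)" by (simp add: sum_distrib_left)
      finally show ?thesis using True sum_pos[OF True] by (simp add: Q_def del: of_real_sum)
    next
      case False
      then show ?thesis using that by (simp add: Q_def linf_sum_def linf_def)
    qed
  qed
  obtain A B where A: "bounded_linear_map S_space (linf_sum (\<lambda>_. 1)) A"
    and B: "bounded_linear_map (linf_sum (\<lambda>_. 1)) S_space B"
    and AB: "\<And>y. y \<in> carrier_of (linf_sum (\<lambda>_. 1)) \<Longrightarrow> A (B y) = y"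
    by (rule linear_isoE[OF linf_sum_of_S]) (rule that)
  have "linear_iso S_space (prod_space (linf_sum p) (scale, {x. (Q \<circ> A) x = 0}, norm))"
  proof (rule linear_iso_complement)
    show "bounded_linear_map (linf_sum p) S_space (B \<circ> T)" by (rule bounded_linear_map_comp[OF T B])
    show "bounded_linear_map S_space (linf_sum p) (Q \<circ> A)" by (rule bounded_linear_map_comp[OF A Q])
    show "(Q \<circ> A) ((B \<circ> T) y) = y" if "y \<in> carrier_of (linf_sum p)" for y
      using QT[OF that] AB[OF bounded_linear_map_mem[OF T that]] by simp
  qed (auto intro: nonneg_linf_sum scale_right_diff_distrib)
  then show ?thesis by (rule that)
qed

section \<open>Absorption of the given sum\<close>

lemma S_iso_linf_sum:
  assumes n: "\<And>k. 0 < n k"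
  shows "linear_iso S_space (linf_sum n)"
proof -
  note [simp] = nonneg_linf_sum nonneg_norm_prod
  have nS: "nonneg_norm S_space" by simp
  \<comment> \<open>One coordinate is taken off each block, so L(n) = S + L(n'). With S + S = S this
    yields S + L(n) = L(n).\<close>
  define n' where "n' k = n k - 1" for k
  define p where "p = rec_nat 0 (\<lambda>k s. s + n k)"
  have p0: "p 0 = 0" and pS: "p (Suc k) = p k + n k" for k by (simp_all add: p_def)
  let ?L = linf_sum
  obtain Z where Z: "linear_iso S_space (prod_space (?L p) (scale, Z, norm))" (is "linear_iso _ (prod_space _ ?Z)")
    by (rule linf_sum_complemented)
  have nZ: "nonneg_norm ?Z" by simp
  note refl = linear_iso_refl[OF nS] linear_iso_refl[OF nonneg_linf_sum] linear_iso_refl[OF nZ]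
  have SS: "linear_iso (prod_space S_space S_space) S_space"
  proof -
    have "linear_iso (prod_space S_space S_space) (prod_space (?L (\<lambda>_. 1)) (?L (\<lambda>_. 1)))"
      by (intro linear_iso_prod linf_sum_of_S)
    also have "linear_iso \<dots> (?L (\<lambda>_. 2))" using linf_sum_add[of "\<lambda>_. 1" "\<lambda>_. 1"] by (simp add: numeral_2_eq_2)
    also have "linear_iso \<dots> (?L (\<lambda>_. 1))" by (rule linf_sum_interleave)
    also have "linear_iso \<dots> S_space" by (rule linear_iso_sym[OF linf_sum_of_S])
    finally show ?thesis .
  qed
  have n1: "linear_iso (prod_space S_space (?L n')) (?L n)"
  proof -
    have "(\<lambda>k. 1 + n' k) = n" using n by (auto simp: n'_def fun_eq_iff Suc_leI)
    then have "linear_iso (prod_space (?L (\<lambda>_. 1)) (?L n')) (?L n)"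
      using linf_sum_add[of "\<lambda>_. 1" n'] by simp
    then show ?thesis by (rule linear_iso_trans[OF linear_iso_prod[OF linf_sum_of_S refl(2)]])
  qed
  have "linear_iso (?L n) (prod_space S_space (?L n'))" by (rule linear_iso_sym[OF n1])
  also have "linear_iso \<dots> (prod_space (prod_space S_space S_space) (?L n'))"
    by (intro linear_iso_prod linear_iso_sym[OF SS] refl)
  also have "linear_iso \<dots> (prod_space S_space (prod_space S_space (?L n')))"
    by (intro linear_iso_assoc nS nonneg_linf_sum)
  also have "linear_iso \<dots> (prod_space S_space (?L n))"
    by (intro linear_iso_prod n1 refl)
  also have "linear_iso \<dots> (prod_space (prod_space (?L p) ?Z) (?L n))"
    by (intro linear_iso_prod Z refl)
  also have "linear_iso \<dots> (prod_space (prod_space ?Z (?L p)) (?L n))"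
    by (intro linear_iso_prod linear_iso_commute nonneg_linf_sum nZ refl)
  also have "linear_iso \<dots> (prod_space ?Z (prod_space (?L p) (?L n)))"
    by (intro linear_iso_assoc nZ nonneg_linf_sum)
  also have "linear_iso \<dots> (prod_space ?Z (?L (\<lambda>k. p k + n k)))"
    by (intro linear_iso_prod linf_sum_add refl)
  \<comment> \<open>As \<open>p k + n k = p (Suc k)\<close>, the sum reached is L(p) without its
    empty first block.\<close>
  also have "linear_iso \<dots> (prod_space ?Z (?L p))"
    using linf_sum_shift[of p, OF p0] by (intro linear_iso_prod refl) (simp add: pS)
  also have "linear_iso \<dots> (prod_space (?L p) ?Z)"
    by (intro linear_iso_commute nZ nonneg_linf_sum)
  also have "linear_iso \<dots> S_space" by (rule linear_iso_sym[OF Z])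
  finally show ?thesis by (rule linear_iso_sym)
qed

section \<open>Identification with the sum defined by convergence\<close>

lemma partial_sums:
  "(\<Sum>k<n. a k *\<^sub>R J (unit_seq k)) = J (window 0 n (\<lambda>k. of_real (a k)))"
proof (induction n)
  case 0
  have "J (\<lambda>_. 0) = 0" by (rule norm_eq_zero[THEN iffD1]) (rule J.F_0)
  then show ?case by (simp add: window_empty)
next
  case (Suc n)
  have "window 0 (Suc n) (\<lambda>k. of_real (a k) :: 'k) = window 0 n (\<lambda>k. of_real (a k)) + (\<lambda>i. of_real (a n) * unit_seq n i)"
    by (auto simp: window_def unit_seq_def fun_eq_iff less_Suc_eq)
  then have "J (window 0 (Suc n) (\<lambda>k. of_real (a k))) =
      J (window 0 n (\<lambda>k. of_real (a k))) + scale (of_real (a n)) (J (unit_seq n))"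
    by (simp only: J_add[OF window_c00 scale_c00[OF unit_seq_c00]] J_scale[OF unit_seq_c00])
  then show ?case using Suc by (simp add: scale_of_real)
qed

lemma sums_iff_represents: "(\<lambda>k. a k *\<^sub>R J (unit_seq k)) sums x \<longleftrightarrow> represents (\<lambda>k. of_real (a k)) x"
  by (simp add: sums_def represents_def partial_sums)

text \<open>The sequence of block norms is read as coordinates of a vector of S: its series
  converges if and only if its windows are bounded, and the norm of the sum is their
  supremum.\<close>

lemma direct_sum_eq:
  assumes n: "\<And>k. 0 < n k"
  shows "direct_sum (\<lambda>k. J (unit_seq k)) (\<lambda>k. linf (n k)) (\<lambda>k. linf_norm (n k)) =
      {y. (\<forall>k. y k \<in> linf (n k)) \<and> F_bounded (block_max n y)}"
    and "F_bounded (block_max n y) \<Longrightarrow>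
      direct_sum_norm (\<lambda>k. J (unit_seq k)) (\<lambda>k. linf_norm (n k)) y = F_sup (block_max n y)"
proof -
  let ?r = "\<lambda>y k. of_real (block_max n y k) :: 'k"
  have norm_r: "(\<lambda>k. norm (?r y k)) = block_max n y" for y by (simp add: block_max_nonneg)
  have e: "linf_norm (n k) (y k) = block_max n y k" for y k by (simp add: block_max_linf_norm n)
  have "summable (\<lambda>k. block_max n y k *\<^sub>R J (unit_seq k)) \<longleftrightarrow> F_bounded (block_max n y)" for y
    unfolding summable_def sums_iff_represents
    using represents_norm(1)[of "?r y"] represents_ex[of "?r y"] unfolding norm_r by blast
  then show "direct_sum (\<lambda>k. J (unit_seq k)) (\<lambda>k. linf (n k)) (\<lambda>k. linf_norm (n k)) =
      {y. (\<forall>k. y k \<in> linf (n k)) \<and> F_bounded (block_max n y)}"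
    by (simp add: direct_sum_def e)
  show "direct_sum_norm (\<lambda>k. J (unit_seq k)) (\<lambda>k. linf_norm (n k)) y = F_sup (block_max n y)"
    if bdd: "F_bounded (block_max n y)"
  proof -
    obtain x where x: "represents (?r y) x" using represents_ex[of "?r y"] bdd unfolding norm_r by blast
    then have "(\<Sum>k. block_max n y k *\<^sub>R J (unit_seq k)) = x"
      unfolding sums_iff_represents[symmetric] by (rule sums_unique[symmetric])
    then show ?thesis using represents_norm(2)[OF x] unfolding norm_r by (simp add: direct_sum_norm_def e)
  qed
qed

end

theorem proposition3:
  fixes scale :: "'k::{real_normed_field,banach} \<Rightarrow> 's::banach \<Rightarrow> 's"
    and J :: "(nat \<Rightarrow> 'k) \<Rightarrow> 's"
    and n :: "nat \<Rightarrow> nat"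
  assumes "schlumprecht_space scale J"
    and "\<And>k. n k > 0"
  shows "isomorphic_spaces
    scale UNIV norm
    (\<lambda>c (y :: nat \<Rightarrow> nat \<Rightarrow> 'k) k i. c * y k i)
    (direct_sum (\<lambda>k. J (unit_seq k)) (\<lambda>k. linf (n k)) (\<lambda>k. linf_norm (n k)))
    (direct_sum_norm (\<lambda>k. J (unit_seq k)) (\<lambda>k. linf_norm (n k)))"
proof -
  interpret schlumprecht_space scale J by (rule assms(1))
  show ?thesis
    unfolding direct_sum_eq(1)[OF assms(2)]
    by (rule linear_iso_imp_isomorphic_spaces[OF S_iso_linf_sum[OF assms(2), unfolded linf_sum_def]])
      (simp add: direct_sum_eq(2)[OF assms(2)])
qed

end
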